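(* Let $k\ge1$, $m\ge0$, $n\ge2$, let $a_1,\dots,a_m$ be integers with $a_s>1$ for all $s$, and let $l_1,\dots,l_n$ be integers with $l_j>1$ for all $j$. Let $X\subset\mathbb{A}^{k+m+n}$ be the trinomial hypersurface over $\mathbb{K}$ given by $$x_1\cdots x_k\,y_1^{a_1}\cdots y_m^{a_m}=z_1^{l_1}\cdots z_n^{l_n}+1.$$ Then no irreducible homogeneous LND of $\mathbb{K}[X]$ is maximal. Moreover, a homogeneous LND of $\mathbb{K}[X]$ is maximal if and only if it is of the form $h\,\partial_{ij}$ for some $1\le i\le k$, $1\le j\le n$, where $h$ is a homogeneous polynomial that does not contain $z_j$ and $x_i$ and contains all $z_s$, $s\ne j$.
   Context: $\mathbb{K}$ is an algebraically closed field of characteristic zero. A derivation of $B=\mathbb{K}[X]$ is locally nilpotent (LND) if each element of $B$ is killed by some power of it. A nonzero LND $\delta$ is irreducible if $\delta(B)$ is not contained in any proper principal ideal of $B$. Two LNDs are equivalent if their kernels coincide; a nonzero LND is maximal if every nonzero LND of $B$ commuting with it is equivalent to it. $B$ is graded by $K=\mathbb{Z}^{k+m+n}/\langle(1,\dots,1,a_1,\dots,a_m,0,\dots,0),(0,\dots,0,l_1,\dots,l_n)\rangle$, where the generators $x_1,\dots,x_k,y_1,\dots,y_m,z_1,\dots,z_n$ are homogeneous of degrees the classes of the standard basis vectors (this is the grading corresponding to the quasitorus of all diagonal rescalings of the variables leaving $x_1\cdots x_ky_1^{a_1}\cdots y_m^{a_m}$ and $z_1^{l_1}\cdots z_n^{l_n}$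 invariant). "Homogeneous" refers to this grading; a derivation is homogeneous if it sends homogeneous elements to homogeneous elements. A polynomial contains a variable if the variable occurs in it. For $1\le i\le k$, $1\le j\le n$ the LND $\partial_{ij}$ of $B$ is defined by $\partial_{ij}(x_i)=l_jz_j^{l_j-1}\prod_{s\ne j}z_s^{l_s}$, $\partial_{ij}(z_j)=y_1^{a_1}\cdots y_m^{a_m}\prod_{s\ne i}x_s$, and $\partial_{ij}(x_r)=\partial_{ij}(y_s)=\partial_{ij}(z_p)=0$ for $r\ne i$, $1\le s\le m$, $p\ne j$. Up to nonzero scalar factors these are all the irreducible homogeneous LNDs of $B$. The polynomial $h$ is a nonzero polynomial in the variables $x_r$ ($r\ne i$), $y_1,\dots,y_m$, $z_s$ ($s\ne j$), which generate $\mathrm{Ker}(\partial_{ij})$. *)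

theory Defs
  imports
    "HOL-Algebra.QuotRing"
    "HOL-Algebra.Generated_Groups"
    "HOL-Algebra.Free_Abelian_Groups"
    "HOL-Computational_Algebra.Polynomial"
begin

section \<open>Locally nilpotent derivations\<close>

text \<open>
  Throughout, \<open>R\<close> is an algebra over a field \<open>'a\<close> with structure map \<open>\<iota>\<close>.
  Derivations are extensional functions on the carrier, so that equality of derivations is
  equality of functions.
\<close>

definition derivation :: "('r, 'm) ring_scheme \<Rightarrow> ('a \<Rightarrow> 'r) \<Rightarrow> ('r \<Rightarrow> 'r) \<Rightarrow> bool" where
  "derivation R \<iota> D \<longleftrightarrow>
     D \<in> carrier R \<rightarrow>\<^sub>E carrier R \<and>
     (\<forall>b\<in>carrier R. \<forall>c\<in>carrier R. D (b \<oplus>\<^bsub>R\<^esub> c) = D b \<oplus>\<^bsub>R\<^esub> D c) \<and>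
     (\<forall>t. \<forall>b\<in>carrier R. D (\<iota> t \<otimes>\<^bsub>R\<^esub> b) = \<iota> t \<otimes>\<^bsub>R\<^esub> D b) \<and>
     (\<forall>b\<in>carrier R. \<forall>c\<in>carrier R.
        D (b \<otimes>\<^bsub>R\<^esub> c) = (D b \<otimes>\<^bsub>R\<^esub> c) \<oplus>\<^bsub>R\<^esub> (b \<otimes>\<^bsub>R\<^esub> D c))"

definition LND :: "('r, 'm) ring_scheme \<Rightarrow> ('a \<Rightarrow> 'r) \<Rightarrow> ('r \<Rightarrow> 'r) \<Rightarrow> bool" where
  "LND R \<iota> D \<longleftrightarrow> derivation R \<iota> D \<and> (\<forall>b\<in>carrier R. \<exists>N. (D ^^ N) b = \<zero>\<^bsub>R\<^esub>)"

definition nonzero_LND :: "('r, 'm) ring_scheme \<Rightarrow> ('a \<Rightarrow> 'r) \<Rightarrow> ('r \<Rightarrow> 'r) \<Rightarrow> bool" where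
  "nonzero_LND R \<iota> D \<longleftrightarrow> LND R \<iota> D \<and> (\<exists>b\<in>carrier R. D b \<noteq> \<zero>\<^bsub>R\<^esub>)"

definition irreducible_LND :: "('r, 'm) ring_scheme \<Rightarrow> ('a \<Rightarrow> 'r) \<Rightarrow> ('r \<Rightarrow> 'r) \<Rightarrow> bool" where
  "irreducible_LND R \<iota> D \<longleftrightarrow> nonzero_LND R \<iota> D \<and>
     (\<forall>J. principalideal J R \<and> J \<noteq> carrier R \<longrightarrow> \<not> D ` carrier R \<subseteq> J)"

definition equivalent_LND :: "('r, 'm) ring_scheme \<Rightarrow> ('r \<Rightarrow> 'r) \<Rightarrow> ('r \<Rightarrow> 'r) \<Rightarrow> bool" where
  "equivalent_LND R D E \<longleftrightarrow> a_kernel R R D = a_kernel R R E"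

definition maximal_LND :: "('r, 'm) ring_scheme \<Rightarrow> ('a \<Rightarrow> 'r) \<Rightarrow> ('r \<Rightarrow> 'r) \<Rightarrow> bool" where
  "maximal_LND R \<iota> D \<longleftrightarrow> nonzero_LND R \<iota> D \<and>
     (\<forall>E. nonzero_LND R \<iota> E \<and> (\<forall>b\<in>carrier R. D (E b) = E (D b)) \<longrightarrow> equivalent_LND R E D)"


section \<open>Polynomials\<close>

datatype variable = XVar nat | YVar nat | ZVar nat

text \<open>A polynomial maps each exponent vector to its coefficient.\<close>

type_synonym 'a mpoly = "(variable \<Rightarrow>\<^sub>0 nat) \<Rightarrow>\<^sub>0 'a"

definition const :: "'a::zero \<Rightarrow> 'a mpoly" where
  "const t = Poly_Mapping.single 0 t"

definition var :: "variable \<Rightarrow> 'a::zero_neq_one mpoly" where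
  "var v = Poly_Mapping.single (Poly_Mapping.single v 1) 1"

definition occurring_vars :: "'a::zero mpoly \<Rightarrow> variable set" where
  "occurring_vars p = (\<Union>e\<in>Poly_Mapping.keys p. Poly_Mapping.keys e)"

definition mpoly_ring :: "variable set \<Rightarrow> 'a::comm_ring_1 mpoly ring" where
  "mpoly_ring V =
     \<lparr>carrier = {p. occurring_vars p \<subseteq> V},
      monoid.mult = (*), monoid.one = 1, ring.zero = 0, ring.add = (+)\<rparr>"


section \<open>The trinomial hypersurface and its grading\<close>

text \<open>
  The variables are \<open>XVar 1, \<dots>, XVar k\<close>, \<open>YVar 1, \<dots>, YVar m\<close>, \<open>ZVar 1, \<dots>, ZVar n\<close>.
\<close>

context
  fixes k m n :: nat and a l :: "nat \<Rightarrow> nat"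
begin

definition variables :: "variable set" where
  "variables = XVar ` {1..k} \<union> YVar ` {1..m} \<union> ZVar ` {1..n}"

definition trinomial :: "'a::comm_ring_1 mpoly" where
  "trinomial = (\<Prod>r\<in>{1..k}. var (XVar r)) * (\<Prod>s\<in>{1..m}. var (YVar s) ^ a s)
     - ((\<Prod>s\<in>{1..n}. var (ZVar s) ^ l s) + 1)"

definition trinomial_ideal :: "'a::comm_ring_1 mpoly set" where
  "trinomial_ideal = PIdl\<^bsub>mpoly_ring variables\<^esub> trinomial"

definition coordinate_ring :: "'a::comm_ring_1 mpoly set ring" where
  "coordinate_ring = mpoly_ring variables Quot trinomial_ideal"

definition residue_class :: "'a::comm_ring_1 mpoly \<Rightarrow> 'a mpoly set" where
  "residue_class p = trinomial_ideal +>\<^bsub>mpoly_ring variables\<^esub> p"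

definition scalar :: "'a::comm_ring_1 \<Rightarrow> 'a mpoly set" where
  "scalar t = residue_class (const t)"

text \<open>
  The grading group is \<open>\<int>\<^bsup>k+m+n\<^esup>\<close>, realised as the free abelian group on the variables, modulo the
  subgroup generated by the exponent vectors of the two nonconstant monomials of the trinomial.
\<close>

definition grading_relations :: "(variable \<Rightarrow>\<^sub>0 int) set" where
  "grading_relations =
     {(\<Sum>r\<in>{1..k}. Poly_Mapping.single (XVar r) 1)
        + (\<Sum>s\<in>{1..m}. Poly_Mapping.single (YVar s) (int (a s))),
      (\<Sum>s\<in>{1..n}. Poly_Mapping.single (ZVar s) (int (l s)))}"

definition relation_subgroup :: "(variable \<Rightarrow>\<^sub>0 int) set" where
  "relation_subgroup = generate (free_Abelian_group variables) grading_relations"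

definition grading_group :: "(variable \<Rightarrow>\<^sub>0 int) set monoid" where
  "grading_group = free_Abelian_group variables Mod relation_subgroup"

definition monomial_degree :: "(variable \<Rightarrow>\<^sub>0 nat) \<Rightarrow> (variable \<Rightarrow>\<^sub>0 int) set" where
  "monomial_degree e =
     relation_subgroup #>\<^bsub>free_Abelian_group variables\<^esub> Poly_Mapping.map int e"

definition homogeneous_polys :: "(variable \<Rightarrow>\<^sub>0 int) set \<Rightarrow> 'a::comm_ring_1 mpoly set" where
  "homogeneous_polys w =
     {p \<in> carrier (mpoly_ring variables). \<forall>e\<in>Poly_Mapping.keys p. monomial_degree e = w}"

definition homogeneous_poly :: "'a::comm_ring_1 mpoly \<Rightarrow> bool" where
  "homogeneous_poly p \<longleftrightarrow> (\<exists>w\<in>carrier grading_group. p \<in> homogeneous_polys w)"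

definition homogeneous_element :: "'a::comm_ring_1 mpoly set \<Rightarrow> bool" where
  "homogeneous_element b \<longleftrightarrow> (\<exists>w\<in>carrier grading_group. b \<in> residue_class ` homogeneous_polys w)"

definition homogeneous_derivation ::
    "('a::comm_ring_1 mpoly set \<Rightarrow> 'a mpoly set) \<Rightarrow> bool" where
  "homogeneous_derivation D \<longleftrightarrow> derivation coordinate_ring scalar D \<and>
     (\<forall>b\<in>carrier coordinate_ring. homogeneous_element b \<longrightarrow> homogeneous_element (D b))"


section \<open>The derivations \<open>\<partial>\<^sub>i\<^sub>j\<close>\<close>

definition partial_values ::
    "nat \<Rightarrow> nat \<Rightarrow> ('a::comm_ring_1 mpoly set \<Rightarrow> 'a mpoly set) \<Rightarrow> bool" where
  "partial_values i j D \<longleftrightarrow>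
     D (residue_class (var (XVar i))) =
       residue_class (const (of_nat (l j)) * var (ZVar j) ^ (l j - 1)
                  * (\<Prod>s\<in>{1..n} - {j}. var (ZVar s) ^ l s)) \<and>
     D (residue_class (var (ZVar j))) =
       residue_class ((\<Prod>s\<in>{1..m}. var (YVar s) ^ a s) * (\<Prod>s\<in>{1..k} - {i}. var (XVar s))) \<and>
     (\<forall>r\<in>{1..k} - {i}. D (residue_class (var (XVar r))) = \<zero>\<^bsub>coordinate_ring\<^esub>) \<and>
     (\<forall>s\<in>{1..m}. D (residue_class (var (YVar s))) = \<zero>\<^bsub>coordinate_ring\<^esub>) \<and>
     (\<forall>p\<in>{1..n} - {j}. D (residue_class (var (ZVar p))) = \<zero>\<^bsub>coordinate_ring\<^esub>)"

text \<open>
  A derivation is determined by its values on the generators, and for \<open>1 \<le> i \<le> k\<close> and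
  \<open>1 \<le> j \<le> n\<close> the prescribed values are compatible with the trinomial relation.
\<close>

definition partial_ij :: "nat \<Rightarrow> nat \<Rightarrow> 'a::comm_ring_1 mpoly set \<Rightarrow> 'a mpoly set" where
  "partial_ij i j = (THE D. derivation coordinate_ring scalar D \<and> partial_values i j D)"

definition multiple_derivation ::
    "'a::comm_ring_1 mpoly \<Rightarrow> ('a mpoly set \<Rightarrow> 'a mpoly set) \<Rightarrow> 'a mpoly set \<Rightarrow> 'a mpoly set" where
  "multiple_derivation h D =
     (\<lambda>b\<in>carrier coordinate_ring. residue_class h \<otimes>\<^bsub>coordinate_ring\<^esub> D b)"

end

end

theory Submission
  imports Defs "HOL-Computational_Algebra.Fraction_Field"
begin

text \<open>
Write \<open>U = x\<^sub>1 \<dots> x\<^sub>k y\<^sup>a\<close> and \<open>T = z\<^sup>l\<close>, so that \<open>X\<close> is given by \<open>F = U - (T + 1) = 0\<close>. In the coordinate ring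
\<open>B\<close> the relation reads \<open>U = T + 1\<close>, both \<open>U\<close> and \<open>T\<close> have degree \<open>0\<close>, and a homogeneous element is a monomial
times a polynomial in \<open>T\<close> (\<open>homog_normal_form\<close>).

A locally nilpotent derivation of a domain has a degree function: the degree of \<open>b\<close> is the largest \<open>N\<close> for which the
\<open>N\<close>-th derivative of \<open>b\<close> is not zero. It is additive on products and drops by one under the derivation. Let
\<open>\<delta>\<close> be nonzero and homogeneous. Then \<open>U\<close> and \<open>T\<close> have the same positive degree, and no variable has a larger one.
So the image of a variable that \<open>\<delta>\<close> does not kill is homogeneous of smaller degree than \<open>T\<close>, hence a scalar
times a monomial (\<open>D_moved\<close>). If \<open>\<delta>\<close> kills neither \<open>v\<close> nor \<open>w\<close>, homogeneity of
\<open>\<delta>(v w)\<close> forces the monomials \<open>\<delta>(v) w\<close> and \<open>v \<delta>(w)\<close> to have the same degree in the grading group, and a look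
at the exponents of \<open>v\<close> and \<open>w\<close> shows that one of the two divides \<open>U\<close> and the other one \<open>T\<close> (\<open>moved_unique\<close>).
Thus \<open>\<delta>\<close> moves exactly one factor \<open>w\<close> of \<open>U\<close> and one factor \<open>z\<^sub>j\<close> of \<open>T\<close>. Comparing their degrees, with \<open>l\<^sub>j > 1\<close>, yields that
\<open>w\<close> occurs in \<open>U\<close> with exponent \<open>1\<close> (\<open>exponent_arithmetic\<close>); since \<open>a\<^sub>s > 1\<close> for all \<open>s\<close>, \<open>w\<close> is some \<open>x\<^sub>i\<close>, and
\<open>\<delta> = c h \<partial>\<^sub>i\<^sub>j\<close> with a scalar \<open>c\<close> and a monomial \<open>h\<close> without \<open>x\<^sub>i\<close> and \<open>z\<^sub>j\<close> (\<open>homogeneous_LND_classification\<close>).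

If \<open>h\<close> misses some \<open>z\<^sub>s\<close> with \<open>s \<noteq> j\<close>, then \<open>\<partial>\<^sub>i\<^sub>s\<close> kills \<open>h\<close> and therefore commutes with \<open>h \<partial>\<^sub>i\<^sub>j\<close>, but its
kernel is a different one, as only \<open>\<partial>\<^sub>i\<^sub>j\<close> kills \<open>z\<^sub>s\<close> (\<open>missing_z_not_maximal\<close>).

Conversely, let \<open>h\<close> contain all these \<open>z\<^sub>s\<close>, put \<open>\<delta> = h \<partial>\<^sub>i\<^sub>j\<close> and \<open>P = \<delta>(z\<^sub>j) = h U / x\<^sub>i\<close>, and let \<open>E\<close> be a nonzero
locally nilpotent derivation that commutes with \<open>\<delta>\<close>. Then \<open>\<delta>\<close> kills \<open>E(P) = \<delta>(E(z\<^sub>j))\<close>, so \<open>E(z\<^sub>j)\<close> has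
\<open>\<delta>\<close>-degree at most one. Because \<open>l\<^sub>j > 1\<close>, such elements have the form \<open>\<alpha> + \<beta> z\<^sub>j\<close> with polynomials \<open>\<alpha>\<close>, \<open>\<beta>\<close>
in the variables other than \<open>x\<^sub>i\<close>, \<open>z\<^sub>j\<close> (\<open>linear_elements\<close>). Hence \<open>E(P) = \<beta> P\<close>, which is possible only for
\<open>E(P) = 0\<close>. Every variable other than \<open>x\<^sub>i\<close>, \<open>z\<^sub>j\<close> divides \<open>P\<close>, so \<open>E\<close> kills all of them and is proportional
to \<open>\<partial>\<^sub>i\<^sub>j\<close> (\<open>commuting_same_kernel\<close>).

Finally, an irreducible homogeneous derivation cannot be maximal: \<open>h\<close> would contain some \<open>z\<^sub>s\<close>, as \<open>n \<ge> 2\<close>, and the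
image of \<open>h \<partial>\<^sub>i\<^sub>j\<close> would lie in the proper ideal generated by \<open>z\<^sub>s\<close>.

All computations with derivations take place in a subring \<open>S\<close> of the fraction field of the polynomial ring: solving \<open>F = 0\<close>
for \<open>x\<^sub>i\<close> defines a homomorphism \<open>Phi\<close> to that field whose kernel is the ideal generated by \<open>F\<close>
(\<open>Phi_eq_0_iff\<close>), so that \<open>B\<close> is isomorphic to its image \<open>S\<close>.
\<close>

section \<open>Derivations of subrings of a domain\<close>

text \<open>
  The ring is a subset of a type, because the coordinate rings depend on the parameters \<open>k, m, n, a, l\<close> and do not form a
  type each; they are all subrings of one field.
\<close>

locale subring_derivation =
  fixes S :: "'b::{idom, ring_char_0} set" and D :: "'b \<Rightarrow> 'b"
  assumes one_in: "1 \<in> S"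
    and add_in: "f \<in> S \<Longrightarrow> g \<in> S \<Longrightarrow> f + g \<in> S"
    and uminus_in: "f \<in> S \<Longrightarrow> - f \<in> S"
    and mult_in: "f \<in> S \<Longrightarrow> g \<in> S \<Longrightarrow> f * g \<in> S"
    and D_in: "f \<in> S \<Longrightarrow> D f \<in> S"
    and D_add: "f \<in> S \<Longrightarrow> g \<in> S \<Longrightarrow> D (f + g) = D f + D g"
    and D_mult: "f \<in> S \<Longrightarrow> g \<in> S \<Longrightarrow> D (f * g) = D f * g + f * D g"
begin

lemma zero_in: "0 \<in> S"
  using add_in[OF one_in uminus_in[OF one_in]] by simp

lemma of_nat_in: "of_nat n \<in> S"
  by (induction n) (auto simp: zero_in one_in add_in)

lemma power_in: "f \<in> S \<Longrightarrow> f ^ n \<in> S"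
  by (induction n) (auto simp: one_in mult_in)

lemma sum_in: "(\<And>x. x \<in> A \<Longrightarrow> f x \<in> S) \<Longrightarrow> sum f A \<in> S"
  by (induction A rule: infinite_finite_induct) (auto simp: zero_in add_in)

lemma prod_in: "(\<And>x. x \<in> A \<Longrightarrow> f x \<in> S) \<Longrightarrow> prod f A \<in> S"
  by (induction A rule: infinite_finite_induct) (auto simp: one_in mult_in)

lemma poly_in: "(\<And>r. coeff c r \<in> S) \<Longrightarrow> z \<in> S \<Longrightarrow> poly c z \<in> S"
  by (simp add: poly_altdef sum_in mult_in power_in)

lemma D_zero: "D 0 = 0"
  using D_add[OF zero_in zero_in] by simp

lemma D_one: "D 1 = 0"
  using D_mult[OF one_in one_in] by simp

lemma D_of_nat: "D (of_nat n) = 0"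
  by (induction n) (auto simp: D_zero D_one D_add of_nat_in one_in)

lemma D_sum: "(\<And>x. x \<in> A \<Longrightarrow> f x \<in> S) \<Longrightarrow> D (sum f A) = (\<Sum>x\<in>A. D (f x))"
  by (induction A rule: infinite_finite_induct) (auto simp: D_zero D_add sum_in)

lemma D_const_mult: "f \<in> S \<Longrightarrow> g \<in> S \<Longrightarrow> D f = 0 \<Longrightarrow> D (f * g) = f * D g"
  by (simp add: D_mult)

lemma D_power: "f \<in> S \<Longrightarrow> D (f ^ n) = of_nat n * f ^ (n - 1) * D f"
proof (induction n)
  case (Suc n)
  then have "D (f ^ Suc n) = D f * f ^ n + f * (of_nat n * f ^ (n - 1) * D f)"
    by (simp add: D_mult power_in)
  then show ?case by (cases n) (simp_all add: algebra_simps)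
qed (simp add: D_one)

lemma D_power_zero: "f \<in> S \<Longrightarrow> D f = 0 \<Longrightarrow> D (f ^ n) = 0"
  by (simp add: D_power)

lemma D_prod_zero: "(\<And>x. x \<in> A \<Longrightarrow> f x \<in> S) \<Longrightarrow> (\<And>x. x \<in> A \<Longrightarrow> D (f x) = 0) \<Longrightarrow> D (prod f A) = 0"
  by (induction A rule: infinite_finite_induct) (auto simp: D_one D_mult prod_in)

lemma D_poly:
  assumes "\<And>r. coeff c r \<in> S" "\<And>r. D (coeff c r) = 0" "z \<in> S"
  shows "D (poly c z) = poly (pderiv c) z * D z"
  using assms
proof (induction c)
  case 0
  then show ?case by (simp add: D_zero)
next
  case (pCons a c)
  have a: "a \<in> S" "D a = 0" using pCons.prems(1,2)[of 0] by auto
  have c: "coeff c r \<in> S" "D (coeff c r) = 0" for r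
    using pCons.prems(1,2)[of "Suc r"] by auto
  have "D (poly c z) = poly (pderiv c) z * D z" using pCons.IH c pCons.prems(3) by blast
  then show ?case
    using a poly_in[OF c(1) pCons.prems(3)] pCons.prems(3)
    by (simp add: D_add mult_in D_mult pderiv_pCons algebra_simps)
qed

lemma iterate_in: "f \<in> S \<Longrightarrow> (D ^^ n) f \<in> S"
  by (induction n) (auto simp: D_in)

lemma iterate_zero: "(D ^^ n) 0 = 0"
  by (induction n) (auto simp: D_zero)

lemma iterate_add: "f \<in> S \<Longrightarrow> g \<in> S \<Longrightarrow> (D ^^ n) (f + g) = (D ^^ n) f + (D ^^ n) g"
  by (induction n) (auto simp: D_add iterate_in)

lemma iterate_vanish_mono: "(D ^^ n) f = 0 \<Longrightarrow> n \<le> N \<Longrightarrow> (D ^^ N) f = 0"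
  by (metis add.commute comp_apply funpow_add iterate_zero le_add_diff_inverse)

lemma iterate_const_mult:
  "f \<in> S \<Longrightarrow> g \<in> S \<Longrightarrow> D f = 0 \<Longrightarrow> (D ^^ n) (f * g) = f * (D ^^ n) g"
  by (induction n) (auto simp: D_const_mult iterate_in)

lemma Leibniz:
  assumes "f \<in> S" "g \<in> S"
  shows "(D ^^ n) (f * g) = (\<Sum>i\<le>n. of_nat (n choose i) * ((D ^^ i) f * (D ^^ (n - i)) g))"
proof (induction n)
  case 0
  then show ?case by simp
next
  case (Suc n)
  let ?t = "\<lambda>i j. (D ^^ i) f * (D ^^ j) g"
  have t_in: "?t i j \<in> S" for i j using assms by (simp add: mult_in iterate_in)
  have Dt: "D (of_nat N * ?t i j) = of_nat N * (?t (Suc i) j + ?t i (Suc j))" for N i j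
    using assms t_in by (simp add: D_const_mult D_of_nat of_nat_in D_mult iterate_in)
  have "(D ^^ Suc n) (f * g) = D (\<Sum>i\<le>n. of_nat (n choose i) * ?t i (n - i))"
    using Suc by simp
  also have "\<dots> = (\<Sum>i\<le>n. of_nat (n choose i) * (?t (Suc i) (n - i) + ?t i (Suc (n - i))))"
    by (subst D_sum) (auto simp: Dt mult_in of_nat_in assms iterate_in)
  also have "\<dots> = (\<Sum>i\<le>n. of_nat (n choose i) * ?t (Suc i) (n - i))
      + (\<Sum>i\<le>n. of_nat (n choose i) * ?t i (Suc n - i))"
    by (simp add: distrib_left sum.distrib Suc_diff_le)
  also have "(\<Sum>i\<le>n. of_nat (n choose i) * ?t i (Suc n - i))
      = (\<Sum>i\<le>Suc n. of_nat (n choose i) * ?t i (Suc n - i))"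
    by (simp del: funpow.simps)
  also have "\<dots> = ?t 0 (Suc n) + (\<Sum>i\<le>n. of_nat (n choose Suc i) * ?t (Suc i) (n - i))"
    by (subst sum.atMost_Suc_shift) simp
  finally have "(D ^^ Suc n) (f * g) = ?t 0 (Suc n)
      + (\<Sum>i\<le>n. of_nat (Suc n choose Suc i) * ?t (Suc i) (n - i))"
    by (simp add: sum.distrib algebra_simps del: funpow.simps)
  also have "\<dots> = (\<Sum>i\<le>Suc n. of_nat (Suc n choose i) * ?t i (Suc n - i))"
    by (subst sum.atMost_Suc_shift) simp
  finally show ?case .
qed

definition nilpotent :: "'b \<Rightarrow> bool" where
  "nilpotent f \<longleftrightarrow> (\<exists>N. (D ^^ N) f = 0)"

lemma nilpotent_add: "f \<in> S \<Longrightarrow> g \<in> S \<Longrightarrow> nilpotent f \<Longrightarrow> nilpotent g \<Longrightarrow> nilpotent (f + g)"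
  unfolding nilpotent_def
  by (metis iterate_add iterate_vanish_mono add.right_neutral max.cobounded1 max.cobounded2)

text \<open>
  If \<open>M\<close> derivatives kill \<open>f\<close> and \<open>N\<close> derivatives kill \<open>g\<close>, then every term in the Leibniz expansion of the
  \<open>(M + N)\<close>-th derivative of \<open>f g\<close> has at least \<open>M\<close> derivatives on \<open>f\<close> or at least \<open>N\<close> on \<open>g\<close>.
\<close>

lemma nilpotent_mult:
  assumes "f \<in> S" "g \<in> S" "nilpotent f" "nilpotent g"
  shows "nilpotent (f * g)"
proof -
  obtain M N where M: "(D ^^ M) f = 0" and N: "(D ^^ N) g = 0"
    using assms unfolding nilpotent_def by blast
  have "of_nat ((M + N) choose i) * ((D ^^ i) f * (D ^^ (M + N - i)) g) = 0" if "i \<le> M + N" for i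
  proof (cases "M \<le> i")
    case True
    then show ?thesis using iterate_vanish_mono[OF M] by simp
  next
    case False
    then have "N \<le> M + N - i" by simp
    then show ?thesis using iterate_vanish_mono[OF N] by simp
  qed
  then have "(D ^^ (M + N)) (f * g) = 0"
    unfolding Leibniz[OF assms(1,2)] by (intro sum.neutral) auto
  then show ?thesis unfolding nilpotent_def by blast
qed

lemma nilpotent_kernel: "D f = 0 \<Longrightarrow> nilpotent f"
  unfolding nilpotent_def by (rule exI[of _ 1]) simp

lemma nilpotent_D: "nilpotent (D f) \<Longrightarrow> nilpotent f"
  unfolding nilpotent_def by (metis funpow_Suc_right comp_apply)

lemma nilpotent_power: "f \<in> S \<Longrightarrow> nilpotent f \<Longrightarrow> nilpotent (f ^ n)"
  by (induction n) (auto simp: nilpotent_kernel D_one power_in intro: nilpotent_mult)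

text \<open>
  The degree function of a locally nilpotent derivation. For \<open>f \<noteq> 0\<close> it is the largest \<open>N\<close> with a nonzero \<open>N\<close>-th
  derivative; in the form of a least number it is \<open>0\<close> at \<open>f = 0\<close>.
\<close>

definition ndeg :: "'b \<Rightarrow> nat" where
  "ndeg f = (LEAST N. (D ^^ Suc N) f = 0)"

end

locale subring_LND = subring_derivation +
  assumes locally_nilpotent: "f \<in> S \<Longrightarrow> \<exists>N. (D ^^ N) f = 0"
begin

lemma iterate_ndeg_Suc:
  assumes "f \<in> S"
  shows "(D ^^ Suc (ndeg f)) f = 0"
  unfolding ndeg_def
proof (rule LeastI_ex)
  obtain N where "(D ^^ N) f = 0" using locally_nilpotent[OF \<open>f \<in> S\<close>] by blast
  then have "(D ^^ Suc N) f = 0" by (rule iterate_vanish_mono) simp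
  then show "\<exists>N. (D ^^ Suc N) f = 0" by blast
qed

lemma iterate_ndeg:
  assumes "f \<in> S" "f \<noteq> 0"
  shows "(D ^^ ndeg f) f \<noteq> 0"
proof (cases "ndeg f")
  case 0
  then show ?thesis using assms by simp
next
  case (Suc N)
  then have "N < ndeg f" by simp
  then show ?thesis using not_less_Least[of N "\<lambda>N. (D ^^ Suc N) f = 0"] Suc
    unfolding ndeg_def by metis
qed

lemma iterate_vanish_iff:
  assumes "f \<in> S" "f \<noteq> 0"
  shows "(D ^^ n) f = 0 \<longleftrightarrow> ndeg f < n"
proof
  assume "(D ^^ n) f = 0"
  then show "ndeg f < n" using iterate_ndeg[OF assms] iterate_vanish_mono[of n f "ndeg f"] by force
next
  assume "ndeg f < n"
  then show "(D ^^ n) f = 0"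
    by (intro iterate_vanish_mono[OF iterate_ndeg_Suc[OF assms(1)]]) simp
qed

lemma ndeg_eqI: "f \<in> S \<Longrightarrow> (D ^^ n) f \<noteq> 0 \<Longrightarrow> (D ^^ Suc n) f = 0 \<Longrightarrow> ndeg f = n"
  using iterate_vanish_iff[of f n] iterate_vanish_iff[of f "Suc n"] iterate_zero[of n]
  by (cases "f = 0") (auto simp del: funpow.simps)

lemma ndeg_eq_0_iff: "f \<in> S \<Longrightarrow> ndeg f = 0 \<longleftrightarrow> D f = 0"
  using iterate_vanish_iff[of f 1] iterate_ndeg_Suc[of f] ndeg_eqI[of f 0] D_zero
  by (cases "f = 0") (auto simp: ndeg_def)

lemma ndeg_D: "f \<in> S \<Longrightarrow> D f \<noteq> 0 \<Longrightarrow> ndeg f = Suc (ndeg (D f))"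
  by (rule ndeg_eqI)
    (use iterate_ndeg[of "D f"] iterate_ndeg_Suc[of "D f"] in
      \<open>simp_all add: D_in funpow_Suc_right del: funpow.simps\<close>)

text \<open>
  In the Leibniz expansion of the derivative of order \<open>ndeg f + ndeg g\<close> only the term with \<open>ndeg f\<close> derivatives on \<open>f\<close>
  survives. It is not zero, because its binomial coefficient is not zero in characteristic \<open>0\<close>.
\<close>

lemma ndeg_mult:
  assumes "f \<in> S" "g \<in> S" "f \<noteq> 0" "g \<noteq> 0"
  shows "ndeg (f * g) = ndeg f + ndeg g"
proof (rule ndeg_eqI)
  let ?M = "ndeg f" and ?N = "ndeg g"
  show "f * g \<in> S" using assms by (simp add: mult_in)
  have van: "(D ^^ i) f * (D ^^ j) g = 0" if "i + j \<ge> ?M + ?N" "i \<noteq> ?M \<or> j \<noteq> ?N" for i j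
    using that assms by (auto simp: iterate_vanish_iff)
  have "(D ^^ (?M + ?N)) (f * g) = of_nat ((?M + ?N) choose ?M) * ((D ^^ ?M) f * (D ^^ ?N) g)"
    unfolding Leibniz[OF assms(1,2)]
  proof (subst sum.remove[of _ ?M])
    have "(D ^^ i) f * (D ^^ (?M + ?N - i)) g = 0" if "i \<in> {..?M + ?N} - {?M}" for i
      using that by (intro van) auto
    then have "(\<Sum>i\<in>{..?M + ?N} - {?M}. of_nat ((?M + ?N) choose i) * ((D ^^ i) f * (D ^^ (?M + ?N - i)) g)) = 0"
      by (intro sum.neutral ballI) (simp only: mult_zero_right)
    then show "of_nat ((?M + ?N) choose ?M) * ((D ^^ ?M) f * (D ^^ (?M + ?N - ?M)) g)
        + (\<Sum>i\<in>{..?M + ?N} - {?M}. of_nat ((?M + ?N) choose i) * ((D ^^ i) f * (D ^^ (?M + ?N - i)) g))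
      = of_nat ((?M + ?N) choose ?M) * ((D ^^ ?M) f * (D ^^ ?N) g)"
      by simp
  qed auto
  then show "(D ^^ (?M + ?N)) (f * g) \<noteq> 0"
    using assms by (simp add: iterate_ndeg)
  show "(D ^^ Suc (?M + ?N)) (f * g) = 0"
    unfolding Leibniz[OF assms(1,2)]
  proof (rule sum.neutral, rule ballI)
    fix i assume "i \<in> {..Suc (?M + ?N)}"
    then have "(D ^^ i) f * (D ^^ (Suc (?M + ?N) - i)) g = 0" by (intro van) auto
    then show "of_nat (Suc (?M + ?N) choose i) * ((D ^^ i) f * (D ^^ (Suc (?M + ?N) - i)) g) = 0"
      by (simp only: mult_zero_right)
  qed
qed

lemma ndeg_one: "ndeg 1 = 0"
  by (simp add: ndeg_eq_0_iff one_in D_one)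

lemma ndeg_power: "f \<in> S \<Longrightarrow> f \<noteq> 0 \<Longrightarrow> ndeg (f ^ n) = n * ndeg f"
  by (induction n) (auto simp: ndeg_one ndeg_mult power_in)

lemma ndeg_prod:
  "finite A \<Longrightarrow> (\<And>x. x \<in> A \<Longrightarrow> f x \<in> S) \<Longrightarrow> (\<And>x. x \<in> A \<Longrightarrow> f x \<noteq> 0)
    \<Longrightarrow> ndeg (prod f A) = (\<Sum>x\<in>A. ndeg (f x))"
  by (induction A rule: finite_induct) (auto simp: ndeg_one ndeg_mult prod_in)

text \<open>The kernel of a locally nilpotent derivation is factorially closed, because degrees are additive and nonnegative.\<close>

lemma D_prod_power_zero:
  assumes "finite A" "\<And>x. x \<in> A \<Longrightarrow> f x \<in> S" "\<And>x. x \<in> A \<Longrightarrow> f x \<noteq> 0"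
    and "D (\<Prod>x\<in>A. f x ^ e x) = 0" "x \<in> A" "e x \<noteq> 0"
  shows "D (f x) = 0"
proof -
  have "ndeg (\<Prod>x\<in>A. f x ^ e x) = (\<Sum>x\<in>A. ndeg (f x ^ e x))"
    by (rule ndeg_prod) (simp_all add: assms(1-3) power_in)
  also have "\<dots> = (\<Sum>x\<in>A. e x * ndeg (f x))"
    by (rule sum.cong) (simp_all add: assms(2,3) ndeg_power)
  finally have "(\<Sum>x\<in>A. e x * ndeg (f x)) = 0"
    using assms(2,4) ndeg_eq_0_iff[of "\<Prod>x\<in>A. f x ^ e x"] by (simp add: prod_in power_in)
  then have "e x * ndeg (f x) = 0" using assms(1,5) by simp
  then have "ndeg (f x) = 0" using assms(6) by simp
  then show ?thesis using assms(2,5) ndeg_eq_0_iff by blast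
qed

text \<open>A nonzero derivative has smaller degree than \<open>f\<close>, a nonzero multiple of \<open>f\<close> does not.\<close>

lemma D_multiple_imp_zero:
  assumes "f \<in> S" "g \<in> S" "D f = g * f"
  shows "D f = 0"
proof (rule ccontr)
  assume nz: "D f \<noteq> 0"
  then have "g \<noteq> 0" "f \<noteq> 0" using assms by auto
  then have "ndeg (D f) = ndeg g + ndeg f" using assms by (simp add: ndeg_mult)
  then show False using ndeg_D[OF assms(1) nz] by simp
qed

text \<open>By induction on the degree of the polynomial, since the derivative of \<open>poly c z\<close> is \<open>poly (pderiv c) z * D z\<close>.\<close>

lemma ndeg_poly:
  assumes "\<And>r. coeff c r \<in> S" "\<And>r. D (coeff c r) = 0" "z \<in> S" "D z \<noteq> 0" "c \<noteq> 0"
  shows "poly c z \<noteq> 0 \<and> ndeg (poly c z) = degree c * ndeg z"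
  using assms(1,2,5)
proof (induction "degree c" arbitrary: c)
  case 0
  then obtain b where "c = [:b:]" by (metis degree_eq_zeroE)
  then show ?case using 0(2,3)[of 0] 0(4) by (simp add: ndeg_eq_0_iff)
next
  case (Suc n)
  have d: "degree (pderiv c) = n" using Suc(2) by (simp add: degree_pderiv)
  have nz: "pderiv c \<noteq> 0" using Suc(2) by (metis nat.simps(3) pderiv_eq_0_iff)
  have co: "coeff (pderiv c) r \<in> S" "D (coeff (pderiv c) r) = 0" for r
    using Suc(3,4) by (auto simp: coeff_pderiv mult_in of_nat_in one_in add_in D_mult D_add D_one D_of_nat)
  have IH: "poly (pderiv c) z \<noteq> 0 \<and> ndeg (poly (pderiv c) z) = n * ndeg z"
    using Suc(1)[of "pderiv c"] d co nz by auto
  have "D (poly c z) = poly (pderiv c) z * D z" by (rule D_poly) (use Suc assms in auto)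
  moreover from this have "D (poly c z) \<noteq> 0" using IH assms(4) by auto
  moreover have "poly c z \<in> S" using Suc(3) assms(3) by (rule poly_in)
  ultimately have "ndeg (poly c z) = Suc (ndeg (poly (pderiv c) z) + ndeg (D z))"
    using IH assms co by (simp add: ndeg_D ndeg_mult poly_in D_in)
  then show ?case
    using IH ndeg_D[OF assms(3,4)] \<open>D (poly c z) \<noteq> 0\<close> D_zero by (auto simp flip: Suc(2))
qed

end

section \<open>Polynomials and their evaluation\<close>

abbreviation "lookup \<equiv> Poly_Mapping.lookup"
abbreviation "keys \<equiv> Poly_Mapping.keys"
abbreviation "single \<equiv> Poly_Mapping.single"

text \<open>
  Some linear order on the variables makes the polynomial ring an instance of \<^class>\<open>idom\<close>: the exponent vectors then
  form an ordered monoid, and leading terms multiply.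
\<close>

instantiation variable :: linorder
begin

primrec variable_rank :: "variable \<Rightarrow> nat" where
  "variable_rank (XVar r) = 3 * r"
| "variable_rank (YVar s) = 3 * s + 1"
| "variable_rank (ZVar s) = 3 * s + 2"

definition less_eq_variable :: "variable \<Rightarrow> variable \<Rightarrow> bool" where
  "u \<le> v \<longleftrightarrow> variable_rank u \<le> variable_rank v"

definition less_variable :: "variable \<Rightarrow> variable \<Rightarrow> bool" where
  "u < v \<longleftrightarrow> variable_rank u < variable_rank v"

lemma variable_rank_inject: "variable_rank u = variable_rank v \<Longrightarrow> u = v"
  by (cases u; cases v) (auto, presburger+)

instance
  by standard (auto simp: less_eq_variable_def less_variable_def intro: variable_rank_inject)

end

instance fract :: ("{idom, ring_char_0}") ring_char_0
proof
  have "of_nat n = Fract (of_nat n) (1::'a)" for n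
    by (induction n) (auto simp: One_fract_def Zero_fract_def)
  then show "inj (of_nat :: nat \<Rightarrow> 'a fract)"
    by (auto simp: inj_def eq_fract)
qed

lemma const_zero [simp]: "const 0 = 0"
  and const_one [simp]: "const 1 = (1 :: 'a::comm_ring_1 mpoly)"
  by (simp_all add: const_def)

lemma const_add: "const (s + t) = const s + (const t :: 'a::comm_ring_1 mpoly)"
  by (simp add: const_def single_add)

lemma const_mult: "const (s * t) = const s * (const t :: 'a::comm_ring_1 mpoly)"
  by (simp add: const_def mult_single)

lemma const_of_nat: "const (of_nat n) = (of_nat n :: 'a::comm_ring_1 mpoly)"
  by (simp add: const_def)

lemma const_eq_0_iff [simp]: "const t = 0 \<longleftrightarrow> t = (0 :: 'a::comm_ring_1)"
  unfolding const_def by (metis lookup_single_eq lookup_zero single_zero)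

definition monomial :: "(variable \<Rightarrow>\<^sub>0 nat) \<Rightarrow> 'a::comm_ring_1 mpoly" where
  "monomial e = single e 1"

lemma monomial_add: "monomial (e + f) = monomial e * monomial f"
  by (simp add: monomial_def mult_single)

lemma monomial_zero [simp]: "monomial 0 = 1"
  by (simp add: monomial_def)

lemma var_monomial: "var v = monomial (single v 1)"
  by (simp add: var_def monomial_def)

lemma single_const_mono: "single e t = const t * monomial e"
  by (simp add: const_def monomial_def mult_single)

lemma monomial_nonzero [simp]: "monomial e \<noteq> (0 :: 'a::comm_ring_1 mpoly)"
  unfolding monomial_def by (metis lookup_single_eq lookup_zero zero_neq_one)

lemma poly_mapping_sum_singles:
  "(\<Sum>e\<in>keys p. single e (lookup p e)) = p"
proof (rule poly_mapping_eqI)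
  fix k
  have "lookup (\<Sum>e\<in>keys p. single e (lookup p e)) k
    = (\<Sum>e\<in>keys p. if e = k then lookup p e else 0)"
    by (simp add: lookup_sum lookup_single when_def)
  then show "lookup (\<Sum>e\<in>keys p. single e (lookup p e)) k
    = lookup p k"
    by (simp add: in_keys_iff)
qed

lemma mpoly_sum_monos:
  fixes p :: "'a::comm_ring_1 mpoly"
  shows "p = (\<Sum>e\<in>keys p. const (lookup p e) * monomial e)"
  using poly_mapping_sum_singles[of p] by (simp add: single_const_mono)

definition power_product :: "(variable \<Rightarrow> 'b::comm_ring_1) \<Rightarrow> (variable \<Rightarrow>\<^sub>0 nat) \<Rightarrow> 'b" where
  "power_product x e = (\<Prod>v\<in>keys e. x v ^ lookup e v)"

lemma power_product_superset:
  assumes "finite A" "keys e \<subseteq> A"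
  shows "power_product x e = (\<Prod>v\<in>A. x v ^ lookup e v)"
  unfolding power_product_def
  by (rule prod.mono_neutral_left) (use assms in \<open>auto simp: in_keys_iff\<close>)

lemma power_product_add: "power_product x (e + f) = power_product x e * power_product x f"
proof -
  let ?A = "keys e \<union> keys f"
  have "power_product x (e + f) = (\<Prod>v\<in>?A. x v ^ lookup (e + f) v)"
    by (rule power_product_superset) (auto dest: subsetD[OF keys_add])
  also have "\<dots> = (\<Prod>v\<in>?A. x v ^ lookup e v) * (\<Prod>v\<in>?A. x v ^ lookup f v)"
    by (simp add: lookup_add power_add prod.distrib)
  also have "\<dots> = power_product x e * power_product x f"
    by (subst (1 2) power_product_superset[of ?A]) auto
  finally show ?thesis .
qed

lemma power_product_zero [simp]: "power_product x 0 = 1"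
  by (simp add: power_product_def)

lemma power_product_single: "power_product x (single v n) = x v ^ n"
  by (simp add: power_product_def)

lemma monomial_single: "monomial (single v n) = var v ^ n"
proof (induction n)
  case (Suc n)
  have "single v (Suc n) = single v 1 + single v n"
    by (simp flip: single_add)
  then show ?case using Suc by (simp only: monomial_add power_Suc var_monomial)
qed simp

lemma monomial_sum: "monomial (\<Sum>x\<in>A. f x) = (\<Prod>x\<in>A. monomial (f x))"
  by (induction A rule: infinite_finite_induct) (auto simp: monomial_add)

lemma monomial_power_product: "monomial e = power_product var e"
proof -
  have "monomial e = monomial (\<Sum>v\<in>keys e. single v (lookup e v))"
    by (simp only: poly_mapping_sum_singles)
  then show ?thesis by (simp only: monomial_sum power_product_def monomial_single)
qed

lemma occurring_vars_zero [simp]: "occurring_vars 0 = {}"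
  by (simp add: occurring_vars_def)

lemma occurring_vars_const [simp]: "occurring_vars (const t) = {}"
  by (simp add: occurring_vars_def const_def)

lemma occurring_vars_one [simp]: "occurring_vars (1 :: 'a::comm_ring_1 mpoly) = {}"
  using occurring_vars_const[of "1::'a"] by simp

lemma occurring_vars_monomial [simp]: "occurring_vars (monomial e :: 'a::comm_ring_1 mpoly) = keys e"
  by (simp add: occurring_vars_def monomial_def)

lemma occurring_vars_var [simp]: "occurring_vars (var v :: 'a::comm_ring_1 mpoly) = {v}"
  by (simp add: var_monomial)

lemma occurring_vars_add: "occurring_vars (p + q) \<subseteq> occurring_vars p \<union> occurring_vars q"
  unfolding occurring_vars_def using keys_add[of p q] by blast

lemma occurring_vars_uminus [simp]: "occurring_vars (- p) = occurring_vars (p :: 'a::comm_ring_1 mpoly)"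
  by (simp add: occurring_vars_def in_keys_iff set_eq_iff)

lemma occurring_vars_mult: "occurring_vars (p * q) \<subseteq> occurring_vars p \<union> occurring_vars (q :: 'a::comm_ring_1 mpoly)"
  unfolding occurring_vars_def using keys_mult[of p q] keys_add by fastforce

lemma occurring_vars_diff: "occurring_vars (p - q) \<subseteq> occurring_vars p \<union> occurring_vars (q :: 'a::comm_ring_1 mpoly)"
  using occurring_vars_add[of p "- q"] by simp

lemma occurring_vars_closed:
  fixes p q :: "'a::comm_ring_1 mpoly"
  assumes "occurring_vars p \<subseteq> V" "occurring_vars q \<subseteq> V"
  shows "occurring_vars (p + q) \<subseteq> V" "occurring_vars (p * q) \<subseteq> V"
    "occurring_vars (p - q) \<subseteq> V" "occurring_vars (- p) \<subseteq> V"
  using assms occurring_vars_add[of p q] occurring_vars_mult[of p q] occurring_vars_diff[of p q]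
  by auto

lemma occurring_vars_power:
  "occurring_vars p \<subseteq> V \<Longrightarrow> occurring_vars (p ^ n :: 'a::comm_ring_1 mpoly) \<subseteq> V"
  by (induction n) (simp_all add: occurring_vars_closed)

lemma occurring_vars_sum:
  "(\<And>x. x \<in> A \<Longrightarrow> occurring_vars (f x) \<subseteq> V) \<Longrightarrow> occurring_vars (sum f A :: 'a::comm_ring_1 mpoly) \<subseteq> V"
  by (induction A rule: infinite_finite_induct) (simp_all add: occurring_vars_closed)

lemma keys_subset_occurring: "e \<in> keys p \<Longrightarrow> keys e \<subseteq> occurring_vars p"
  by (auto simp: occurring_vars_def)

lemma mpoly_induct [consumes 1, case_names const var add mult]:
  fixes p :: "'a::comm_ring_1 mpoly"
  assumes "occurring_vars p \<subseteq> V"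
    and const: "\<And>t. P (const t)"
    and var: "\<And>v. v \<in> V \<Longrightarrow> P (var v)"
    and add: "\<And>p q. P p \<Longrightarrow> P q \<Longrightarrow> P (p + q)"
    and mult: "\<And>p q. P p \<Longrightarrow> P q \<Longrightarrow> P (p * q)"
  shows "P p"
proof -
  have one: "P 1" using const[of 1] by simp
  have pow: "P (q ^ n)" if "P q" for q n
    using that by (induction n) (auto intro: mult one)
  have prd: "P (prod f A)" if "\<And>x. x \<in> A \<Longrightarrow> P (f x)" for f and A :: "variable set"
    using that by (induction A rule: infinite_finite_induct) (auto intro: mult one)
  have sm: "P (sum f A)" if "\<And>x. x \<in> A \<Longrightarrow> P (f x)" for f and A :: "(variable \<Rightarrow>\<^sub>0 nat) set"
    using that const[of 0] by (induction A rule: infinite_finite_induct) (auto intro: add)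
  have "P (monomial e)" if "e \<in> keys p" for e
    unfolding monomial_power_product power_product_def
    using that assms(1) by (intro prd pow var) (auto simp: occurring_vars_def)
  then show ?thesis
    by (subst mpoly_sum_monos) (auto intro!: sm mult const)
qed

locale coefficient_hom =
  fixes c :: "'a::comm_ring_1 \<Rightarrow> 'b::comm_ring_1"
  assumes c_one: "c 1 = 1" and c_add: "c (s + t) = c s + c t" and c_mult: "c (s * t) = c s * c t"
begin

lemma c_zero: "c 0 = 0"
  using c_add[of 0 0] by simp

definition eval :: "(variable \<Rightarrow> 'b) \<Rightarrow> 'a mpoly \<Rightarrow> 'b" where
  "eval x p = (\<Sum>e\<in>keys p. c (lookup p e) * power_product x e)"

lemma eval_superset:
  assumes "finite A" "keys p \<subseteq> A"
  shows "eval x p = (\<Sum>e\<in>A. c (lookup p e) * power_product x e)"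
  unfolding eval_def
  by (rule sum.mono_neutral_left) (use assms in \<open>auto simp: in_keys_iff c_zero\<close>)

lemma eval_add: "eval x (p + q) = eval x p + eval x q"
proof -
  let ?A = "keys p \<union> keys q"
  have "eval x (p + q) = (\<Sum>e\<in>?A. c (lookup (p + q) e) * power_product x e)"
    by (rule eval_superset) (auto dest: subsetD[OF keys_add])
  also have "\<dots> = (\<Sum>e\<in>?A. c (lookup p e) * power_product x e)
      + (\<Sum>e\<in>?A. c (lookup q e) * power_product x e)"
    by (simp add: lookup_add c_add distrib_right sum.distrib)
  also have "\<dots> = eval x p + eval x q"
    by (subst (1 2) eval_superset[of ?A]) auto
  finally show ?thesis .
qed

lemma eval_single: "eval x (single e t) = c t * power_product x e"
  by (cases "t = 0") (auto simp: eval_def c_zero)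

lemma eval_const: "eval x (const t) = c t"
  by (simp add: const_def eval_single)

lemma eval_zero [simp]: "eval x 0 = 0"
  by (simp add: eval_def)

lemma eval_one [simp]: "eval x 1 = 1"
  using eval_const[of x 1] by (simp add: c_one)

lemma eval_monomial: "eval x (monomial e) = power_product x e"
  by (simp add: monomial_def eval_single c_one)

lemma eval_var [simp]: "eval x (var v) = x v"
  by (simp add: var_monomial eval_monomial power_product_single)

lemma eval_sum: "eval x (sum f A) = (\<Sum>i\<in>A. eval x (f i))"
  by (induction A rule: infinite_finite_induct) (auto simp: eval_add)

lemma eval_mult: "eval x (p * q) = eval x p * eval x q"
proof -
  have "p * q = (\<Sum>e\<in>keys p. \<Sum>f\<in>keys q.
      single (e + f) (lookup p e * lookup q f))"
    by (subst (1) poly_mapping_sum_singles[of p, symmetric],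
        subst (1) poly_mapping_sum_singles[of q, symmetric])
      (simp add: sum_product mult_single)
  then have "eval x (p * q) = (\<Sum>e\<in>keys p. \<Sum>f\<in>keys q.
      (c (lookup p e) * power_product x e) * (c (lookup q f) * power_product x f))"
    by (simp add: eval_sum eval_single c_mult power_product_add mult_ac)
  then show ?thesis by (simp add: eval_def sum_product)
qed

lemma eval_power: "eval x (p ^ n) = eval x p ^ n"
  by (induction n) (auto simp: eval_mult)

lemma eval_prod: "eval x (prod f A) = (\<Prod>i\<in>A. eval x (f i))"
  by (induction A rule: infinite_finite_induct) (auto simp: eval_mult)

lemma eval_uminus: "eval x (- p) = - eval x p"
  using eval_add[of x p "- p"] by (simp add: eq_neg_iff_add_eq_0 add.commute)

lemma eval_diff: "eval x (p - q) = eval x p - eval x q"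
  using eval_add[of x p "- q"] eval_uminus[of x q] by simp

lemma eval_of_nat: "eval x (of_nat n) = of_nat n"
  by (induction n) (auto simp: eval_add)

lemmas eval_simps = eval_add eval_mult eval_power eval_prod eval_uminus eval_diff eval_const eval_sum

lemma eval_unique:
  assumes "occurring_vars p \<subseteq> V"
    and "\<And>t. \<phi> (const t) = c t" "\<And>v. v \<in> V \<Longrightarrow> \<phi> (var v) = x v"
    and "\<And>p q. \<phi> (p + q) = \<phi> p + \<phi> q" "\<And>p q. \<phi> (p * q) = \<phi> p * \<phi> q"
  shows "eval x p = \<phi> p"
  using assms(1) by (induction rule: mpoly_induct) (auto simp: assms(2-) eval_simps)

lemma eval_cong:
  "(\<And>v. v \<in> occurring_vars p \<Longrightarrow> x v = y v) \<Longrightarrow> eval x p = eval y p"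
  by (rule eval_unique[of p "occurring_vars p"]) (auto simp: eval_simps)

end

interpretation subst: coefficient_hom "const :: 'a::comm_ring_1 \<Rightarrow> 'a mpoly"
  by standard (auto simp: const_add const_mult)

lemma subst_var: "subst.eval var p = p"
  by (rule subst.eval_unique[of p "occurring_vars p"]) auto

lemma occurring_vars_subst:
  fixes p :: "'a::comm_ring_1 mpoly"
  assumes "occurring_vars p \<subseteq> V" "\<And>v. v \<in> V \<Longrightarrow> occurring_vars (x v) \<subseteq> W"
  shows "occurring_vars (subst.eval x p) \<subseteq> W"
  using assms(1)
  by (induction rule: mpoly_induct) (simp_all add: subst.eval_simps assms(2) occurring_vars_closed)

section \<open>The trinomial relation\<close>

lemma split_off_var:
  fixes p :: "'a::comm_ring_1 mpoly"
  assumes "occurring_vars p \<subseteq> W" "v \<in> W"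
  shows "\<exists>q. occurring_vars q \<subseteq> W \<and> p = subst.eval (var(v := 0)) p + var v * q"
proof -
  let ?s = "subst.eval (var(v := 0))"
  have "\<exists>p0 q. occurring_vars p0 \<subseteq> W \<and> occurring_vars q \<subseteq> W \<and> p0 = ?s p \<and> p = p0 + var v * q"
    using assms(1)
  proof (induction rule: mpoly_induct)
    case (const t)
    then show ?case
      by (intro exI[of _ "const t"] exI[of _ 0]) (simp add: subst.eval_const)
  next
    case (var w)
    show ?case
    proof (cases "w = v")
      case True
      then show ?thesis by (intro exI[of _ 0] exI[of _ 1]) simp
    next
      case False
      then show ?thesis using var by (intro exI[of _ "var w"] exI[of _ 0]) simp
    qed
  next
    case (add p q)
    then obtain p0 p1 q0 q1
      where *: "occurring_vars p0 \<subseteq> W" "occurring_vars p1 \<subseteq> W" "p0 = ?s p" "p = p0 + var v * p1"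
        "occurring_vars q0 \<subseteq> W" "occurring_vars q1 \<subseteq> W" "q0 = ?s q" "q = q0 + var v * q1" by blast
    have pq: "p + q = (p0 + q0) + var v * (p1 + q1)" using *(4,8) by (simp add: algebra_simps)
    show ?case
    proof (intro exI conjI)
      show "p + q = (p0 + q0) + var v * (p1 + q1)" by (rule pq)
      show "p0 + q0 = ?s (p + q)" using *(3,7) by (simp only: subst.eval_add)
    qed (use *(1,2,5,6) in \<open>simp_all only: occurring_vars_closed\<close>)
  next
    case (mult p q)
    then obtain p0 p1 q0 q1
      where *: "occurring_vars p0 \<subseteq> W" "occurring_vars p1 \<subseteq> W" "p0 = ?s p" "p = p0 + var v * p1"
        "occurring_vars q0 \<subseteq> W" "occurring_vars q1 \<subseteq> W" "q0 = ?s q" "q = q0 + var v * q1" by blast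
    have pq: "p * q = p0 * q0 + var v * (p1 * q0 + p0 * q1 + var v * (p1 * q1))"
      using *(4,8) by (simp add: algebra_simps)
    have v: "occurring_vars (var v :: 'a mpoly) \<subseteq> W" using assms(2) by simp
    show ?case
    proof (intro exI conjI)
      show "p * q = p0 * q0 + var v * (p1 * q0 + p0 * q1 + var v * (p1 * q1))" by (rule pq)
      show "p0 * q0 = ?s (p * q)" using *(3,7) by (simp only: subst.eval_mult)
    qed (use *(1,2,5,6) v in \<open>simp_all only: occurring_vars_closed\<close>)
  qed
  then show ?thesis by blast
qed

lemma poly_in_occurring:
  fixes c :: "'a::comm_ring_1 mpoly poly"
  assumes "\<And>r. occurring_vars (coeff c r) \<subseteq> W" "occurring_vars z \<subseteq> W"
  shows "occurring_vars (poly c z) \<subseteq> W"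
  unfolding poly_altdef
  by (intro occurring_vars_sum occurring_vars_closed occurring_vars_power assms)

lemma finite_variables [simp]: "finite (variables k m n)"
  by (simp add: variables_def)

locale hypersurface =
  fixes k m n :: nat and a l :: "nat \<Rightarrow> nat"
  assumes a_gt: "s \<in> {1..m} \<Longrightarrow> a s > 1"
    and l_gt: "j \<in> {1..n} \<Longrightarrow> l j > 1"
begin

abbreviation "V \<equiv> variables k m n"

text \<open>\<open>eU\<close> and \<open>eT\<close> are the exponent vectors of the monomials \<open>U\<close> and \<open>T\<close> in the relation \<open>U = T + 1\<close>.\<close>

definition eU :: "variable \<Rightarrow>\<^sub>0 nat" where
  "eU = (\<Sum>r\<in>{1..k}. single (XVar r) 1) + (\<Sum>s\<in>{1..m}. single (YVar s) (a s))"

definition eT :: "variable \<Rightarrow>\<^sub>0 nat" where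
  "eT = (\<Sum>s\<in>{1..n}. single (ZVar s) (l s))"

abbreviation F :: "'a::comm_ring_1 mpoly" where "F \<equiv> trinomial k m n a l"

lemma lookup_eU [simp]:
  "lookup eU (XVar r) = (if r \<in> {1..k} then 1 else 0)"
  "lookup eU (YVar s) = (if s \<in> {1..m} then a s else 0)"
  "lookup eU (ZVar s) = 0"
  by (simp_all add: eU_def lookup_add lookup_sum lookup_single when_def)

lemma lookup_eT [simp]:
  "lookup eT (XVar r) = 0"
  "lookup eT (YVar s) = 0"
  "lookup eT (ZVar s) = (if s \<in> {1..n} then l s else 0)"
  by (simp_all add: eT_def lookup_sum lookup_single when_def)

lemma in_V [simp]:
  "XVar r \<in> V \<longleftrightarrow> r \<in> {1..k}" "YVar r \<in> V \<longleftrightarrow> r \<in> {1..m}" "ZVar r \<in> V \<longleftrightarrow> r \<in> {1..n}"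
  by (auto simp: variables_def)

lemma eU_keys: "v \<in> keys eU \<longleftrightarrow> v \<in> V \<and> (\<forall>s. v \<noteq> ZVar s)"
  by (cases v) (use a_gt in \<open>force simp: in_keys_iff\<close>)+

lemma eT_keys: "v \<in> keys eT \<longleftrightarrow> v \<in> V \<and> (\<exists>s. v = ZVar s)"
  by (cases v) (use l_gt in \<open>force simp: in_keys_iff\<close>)+

lemma trinomial_eq: "(F :: 'a::comm_ring_1 mpoly) = monomial eU - (monomial eT + 1)"
  by (simp add: trinomial_def eU_def eT_def monomial_add monomial_sum monomial_single)

lemma occurring_F: "occurring_vars (F :: 'a::comm_ring_1 mpoly) \<subseteq> V"
proof -
  have "keys eU \<subseteq> V" "keys eT \<subseteq> V" using eU_keys eT_keys by blast+
  then show ?thesis unfolding trinomial_eq by (intro occurring_vars_closed) simp_all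
qed

end

locale hypersurface_at = hypersurface +
  fixes i j :: nat
  assumes i_in: "i \<in> {1..k}" and j_in: "j \<in> {1..n}"
begin

text \<open>
  The relation becomes \<open>Q x\<^sub>i = R z\<^sub>j ^ l\<^sub>j + 1\<close>, where the monomials \<open>Q\<close> and \<open>R\<close> have the exponent vectors \<open>eQ\<close>
  and \<open>eR\<close>. The variables in \<open>W\<close> are the ones killed by \<open>\<partial>\<^sub>i\<^sub>j\<close>.
\<close>

definition eQ :: "variable \<Rightarrow>\<^sub>0 nat" where "eQ = eU - single (XVar i) 1"
definition eR :: "variable \<Rightarrow>\<^sub>0 nat" where "eR = eT - single (ZVar j) (l j)"
definition W :: "variable set" where "W = V - {XVar i, ZVar j}"

lemma eU_split: "eU = eQ + single (XVar i) 1"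
  using i_in by (intro poly_mapping_eqI) (auto simp: eQ_def lookup_add lookup_minus lookup_single when_def)

lemma eT_split: "eT = eR + single (ZVar j) (l j)"
  using j_in by (intro poly_mapping_eqI) (auto simp: eR_def lookup_add lookup_minus lookup_single when_def)

lemma monomial_eU: "monomial eU = monomial eQ * var (XVar i)"
  by (subst eU_split) (simp add: monomial_add var_monomial)

lemma monomial_eT: "monomial eT = monomial eR * var (ZVar j) ^ l j"
  by (subst eT_split) (simp add: monomial_add monomial_single)

lemma keys_eQ: "v \<in> keys eQ \<longleftrightarrow> v \<in> V \<and> (\<forall>s. v \<noteq> ZVar s) \<and> v \<noteq> XVar i"
  using eU_keys[of v]
  by (cases v) (auto simp: in_keys_iff eQ_def lookup_minus lookup_single when_def)

lemma keys_eR: "v \<in> keys eR \<longleftrightarrow> v \<in> V \<and> (\<exists>s. v = ZVar s) \<and> v \<noteq> ZVar j"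
  using eT_keys[of v]
  by (cases v) (auto simp: in_keys_iff eR_def lookup_minus lookup_single when_def)

lemma keys_eQ_W: "keys eQ \<subseteq> W" and keys_eR_W: "keys eR \<subseteq> W"
  by (auto simp: keys_eQ keys_eR W_def)

lemma V_eq: "V = insert (XVar i) (insert (ZVar j) W)"
  using i_in j_in by (auto simp: W_def)

text \<open>
  Modulo \<open>F\<close>, a factor \<open>Q\<close> turns \<open>x\<^sub>i\<close> into \<open>R z\<^sub>j ^ l\<^sub>j + 1\<close>, so a high power of \<open>Q\<close> removes \<open>x\<^sub>i\<close> from any
  polynomial. The set \<open>X\<close> allows for variables that do not belong to the hypersurface.
\<close>

lemma clear_denominator:
  fixes p :: "'a::idom mpoly"
  assumes "occurring_vars p \<subseteq> V \<union> X" "XVar i \<notin> X" "ZVar j \<notin> X"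
  shows "\<exists>N c g. monomial eQ ^ N * p = poly c (var (ZVar j)) + F * g \<and>
     (\<forall>r. occurring_vars (coeff c r) \<subseteq> W \<union> X)"
  using assms(1)
proof (induction rule: mpoly_induct)
  case (const t)
  have "occurring_vars (coeff [:const t:] r) \<subseteq> W \<union> X" for r
    by (cases r) auto
  then show ?case by (intro exI[of _ 0] exI[of _ "[:const t:]"]) simp
next
  case (var v)
  consider "v = XVar i" | "v = ZVar j" | "v \<in> W \<union> X" using var by (auto simp: V_eq)
  then show ?case
  proof cases
    case 1
    have "monomial eQ ^ 1 * var v = poly (monom (monomial eR) (l j) + [:1:]) (var (ZVar j)) + F * (1 :: 'a mpoly)"
      by (simp add: 1 trinomial_eq monomial_eU monomial_eT poly_monom algebra_simps)
    moreover have "occurring_vars (coeff (monom (monomial eR) (l j) + [:1:] :: 'a mpoly poly) r) \<subseteq> W \<union> X" for r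
      using keys_eR_W by (auto simp: coeff_pCons split: nat.splits
          dest!: subsetD[OF occurring_vars_add])
    ultimately show ?thesis by blast
  next
    case 2
    have "occurring_vars (coeff [:0, 1 :: 'a mpoly:] r) \<subseteq> W \<union> X" for r
      by (simp add: coeff_pCons split: nat.splits)
    then show ?thesis by (intro exI[of _ 0] exI[of _ "[:0, 1:]"] exI[of _ 0]) (simp add: 2)
  next
    case 3
    have "occurring_vars (coeff [:var v :: 'a mpoly:] r) \<subseteq> W \<union> X" for r
      using 3 by (simp add: coeff_pCons split: nat.splits)
    then show ?thesis by (intro exI[of _ 0] exI[of _ "[:var v:]"] exI[of _ 0]) simp
  qed
next
  case (add p q)
  then obtain M c f N d g where
    p: "monomial eQ ^ M * p = poly c (var (ZVar j)) + F * f" "\<And>r. occurring_vars (coeff c r) \<subseteq> W \<union> X" and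
    q: "monomial eQ ^ N * q = poly d (var (ZVar j)) + F * g" "\<And>r. occurring_vars (coeff d r) \<subseteq> W \<union> X"
    by blast
  let ?Q = "monomial eQ :: 'a mpoly"
  have "?Q ^ (M + N) * (p + q) = ?Q ^ N * (?Q ^ M * p) + ?Q ^ M * (?Q ^ N * q)"
    by (simp add: power_add algebra_simps)
  also have "\<dots> = poly (smult (?Q ^ N) c + smult (?Q ^ M) d) (var (ZVar j)) + F * (?Q ^ N * f + ?Q ^ M * g)"
    by (simp only: p q) (simp add: algebra_simps)
  finally have "?Q ^ (M + N) * (p + q) = \<dots>" .
  moreover have "occurring_vars (coeff (smult (?Q ^ N) c + smult (?Q ^ M) d) r) \<subseteq> W \<union> X" for r
    unfolding coeff_add coeff_smult
    by (intro occurring_vars_closed occurring_vars_power p q) (use keys_eQ_W in auto)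
  ultimately show ?case by blast
next
  case (mult p q)
  then obtain M c f N d g where
    p: "monomial eQ ^ M * p = poly c (var (ZVar j)) + F * f" "\<And>r. occurring_vars (coeff c r) \<subseteq> W \<union> X" and
    q: "monomial eQ ^ N * q = poly d (var (ZVar j)) + F * g" "\<And>r. occurring_vars (coeff d r) \<subseteq> W \<union> X"
    by blast
  let ?Q = "monomial eQ :: 'a mpoly" and ?z = "var (ZVar j) :: 'a mpoly"
  have "?Q ^ (M + N) * (p * q) = (?Q ^ M * p) * (?Q ^ N * q)"
    by (simp add: power_add algebra_simps)
  also have "\<dots> = poly (c * d) ?z + F * (poly c ?z * g + f * poly d ?z + F * (f * g))"
    by (simp only: p q) (simp add: algebra_simps)
  finally have "?Q ^ (M + N) * (p * q) = \<dots>" .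
  moreover have "occurring_vars (coeff (c * d) r) \<subseteq> W \<union> X" for r
    unfolding coeff_mult
    by (intro occurring_vars_closed occurring_vars_sum p q)
  ultimately show ?case by blast
qed

end

interpretation univ: coefficient_hom "\<lambda>t. [:const t :: 'a::comm_ring_1 mpoly:]"
  by standard (auto simp: const_add const_mult one_pCons)

context hypersurface_at
begin

text \<open>Set \<open>v\<close> to \<open>0\<close> and read the result as a polynomial in \<open>z\<^sub>j\<close>.\<close>

definition reduct :: "variable \<Rightarrow> 'a::comm_ring_1 mpoly \<Rightarrow> 'a mpoly poly" where
  "reduct v = univ.eval (\<lambda>w. if w = v then 0 else if w = ZVar j then [:0, 1:] else [:var w:])"

lemma poly_reduct:
  fixes p :: "'a::comm_ring_1 mpoly"
  shows "poly (reduct v p) (var (ZVar j)) = subst.eval (var(v := 0)) p"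
  unfolding reduct_def
  by (rule sym, rule subst.eval_unique[of p UNIV]) (auto simp: univ.eval_simps)

lemma reduct_no_z:
  fixes p :: "'a::comm_ring_1 mpoly"
  assumes "ZVar j \<notin> occurring_vars p"
  shows "reduct v p = [:subst.eval (var(v := 0)) p:]"
  unfolding reduct_def
  by (rule univ.eval_unique[of p "occurring_vars p"])
    (use assms in \<open>auto simp: subst.eval_simps\<close>)

lemma reduct_F:
  assumes "v \<in> keys eQ"
  shows "reduct v (F :: 'a::comm_ring_1 mpoly) = - (monom (monomial eR) (l j) + 1)"
proof -
  have vR: "v \<notin> keys eR" "v \<noteq> ZVar j" using assms by (auto simp: keys_eQ keys_eR)
  have "reduct v (monomial eQ :: 'a mpoly) = 0"
    unfolding reduct_def univ.eval_monomial power_product_def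
    by (rule prod_zero) (use assms in \<open>auto intro!: bexI[of _ v] zero_power simp: in_keys_iff\<close>)
  then have "reduct v (monomial eU :: 'a mpoly) = 0"
    by (simp add: monomial_eU reduct_def univ.eval_simps)
  moreover have "reduct v (monomial eR :: 'a mpoly) = [:monomial eR:]"
  proof -
    have "reduct v (monomial eR :: 'a mpoly) = [:subst.eval (var(v := 0)) (monomial eR):]"
      by (rule reduct_no_z) (simp add: keys_eR)
    also have "subst.eval (var(v := 0)) (monomial eR) = (subst.eval var (monomial eR) :: 'a mpoly)"
      by (rule subst.eval_cong) (use vR in auto)
    finally show ?thesis by (simp add: subst_var)
  qed
  ultimately show ?thesis
    using vR(2) unfolding trinomial_eq monomial_eT
    by (simp add: reduct_def univ.eval_simps monom_altdef)
qed

text \<open>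
  For a factor \<open>v\<close> of \<open>Q\<close>, setting \<open>v = 0\<close> turns \<open>F\<close> into \<open>- (R z\<^sub>j ^ l\<^sub>j + 1)\<close>, of degree \<open>l\<^sub>j > 1\<close> in \<open>z\<^sub>j\<close>. A
  multiple of it cannot equal the reduction of \<open>\<alpha> + \<beta> z\<^sub>j\<close>, of degree at most one, unless both vanish, that is, unless
  \<open>v\<close> divides \<open>\<alpha>\<close>, \<open>\<beta>\<close> and the cofactor of \<open>F\<close>.
\<close>

lemma cancel_var:
  fixes p \<alpha> \<beta> g :: "'a::idom mpoly"
  assumes v: "v \<in> keys eQ"
    and eq: "var v * p = \<alpha> + \<beta> * var (ZVar j) + F * g"
    and occ: "occurring_vars \<alpha> \<subseteq> W" "occurring_vars \<beta> \<subseteq> W"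
  obtains \<alpha>' \<beta>' g' where "p = \<alpha>' + \<beta>' * var (ZVar j) + F * g'" "\<alpha> = var v * \<alpha>'" "\<beta> = var v * \<beta>'"
    "occurring_vars \<alpha>' \<subseteq> W" "occurring_vars \<beta>' \<subseteq> W"
proof -
  let ?s = "subst.eval (var(v := 0)) :: 'a mpoly \<Rightarrow> 'a mpoly"
  let ?c = "monom (monomial eR) (l j) + 1 :: 'a mpoly poly"
  have vW: "v \<in> W" using v keys_eQ_W by blast
  have vz: "v \<noteq> ZVar j" using v by (auto simp: keys_eQ)
  have hom: "reduct v (p + q) = reduct v p + reduct v q" "reduct v (p * q) = reduct v p * reduct v q"
    for p q :: "'a mpoly"
    by (simp_all add: reduct_def univ.eval_simps)
  have "reduct v (var v * p) = 0" by (simp add: hom(2)) (simp add: reduct_def)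
  moreover have "reduct v (var (ZVar j) :: 'a mpoly) = [:0, 1:]" using vz by (simp add: reduct_def)
  moreover have "reduct v \<alpha> = [:?s \<alpha>:]" "reduct v \<beta> = [:?s \<beta>:]"
    using occ by (auto simp: W_def intro!: reduct_no_z)
  ultimately have "0 = [:?s \<alpha>:] + [:?s \<beta>:] * [:0, 1:] + reduct v F * reduct v g"
    unfolding eq hom by simp
  then have red: "[:?s \<alpha>, ?s \<beta>:] = ?c * reduct v g"
    unfolding reduct_F[OF v] by (simp add: algebra_simps)
  \<comment> \<open>A nonzero cofactor would make the right-hand side of degree at least \<open>l j\<close> in \<open>z\<^sub>j\<close>.\<close>
  have "reduct v g = 0"
  proof (rule ccontr)
    assume nz: "reduct v g \<noteq> 0"
    have lj: "l j > 1" using l_gt j_in by blast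
    have "degree ?c = l j"
      by (subst degree_add_eq_left) (use lj in \<open>simp_all add: degree_monom_eq\<close>)
    moreover from this lj have "?c \<noteq> 0" by (metis degree_0 not_less_zero)
    ultimately have "degree [:?s \<alpha>, ?s \<beta>:] \<ge> l j"
      using nz unfolding red by (simp add: degree_mult_eq)
    then show False using lj by (simp add: degree_pCons_eq_if split: if_splits)
  qed
  then have z: "?s \<alpha> = 0" "?s \<beta> = 0" "?s g = 0"
    using red poly_reduct[of v g] by auto
  obtain \<alpha>' where \<alpha>': "occurring_vars \<alpha>' \<subseteq> W" "\<alpha> = var v * \<alpha>'"
    using split_off_var[OF occ(1) vW] z by auto
  obtain \<beta>' where \<beta>': "occurring_vars \<beta>' \<subseteq> W" "\<beta> = var v * \<beta>'"
    using split_off_var[OF occ(2) vW] z by auto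
  obtain g' where g': "g = var v * g'"
    using split_off_var[of g UNIV v] z by auto
  have "var v * p = var v * (\<alpha>' + \<beta>' * var (ZVar j) + F * g')"
    unfolding eq \<alpha>'(2) \<beta>'(2) g' by (simp add: algebra_simps)
  then have "p = \<alpha>' + \<beta>' * var (ZVar j) + F * g'" by (simp add: var_monomial)
  then show ?thesis using \<alpha>' \<beta>' that by blast
qed

text \<open>A power of \<open>Q\<close> is a product of variables that divide \<open>Q\<close>, which can be cancelled one at a time.\<close>

lemma cancel_Q:
  fixes p :: "'a::idom mpoly"
  assumes cancel: "\<And>v q. v \<in> keys eQ \<Longrightarrow> P (var v * q) \<Longrightarrow> P q"
    and "P (monomial eQ ^ N * p)"
  shows "P p"
proof -
  have pow: "P q" if "v \<in> keys eQ" "P (var v ^ r * q)" for v r q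
    using that(2)
  proof (induction r)
    case (Suc r)
    then show ?case using cancel[OF that(1), of "var v ^ r * q"] by (simp only: power_Suc mult.assoc)
  qed simp
  have prd: "P q" if "X \<subseteq> keys eQ" "finite X" "P ((\<Prod>v\<in>X. var v ^ e v) * q)" for X e q
    using that(2,1,3)
  proof (induction X arbitrary: q rule: finite_induct)
    case (insert v X)
    have "P (var v ^ e v * ((\<Prod>v\<in>X. var v ^ e v) * q))"
      using insert.prems(2) insert.hyps by (simp add: mult.assoc)
    then have "P ((\<Prod>v\<in>X. var v ^ e v) * q)" by (rule pow[rotated]) (use insert.prems in simp)
    then show ?case by (rule insert.IH[rotated]) (use insert.prems in simp)
  qed simp
  have Q: "P q" if "P (monomial eQ * q)" for q
    using that unfolding monomial_power_product power_product_def by (rule prd[OF order_refl finite_keys])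
  show ?thesis using assms(2)
  proof (induction N)
    case (Suc N)
    then show ?case using Q[of "monomial eQ ^ N * p"] by (simp only: power_Suc mult.assoc)
  qed simp
qed

lemma F_dvd_cancel_Q:
  fixes p :: "'a::idom mpoly"
  assumes "F dvd monomial eQ ^ N * p"
  shows "F dvd p"
  using assms
proof (rule cancel_Q[rotated])
  fix v and q :: "'a mpoly" assume v: "v \<in> keys eQ" and "F dvd var v * q"
  then obtain g where g: "var v * q = 0 + 0 * var (ZVar j) + F * g" by (auto elim: dvdE)
  obtain \<alpha>' \<beta>' g' where "q = \<alpha>' + \<beta>' * var (ZVar j) + F * g'" "0 = var v * \<alpha>'" "0 = var v * \<beta>'"
    by (rule cancel_var[OF v g]) auto
  then show "F dvd q" by (simp add: var_monomial)
qed

end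

interpretation frac: coefficient_hom "\<lambda>t :: 'a::idom. Fract (const t) 1"
  by standard (auto simp: const_add const_mult One_fract_def)

section \<open>The coordinate ring as a subring of a field\<close>

context hypersurface_at
begin

text \<open>Evaluation at \<open>x\<^sub>i = (T + 1) / Q\<close>, the solution of \<open>F = 0\<close> for \<open>x\<^sub>i\<close>.\<close>

definition Phi :: "'a::idom mpoly \<Rightarrow> 'a mpoly fract" where
  "Phi = frac.eval (\<lambda>v. if v = XVar i then Fract (monomial eT + 1) (monomial eQ) else Fract (var v) 1)"

lemma Phi_add: "Phi (p + q) = Phi p + Phi q"
  and Phi_mult: "Phi (p * q) = Phi p * Phi q"
  and Phi_diff: "Phi (p - q) = Phi p - Phi q"
  and Phi_uminus: "Phi (- p) = - Phi p"
  and Phi_power: "Phi (p ^ N) = Phi p ^ N"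
  and Phi_zero [simp]: "Phi 0 = 0"
  and Phi_one [simp]: "Phi 1 = 1"
  and Phi_of_nat: "Phi (of_nat N) = of_nat N"
  by (simp_all add: Phi_def frac.eval_simps frac.eval_of_nat)

lemma Phi_sum: "Phi (sum f B) = (\<Sum>x\<in>B. Phi (f x))"
  by (simp add: Phi_def frac.eval_sum)

lemma Phi_prod: "Phi (prod f B) = (\<Prod>x\<in>B. Phi (f x))"
  by (simp add: Phi_def frac.eval_prod)

lemmas Phi_simps = Phi_add Phi_mult Phi_diff Phi_uminus Phi_power

lemma Phi_no_x:
  assumes "XVar i \<notin> occurring_vars p"
  shows "Phi p = Fract p 1"
  unfolding Phi_def
  by (rule frac.eval_unique[of p "occurring_vars p"]) (use assms in auto)

lemma Phi_no_x_eq_0: "XVar i \<notin> occurring_vars p \<Longrightarrow> Phi p = 0 \<longleftrightarrow> p = 0"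
  by (simp add: Phi_no_x Zero_fract_def eq_fract)

lemma Phi_Q_nonzero [simp]: "Phi (monomial eQ) \<noteq> 0"
  by (subst Phi_no_x_eq_0) (auto simp: keys_eQ)

lemma x_notin_T: "XVar i \<notin> occurring_vars (monomial eT + 1 :: 'a::comm_ring_1 mpoly)"
proof -
  have "XVar i \<notin> keys eT" by (simp add: eT_keys)
  then show ?thesis using occurring_vars_add[of "monomial eT" "1 :: 'a mpoly"] by auto
qed

lemma Phi_x: "Phi (monomial eQ) * Phi (var (XVar i)) = Phi (monomial eT) + 1"
proof -
  have "Phi (var (XVar i)) = Fract (monomial eT + 1 :: 'a mpoly) (monomial eQ)"
    by (simp add: Phi_def)
  moreover have "Phi (monomial eQ) = Fract (monomial eQ :: 'a mpoly) 1"
    by (rule Phi_no_x) (simp add: keys_eQ)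
  moreover have "Phi (monomial eT) + 1 = Fract (monomial eT + 1 :: 'a mpoly) 1"
    using Phi_no_x[OF x_notin_T, where 'a = 'a] by (simp add: Phi_add)
  ultimately show ?thesis by (simp add: eq_fract)
qed

lemma Phi_U: "Phi (monomial eU) = Phi (monomial eT) + 1"
  using Phi_x by (simp add: monomial_eU Phi_mult)

lemma Phi_F [simp]: "Phi F = 0"
  by (simp add: trinomial_eq Phi_diff Phi_add Phi_U)

text \<open>
  A power of \<open>Q\<close> moves \<open>p\<close>, modulo \<open>F\<close>, into the polynomials without \<open>x\<^sub>i\<close>, where \<open>Phi\<close> is the inclusion into the
  fraction field. So \<open>F\<close> divides \<open>Q\<^sup>N p\<close>, and \<open>Q\<close> can be cancelled.
\<close>

lemma Phi_eq_0_iff: "Phi p = 0 \<longleftrightarrow> F dvd p"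
proof
  assume "F dvd p"
  then show "Phi p = 0" by (auto simp: Phi_mult elim!: dvdE)
next
  assume p: "Phi p = 0"
  obtain N c g where N: "monomial eQ ^ N * p = poly c (var (ZVar j)) + F * g"
    and c: "\<And>r. occurring_vars (coeff c r) \<subseteq> W \<union> (UNIV - V)"
    using clear_denominator[of p "UNIV - V"] i_in j_in by (metis Diff_iff Un_Diff_cancel Un_UNIV_right in_V(1,3) top_greatest)
  have "occurring_vars (poly c (var (ZVar j))) \<subseteq> UNIV - {XVar i}"
  proof (rule poly_in_occurring)
    show "occurring_vars (coeff c r) \<subseteq> UNIV - {XVar i}" for r
      using c[of r] i_in by (auto simp: W_def)
  qed simp
  then have "XVar i \<notin> occurring_vars (poly c (var (ZVar j)))" by blast
  moreover have "Phi (poly c (var (ZVar j))) = 0"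
    using arg_cong[OF N, of Phi] p by (simp add: Phi_simps)
  ultimately have "poly c (var (ZVar j)) = 0" by (simp add: Phi_no_x_eq_0)
  then show "F dvd p" using N by - (rule F_dvd_cancel_Q[of N], simp)
qed

lemma Phi_eq_iff: "Phi p = Phi q \<longleftrightarrow> F dvd p - q"
  using Phi_eq_0_iff[of "p - q"] by (simp add: Phi_diff)

lemma Phi_const_eq_0 [simp]: "Phi (const t) = 0 \<longleftrightarrow> t = 0"
  by (subst Phi_no_x_eq_0) auto

lemma Phi_var_nonzero [simp]: "Phi (var v) \<noteq> 0"
proof (cases "v = XVar i")
  case True
  have "Phi (monomial eT + 1 :: 'a mpoly) \<noteq> 0"
  proof (subst Phi_no_x_eq_0[OF x_notin_T])
    have "eT \<noteq> 0" using eT_keys[of "ZVar j"] j_in by auto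
    then have "lookup (monomial eT + 1 :: 'a mpoly) 0 = 1"
      by (simp add: lookup_add monomial_def lookup_single lookup_one when_def)
    then show "monomial eT + 1 \<noteq> (0 :: 'a mpoly)" by (metis lookup_zero zero_neq_one)
  qed
  then show ?thesis using Phi_x[where 'a = 'a] True by (auto simp: Phi_add)
next
  case False
  then show ?thesis by (subst Phi_no_x_eq_0) (auto simp: var_monomial)
qed

lemma Phi_monomial: "Phi (monomial e) = (\<Prod>v\<in>keys e. Phi (var v) ^ lookup e v)"
  by (simp add: monomial_power_product power_product_def Phi_prod Phi_power)

lemma Phi_monomial_nonzero [simp]: "Phi (monomial e) \<noteq> 0"
  by (simp add: Phi_monomial)

definition S :: "'a::idom mpoly fract set" where
  "S = Phi ` {p. occurring_vars p \<subseteq> V}"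

lemma Phi_in_S [intro]: "occurring_vars p \<subseteq> V \<Longrightarrow> Phi p \<in> S"
  by (simp add: S_def)

lemma in_S_cases: "f \<in> S \<Longrightarrow> (\<And>p. f = Phi p \<Longrightarrow> occurring_vars p \<subseteq> V \<Longrightarrow> P) \<Longrightarrow> P"
  by (auto simp: S_def)

lemma Phi_var_in_S [intro]: "v \<in> V \<Longrightarrow> Phi (var v) \<in> S"
  by (rule Phi_in_S) simp

lemma Phi_const_in_S [intro]: "Phi (const t) \<in> S"
  by (rule Phi_in_S) simp

lemma Phi_monomial_in_S [intro]: "keys e \<subseteq> V \<Longrightarrow> Phi (monomial e) \<in> S"
  by (rule Phi_in_S) simp

text \<open>The derivations of \<open>S\<close> that are linear over the ground field: by the Leibniz rule it suffices that they kill the scalars.\<close>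

definition kder :: "('a::{idom, ring_char_0} mpoly fract \<Rightarrow> 'a mpoly fract) \<Rightarrow> bool" where
  "kder d \<longleftrightarrow> subring_derivation S d \<and> (\<forall>t. d (Phi (const t)) = 0)"

lemma S_closed:
  assumes "f \<in> S" "g \<in> S"
  shows "f + g \<in> S" "f * g \<in> S" "- f \<in> S"
proof -
  obtain p q where pq: "f = Phi p" "g = Phi q" "occurring_vars p \<subseteq> V" "occurring_vars q \<subseteq> V"
    using assms by (metis in_S_cases)
  have "Phi (p + q) \<in> S" "Phi (p * q) \<in> S" "Phi (- p) \<in> S"
    by (rule Phi_in_S, rule occurring_vars_closed, use pq in simp_all)+
  then show "f + g \<in> S" "f * g \<in> S" "- f \<in> S" by (simp_all only: Phi_simps pq)
qed

lemma kderI: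
  assumes "\<And>f. f \<in> S \<Longrightarrow> d f \<in> S" "\<And>f g. f \<in> S \<Longrightarrow> g \<in> S \<Longrightarrow> d (f + g) = d f + d g"
    and "\<And>f g. f \<in> S \<Longrightarrow> g \<in> S \<Longrightarrow> d (f * g) = d f * g + f * d g"
    and "\<And>t. d (Phi (const t)) = 0"
  shows "kder d"
proof -
  have "(1 :: 'a mpoly fract) \<in> S" using Phi_const_in_S[of 1] by simp
  then show ?thesis
    unfolding kder_def subring_derivation_def using assms S_closed by auto
qed

lemma kder_eqI:
  assumes d: "kder d" and d': "kder d'"
    and eq: "\<And>v. v \<in> V \<Longrightarrow> d (Phi (var v)) = d' (Phi (var v))"
    and f: "f \<in> S"
  shows "d f = d' f"
proof -
  interpret d: subring_derivation S d using d by (simp add: kder_def)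
  interpret d': subring_derivation S d' using d' by (simp add: kder_def)
  obtain p where p: "f = Phi p" "occurring_vars p \<subseteq> V" using f by (rule in_S_cases)
  have "Phi p \<in> S \<and> d (Phi p) = d' (Phi p)"
    using p(2)
  proof (induction rule: mpoly_induct)
    case (const t)
    then show ?case using d d' by (auto simp: kder_def)
  qed (auto simp: eq Phi_simps d.add_in d.mult_in d.D_add d'.D_add d.D_mult d'.D_mult)
  then show ?thesis using p by simp
qed

lemma kder_scale: "kder d \<Longrightarrow> c \<in> S \<Longrightarrow> kder (\<lambda>f. c * d f)"
  by (rule kderI)
    (auto simp: kder_def subring_derivation_def S_closed algebra_simps)

end

section \<open>Passing between the quotient ring and the subring\<close>

lemma cring_mpoly_ring: "cring (mpoly_ring X :: 'a::comm_ring_1 mpoly ring)"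
proof (rule cringI)
  show "abelian_group (mpoly_ring X :: 'a mpoly ring)"
  proof (rule abelian_groupI)
    fix p :: "'a mpoly" assume "p \<in> carrier (mpoly_ring X)"
    then show "\<exists>q\<in>carrier (mpoly_ring X). q \<oplus>\<^bsub>mpoly_ring X\<^esub> p = \<zero>\<^bsub>mpoly_ring X\<^esub>"
      by (intro bexI[of _ "- p"]) (auto simp: mpoly_ring_def)
  qed (auto simp: mpoly_ring_def add_ac dest!: subsetD[OF occurring_vars_add])
  show "Group.comm_monoid (mpoly_ring X :: 'a mpoly ring)"
    by (rule comm_monoidI) (auto simp: mpoly_ring_def mult_ac dest!: subsetD[OF occurring_vars_mult])
qed (auto simp: mpoly_ring_def distrib_right)

context hypersurface_at
begin

abbreviation "R \<equiv> mpoly_ring V"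
abbreviation "B \<equiv> coordinate_ring k m n a l"
abbreviation "\<iota> \<equiv> scalar k m n a l"
abbreviation "rc \<equiv> residue_class k m n a l"

lemma ideal_I: "ideal (trinomial_ideal k m n a l) (R :: 'a::comm_ring_1 mpoly ring)"
  unfolding trinomial_ideal_def
  by (rule cring.cgenideal_ideal[OF cring_mpoly_ring]) (use occurring_F in \<open>auto simp: mpoly_ring_def\<close>)

lemma rc_hom:
  fixes p q :: "'a::comm_ring_1 mpoly"
  assumes "occurring_vars p \<subseteq> V" "occurring_vars q \<subseteq> V"
  shows "rc (p + q) = rc p \<oplus>\<^bsub>B\<^esub> rc q" "rc (p * q) = rc p \<otimes>\<^bsub>B\<^esub> rc q"
proof -
  have "rc \<in> ring_hom (R :: 'a mpoly ring) B"
    unfolding residue_class_def coordinate_ring_def using ideal.rcos_ring_hom[OF ideal_I] by simp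
  then show "rc (p + q) = rc p \<oplus>\<^bsub>B\<^esub> rc q" "rc (p * q) = rc p \<otimes>\<^bsub>B\<^esub> rc q"
    using assms by (auto simp: ring_hom_def mpoly_ring_def)
qed

lemma rc_one: "rc 1 = \<one>\<^bsub>B\<^esub>"
  using ring_hom_one[OF ideal.rcos_ring_hom[OF ideal_I]]
  by (simp add: residue_class_def coordinate_ring_def mpoly_ring_def)

lemma cring_B: "cring (B :: 'a::comm_ring_1 mpoly set ring)"
  unfolding coordinate_ring_def by (rule ideal.quotient_is_cring[OF ideal_I cring_mpoly_ring])

lemma carrier_B: "carrier B = rc ` {p. occurring_vars p \<subseteq> V}"
  by (auto simp: coordinate_ring_def FactRing_def A_RCOSETS_def' residue_class_def mpoly_ring_def)

lemma rc_in_B [intro]: "occurring_vars p \<subseteq> V \<Longrightarrow> rc p \<in> carrier B"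
  by (auto simp: carrier_B)

lemma B_cases: "b \<in> carrier B \<Longrightarrow> (\<And>p. b = rc p \<Longrightarrow> occurring_vars p \<subseteq> V \<Longrightarrow> P) \<Longrightarrow> P"
  by (auto simp: carrier_B)

text \<open>
  The ideal is generated within the polynomials in the variables of the hypersurface. Setting all other variables to \<open>0\<close>
  turns any cofactor of \<open>F\<close> into one from that ring.
\<close>

lemma in_trinomial_ideal_iff:
  fixes p :: "'a::comm_ring_1 mpoly"
  assumes "occurring_vars p \<subseteq> V"
  shows "p \<in> trinomial_ideal k m n a l \<longleftrightarrow> F dvd p"
proof
  assume "p \<in> trinomial_ideal k m n a l"
  then show "F dvd p" by (auto simp: trinomial_ideal_def cgenideal_def mpoly_ring_def)
next
  assume "F dvd p"
  then obtain g where g: "p = F * g" by (auto elim: dvdE)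
  \<comment> \<open>the retraction onto the polynomials in the variables of the hypersurface\<close>
  define s where "s = subst.eval (\<lambda>v. if v \<in> V then var v else 0 :: 'a mpoly)"
  have fixed: "s q = q" if "occurring_vars q \<subseteq> V" for q
    unfolding s_def using that
    by (subst subst.eval_cong[of q _ var]) (auto simp: subst_var)
  have "p = s F * s g" using g fixed[OF assms] by (simp add: s_def subst.eval_mult)
  then have "p = s g * F" by (simp add: fixed[OF occurring_F] mult.commute)
  moreover have "occurring_vars (s g) \<subseteq> V"
    unfolding s_def by (rule occurring_vars_subst[of g UNIV]) auto
  ultimately show "p \<in> trinomial_ideal k m n a l"
    by (auto simp: trinomial_ideal_def cgenideal_def mpoly_ring_def)
qed

lemma rc_eq_iff:
  fixes p q :: "'a::idom mpoly"
  assumes "occurring_vars p \<subseteq> V" "occurring_vars q \<subseteq> V"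
  shows "rc p = rc q \<longleftrightarrow> Phi p = Phi q"
proof -
  interpret R: cring "R :: 'a mpoly ring" by (rule cring_mpoly_ring)
  have in_R: "p \<in> carrier R" "q \<in> carrier R" using assms by (auto simp: mpoly_ring_def)
  have "\<ominus>\<^bsub>R\<^esub> q = - q"
    by (rule R.minus_equality) (use assms in \<open>auto simp: mpoly_ring_def\<close>)
  then have "p \<ominus>\<^bsub>R\<^esub> q = p - q" by (simp add: a_minus_def) (simp add: mpoly_ring_def)
  moreover have "rc p = rc q \<longleftrightarrow> p \<ominus>\<^bsub>R\<^esub> q \<in> trinomial_ideal k m n a l"
    unfolding residue_class_def using R.quotient_eq_iff_same_a_r_cos[OF ideal_I in_R] by simp
  ultimately show ?thesis
    using in_trinomial_ideal_iff[of "p - q"] occurring_vars_closed(3)[OF assms] by (simp add: Phi_eq_iff)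
qed

lemma rc_zero: "rc 0 = \<zero>\<^bsub>B\<^esub>"
proof -
  interpret B: cring "B :: 'a mpoly set ring" by (rule cring_B)
  have "rc (0 + 0 :: 'a mpoly) = rc 0 \<oplus>\<^bsub>B\<^esub> rc 0" by (rule rc_hom) auto
  moreover have "rc (0 :: 'a mpoly) \<in> carrier B" by auto
  ultimately show ?thesis using B.add.l_cancel_one'[of "rc 0" "rc 0"] by auto
qed

text \<open>
  The isomorphism from the quotient ring to \<open>S\<close> and its inverse. Both are defined on representatives, which does not
  depend on the choice since \<open>rc\<close> and \<open>Phi\<close> identify the same polynomials.
\<close>

definition theta :: "'a::idom mpoly set \<Rightarrow> 'a mpoly fract" where
  "theta b = Phi (SOME p. occurring_vars p \<subseteq> V \<and> rc p = b)"

definition theta_inv :: "'a::idom mpoly fract \<Rightarrow> 'a mpoly set" where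
  "theta_inv f = rc (SOME p. occurring_vars p \<subseteq> V \<and> Phi p = f)"

lemma theta_rc [simp]:
  assumes "occurring_vars p \<subseteq> V"
  shows "theta (rc p) = Phi p"
proof -
  let ?q = "SOME q. occurring_vars q \<subseteq> V \<and> rc q = rc p"
  have "occurring_vars ?q \<subseteq> V \<and> rc ?q = rc p"
    by (rule someI[of _ p]) (use assms in simp)
  then show ?thesis using rc_eq_iff assms unfolding theta_def by blast
qed

lemma theta_inv_Phi [simp]:
  assumes "occurring_vars p \<subseteq> V"
  shows "theta_inv (Phi p) = rc p"
proof -
  let ?q = "SOME q. occurring_vars q \<subseteq> V \<and> Phi q = Phi p"
  have "occurring_vars ?q \<subseteq> V \<and> Phi ?q = Phi p"
    by (rule someI[of _ p]) (use assms in simp)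
  then show ?thesis using rc_eq_iff assms unfolding theta_inv_def by blast
qed

lemma theta_in_S: "b \<in> carrier B \<Longrightarrow> theta b \<in> S"
  by (auto elim!: B_cases)

lemma theta_inv_in_B: "f \<in> S \<Longrightarrow> theta_inv f \<in> carrier B"
  by (auto elim!: in_S_cases)

lemma theta_theta_inv: "f \<in> S \<Longrightarrow> theta (theta_inv f) = f"
  by (auto elim!: in_S_cases)

lemma theta_inv_theta: "b \<in> carrier B \<Longrightarrow> theta_inv (theta b) = b"
  by (auto elim!: B_cases)

lemma theta_inject: "b \<in> carrier B \<Longrightarrow> c \<in> carrier B \<Longrightarrow> theta b = theta c \<Longrightarrow> b = c"
  by (metis theta_inv_theta)

lemma theta_hom:
  assumes "b \<in> carrier B" "c \<in> carrier B"
  shows "theta (b \<oplus>\<^bsub>B\<^esub> c) = theta b + theta c" "theta (b \<otimes>\<^bsub>B\<^esub> c) = theta b * theta c"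
  using assms by (auto elim!: B_cases simp: Phi_simps occurring_vars_closed simp flip: rc_hom)

lemma theta_zero [simp]: "theta \<zero>\<^bsub>B\<^esub> = 0"
  by (simp flip: rc_zero)

lemma theta_scalar [simp]: "theta (\<iota> t) = Phi (const t)"
  by (simp add: scalar_def)

lemma scalar_in_B: "\<iota> t \<in> carrier B"
  by (auto simp: scalar_def)

definition transport :: "('a::idom mpoly set \<Rightarrow> 'a mpoly set) \<Rightarrow> 'a mpoly fract \<Rightarrow> 'a mpoly fract" where
  "transport D f = theta (D (theta_inv f))"

lemma transport_theta: "b \<in> carrier B \<Longrightarrow> transport D (theta b) = theta (D b)"
  by (simp add: transport_def theta_inv_theta)

lemma transport_Phi: "occurring_vars p \<subseteq> V \<Longrightarrow> transport D (Phi p) = theta (D (rc p))"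
  by (simp add: transport_def)

lemma kder_transport:
  fixes D :: "'a::{idom, ring_char_0} mpoly set \<Rightarrow> 'a mpoly set"
  assumes D: "derivation B \<iota> D"
  shows "kder (transport D)"
proof -
  interpret B: cring "B :: 'a mpoly set ring" by (rule cring_B)
  have D_in: "D b \<in> carrier B" if "b \<in> carrier B" for b
    using D that by (auto simp: derivation_def)
  show ?thesis
  proof (rule kderI)
    fix f :: "'a mpoly fract" assume "f \<in> S"
    then show "transport D f \<in> S" by (simp add: transport_def theta_in_S theta_inv_in_B D_in)
  next
    fix f g :: "'a mpoly fract" assume "f \<in> S" "g \<in> S"
    then obtain b c where bc: "f = theta b" "g = theta c" "b \<in> carrier B" "c \<in> carrier B"
      by (metis theta_inv_in_B theta_theta_inv)
    have "transport D (theta (b \<oplus>\<^bsub>B\<^esub> c)) = theta (D b \<oplus>\<^bsub>B\<^esub> D c)"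
      using D bc by (simp add: transport_theta derivation_def)
    then show "transport D (f + g) = transport D f + transport D g"
      using bc by (simp add: theta_hom transport_theta D_in)
    have "transport D (theta (b \<otimes>\<^bsub>B\<^esub> c)) = theta ((D b \<otimes>\<^bsub>B\<^esub> c) \<oplus>\<^bsub>B\<^esub> (b \<otimes>\<^bsub>B\<^esub> D c))"
      using D bc by (simp add: transport_theta derivation_def)
    then show "transport D (f * g) = transport D f * g + f * transport D g"
      using bc by (simp add: theta_hom transport_theta D_in)
  next
    fix t
    have one: "D \<one>\<^bsub>B\<^esub> \<in> carrier B" using D_in B.one_closed by blast
    have "D (\<one>\<^bsub>B\<^esub> \<otimes>\<^bsub>B\<^esub> \<one>\<^bsub>B\<^esub>) = (D \<one>\<^bsub>B\<^esub> \<otimes>\<^bsub>B\<^esub> \<one>\<^bsub>B\<^esub>) \<oplus>\<^bsub>B\<^esub> (\<one>\<^bsub>B\<^esub> \<otimes>\<^bsub>B\<^esub> D \<one>\<^bsub>B\<^esub>)"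
      using D B.one_closed unfolding derivation_def by blast
    then have "D \<one>\<^bsub>B\<^esub> = D \<one>\<^bsub>B\<^esub> \<oplus>\<^bsub>B\<^esub> D \<one>\<^bsub>B\<^esub>" using one by simp
    then have "D \<one>\<^bsub>B\<^esub> = \<zero>\<^bsub>B\<^esub>" using B.add.l_cancel_one'[OF one one] by simp
    moreover have "D (\<iota> t \<otimes>\<^bsub>B\<^esub> \<one>\<^bsub>B\<^esub>) = \<iota> t \<otimes>\<^bsub>B\<^esub> D \<one>\<^bsub>B\<^esub>"
      using D B.one_closed unfolding derivation_def by blast
    ultimately have "D (\<iota> t) = \<zero>\<^bsub>B\<^esub>" by (simp add: scalar_in_B)
    then show "transport D (Phi (const t)) = 0"
      using transport_theta[OF scalar_in_B, of D t] by simp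
  qed
qed

lemma iterate_transport:
  assumes D: "derivation B \<iota> D" and b: "b \<in> carrier B"
  shows "(D ^^ N) b \<in> carrier B \<and> theta ((D ^^ N) b) = (transport D ^^ N) (theta b)"
proof (induction N)
  case (Suc N)
  have "D c \<in> carrier B" if "c \<in> carrier B" for c
    using D that by (auto simp: derivation_def)
  then show ?case using Suc by (auto simp flip: transport_theta)
qed (simp add: b)

lemma theta_eq_0_iff: "b \<in> carrier B \<Longrightarrow> theta b = 0 \<longleftrightarrow> b = \<zero>\<^bsub>B\<^esub>"
  by (metis theta_zero theta_inject rc_zero rc_in_B occurring_vars_zero empty_subsetI)

lemma LND_iff:
  fixes D :: "'a::{idom, ring_char_0} mpoly set \<Rightarrow> 'a mpoly set"
  assumes D: "derivation B \<iota> D"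
  shows "LND B \<iota> D \<longleftrightarrow> subring_LND S (transport D)"
proof -
  have "subring_derivation S (transport D)" using kder_transport[OF D] by (simp add: kder_def)
  moreover have "(\<exists>N. (D ^^ N) b = \<zero>\<^bsub>B\<^esub>) \<longleftrightarrow> (\<exists>N. (transport D ^^ N) (theta b) = 0)"
    if "b \<in> carrier B" for b
    using iterate_transport[OF D that] theta_eq_0_iff by metis
  moreover have "(\<forall>b\<in>carrier B. P (theta b)) \<longleftrightarrow> (\<forall>f. f \<in> S \<longrightarrow> P f)" for P :: "'a mpoly fract \<Rightarrow> bool"
    by (metis theta_in_S theta_inv_in_B theta_theta_inv)
  ultimately show ?thesis
    unfolding LND_def subring_LND_def subring_LND_axioms_def using D by simp
qed

lemma derivation_eqI:
  fixes D E :: "'a::{idom, ring_char_0} mpoly set \<Rightarrow> 'a mpoly set"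
  assumes D: "derivation B \<iota> D" and E: "derivation B \<iota> E"
    and eq: "\<And>v. v \<in> V \<Longrightarrow> D (rc (var v)) = E (rc (var v))"
  shows "D = E"
proof
  fix b
  have fun_in: "D \<in> carrier B \<rightarrow>\<^sub>E carrier B" "E \<in> carrier B \<rightarrow>\<^sub>E carrier B"
    using D E by (auto simp: derivation_def)
  show "D b = E b"
  proof (cases "b \<in> carrier B")
    case True
    have "transport D (theta b) = transport E (theta b)"
      by (rule kder_eqI[OF kder_transport[OF D] kder_transport[OF E]])
        (use True eq in \<open>auto simp: transport_Phi theta_in_S\<close>)
    then show ?thesis
      using True by (intro theta_inject PiE_mem[OF fun_in(1)] PiE_mem[OF fun_in(2)])
        (simp_all add: transport_theta)
  next
    case False
    then show ?thesis using PiE_arb[OF fun_in(1)] PiE_arb[OF fun_in(2)] by simp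
  qed
qed

end

section \<open>The derivations \<open>\<partial>\<^sub>i\<^sub>j\<close>\<close>

text \<open>
  The derivation that sends each variable \<open>v\<close> to \<open>x v\<close>: evaluate at \<open>v + x v \<epsilon>\<close> and take the coefficient of \<open>\<epsilon>\<close>.
  The Leibniz rule is then the multiplication rule for the coefficients of \<open>1\<close> and \<open>\<epsilon>\<close>.
\<close>

definition poly_derivation :: "(variable \<Rightarrow> 'a::comm_ring_1 mpoly) \<Rightarrow> 'a mpoly \<Rightarrow> 'a mpoly" where
  "poly_derivation x p = coeff (univ.eval (\<lambda>v. [:var v, x v:]) p) 1"

lemma poly_derivation_base: "coeff (univ.eval (\<lambda>v. [:var v, x v:]) p) 0 = p"
proof -
  have "occurring_vars p \<subseteq> UNIV" by simp
  then show ?thesis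
    by (induction rule: mpoly_induct) (auto simp: univ.eval_simps coeff_mult)
qed

lemma poly_derivation_add: "poly_derivation x (p + q) = poly_derivation x p + poly_derivation x q"
  by (simp add: poly_derivation_def univ.eval_simps)

lemma poly_derivation_mult:
  "poly_derivation x (p * q) = poly_derivation x p * q + p * poly_derivation x q"
  by (simp add: poly_derivation_def univ.eval_simps coeff_mult poly_derivation_base)

lemma poly_derivation_const [simp]: "poly_derivation x (const t) = 0"
  by (simp add: poly_derivation_def univ.eval_simps)

lemma poly_derivation_var [simp]: "poly_derivation x (var v) = x v"
  by (simp add: poly_derivation_def)

lemma poly_derivation_of_nat [simp]: "poly_derivation x (of_nat N) = 0"
  using poly_derivation_const[of x "of_nat N"] by (simp add: const_of_nat)

lemma poly_derivation_diff: "poly_derivation x (p - q) = poly_derivation x p - poly_derivation x q"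
  by (simp add: poly_derivation_def univ.eval_simps)

lemma poly_derivation_power:
  "poly_derivation x (p ^ N) = of_nat N * p ^ (N - 1) * poly_derivation x p"
proof (induction N)
  case 0
  show ?case using poly_derivation_of_nat[of x 1] by simp
next
  case (Suc N)
  then have "poly_derivation x (p ^ Suc N)
      = poly_derivation x p * p ^ N + p * (of_nat N * p ^ (N - 1) * poly_derivation x p)"
    by (simp add: poly_derivation_mult)
  then show ?case by (cases N) (simp_all add: algebra_simps)
qed

lemma poly_derivation_vanishes:
  fixes p :: "'a::comm_ring_1 mpoly"
  assumes "occurring_vars p \<subseteq> X" "\<And>v. v \<in> X \<Longrightarrow> x v = 0"
  shows "poly_derivation x p = 0"
  using assms(1)
  by (induction rule: mpoly_induct) (auto simp: poly_derivation_add poly_derivation_mult assms(2))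

lemma occurring_poly_derivation:
  fixes p :: "'a::comm_ring_1 mpoly"
  assumes "occurring_vars p \<subseteq> X" "\<And>v. v \<in> X \<Longrightarrow> occurring_vars (x v) \<subseteq> X"
  shows "occurring_vars (poly_derivation x p) \<subseteq> X"
proof -
  have "occurring_vars p \<subseteq> X \<and> occurring_vars (poly_derivation x p) \<subseteq> X"
    using assms(1)
    by (induction rule: mpoly_induct)
      (simp_all add: poly_derivation_add poly_derivation_mult assms(2) occurring_vars_closed)
  then show ?thesis ..
qed

text \<open>The commutator of two derivations is a derivation, so it vanishes as soon as it vanishes on the variables.\<close>

lemma poly_derivation_commute:
  fixes p :: "'a::comm_ring_1 mpoly"
  assumes "\<And>v. poly_derivation x (y v) = poly_derivation y (x v)"
  shows "poly_derivation x (poly_derivation y p) = poly_derivation y (poly_derivation x p)"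
proof -
  have zero: "poly_derivation w 0 = 0" for w :: "variable \<Rightarrow> 'a mpoly"
    using poly_derivation_of_nat[of w 0] by simp
  have "occurring_vars p \<subseteq> UNIV" by simp
  then show ?thesis
  proof (induction rule: mpoly_induct)
    case (mult p q)
    then show ?case by (simp add: poly_derivation_add poly_derivation_mult algebra_simps)
  qed (auto simp: assms poly_derivation_add zero)
qed

context hypersurface_at
begin

definition partial_val :: "variable \<Rightarrow> 'a::comm_ring_1 mpoly" where
  "partial_val v = (if v = XVar i then of_nat (l j) * var (ZVar j) ^ (l j - 1) * monomial eR
     else if v = ZVar j then monomial eQ else 0)"

abbreviation partial_poly :: "'a::comm_ring_1 mpoly \<Rightarrow> 'a mpoly" where
  "partial_poly \<equiv> poly_derivation partial_val"

abbreviation partial :: "'a::comm_ring_1 mpoly set \<Rightarrow> 'a mpoly set" where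
  "partial \<equiv> partial_ij k m n a l i j"

lemma partial_val_simps [simp]:
  "partial_val (XVar i) = of_nat (l j) * var (ZVar j) ^ (l j - 1) * monomial eR"
  "partial_val (ZVar j) = monomial eQ"
  "v \<in> W \<Longrightarrow> partial_val v = 0"
  by (auto simp: partial_val_def W_def)

lemma occurring_partial_val: "occurring_vars (partial_val v :: 'a::comm_ring_1 mpoly) \<subseteq> V"
proof -
  have "keys eQ \<subseteq> V" "keys eR \<subseteq> V"
    using keys_eQ_W keys_eR_W by (auto simp: W_def)
  then have "occurring_vars (of_nat (l j) * var (ZVar j) ^ (l j - 1) * monomial eR :: 'a mpoly) \<subseteq> V"
    using j_in by (intro occurring_vars_closed occurring_vars_power; simp flip: const_of_nat)
  moreover have "occurring_vars (monomial eQ :: 'a mpoly) \<subseteq> V"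
    using \<open>keys eQ \<subseteq> V\<close> by simp
  ultimately show ?thesis by (simp add: partial_val_def)
qed

lemma occurring_partial_poly:
  "occurring_vars p \<subseteq> V \<Longrightarrow> occurring_vars (partial_poly (p :: 'a::comm_ring_1 mpoly)) \<subseteq> V"
  by (rule occurring_poly_derivation) (auto simp: occurring_partial_val)

lemma partial_poly_W:
  "occurring_vars p \<subseteq> W \<Longrightarrow> partial_poly (p :: 'a::comm_ring_1 mpoly) = 0"
  by (rule poly_derivation_vanishes[of p W]) simp_all

lemma partial_poly_Q [simp]: "partial_poly (monomial eQ :: 'a::comm_ring_1 mpoly) = 0"
  by (rule partial_poly_W) (simp add: keys_eQ_W)

lemma partial_poly_R [simp]: "partial_poly (monomial eR :: 'a::comm_ring_1 mpoly) = 0"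
  by (rule partial_poly_W) (simp add: keys_eR_W)

lemma partial_poly_F: "partial_poly (F :: 'a::comm_ring_1 mpoly) = 0"
proof -
  have "partial_poly (1 :: 'a mpoly) = 0" using poly_derivation_const[of partial_val 1] by simp
  then show ?thesis
    by (simp add: trinomial_eq monomial_eU monomial_eT poly_derivation_diff poly_derivation_add
        poly_derivation_mult poly_derivation_power algebra_simps)
qed

lemma Phi_partial_poly_cong:
  assumes "Phi p = Phi q"
  shows "Phi (partial_poly p) = Phi (partial_poly q)"
proof -
  obtain g where "p - q = F * g" using assms by (auto simp: Phi_eq_iff elim: dvdE)
  then have "p = q + F * g" by (simp add: algebra_simps)
  then show ?thesis
    by (simp add: poly_derivation_add poly_derivation_mult partial_poly_F Phi_simps)
qed

text \<open>As \<open>partial_poly\<close> kills \<open>F\<close>, it maps multiples of \<open>F\<close> to multiples of \<open>F\<close> and descends to the quotient ring.\<close>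

definition partial_model :: "'a::idom mpoly set \<Rightarrow> 'a mpoly set" where
  "partial_model = (\<lambda>b\<in>carrier B. rc (partial_poly (SOME p. occurring_vars p \<subseteq> V \<and> rc p = b)))"

lemma partial_model_rc:
  fixes p :: "'a::idom mpoly"
  assumes p: "occurring_vars p \<subseteq> V"
  shows "partial_model (rc p) = rc (partial_poly p)"
proof -
  let ?q = "SOME q. occurring_vars q \<subseteq> V \<and> rc q = rc p"
  have q: "occurring_vars ?q \<subseteq> V \<and> rc ?q = rc p"
    by (rule someI[of _ p]) (use p in simp)
  then have "Phi ?q = Phi p" using rc_eq_iff p by blast
  then have "Phi (partial_poly ?q) = Phi (partial_poly p)" by (rule Phi_partial_poly_cong)
  then have "rc (partial_poly ?q) = rc (partial_poly p)"
    using rc_eq_iff occurring_partial_poly p q by blast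
  then show ?thesis using p by (auto simp: partial_model_def)
qed

lemma derivation_partial_model: "derivation B \<iota> (partial_model :: 'a::idom mpoly set \<Rightarrow> 'a mpoly set)"
  unfolding derivation_def
proof (intro conjI ballI allI)
  show "partial_model \<in> carrier B \<rightarrow>\<^sub>E (carrier B :: 'a mpoly set set)"
  proof (rule PiE_I)
    fix b :: "'a mpoly set" assume "b \<in> carrier B"
    then obtain p where "b = rc p" "occurring_vars p \<subseteq> V" by (rule B_cases)
    then show "partial_model b \<in> carrier B"
      by (simp add: partial_model_rc occurring_partial_poly rc_in_B)
  qed (simp add: partial_model_def)
  fix b c :: "'a mpoly set" assume "b \<in> carrier B" "c \<in> carrier B"
  then obtain p q where b: "b = rc p" "occurring_vars p \<subseteq> V" and c: "c = rc q" "occurring_vars q \<subseteq> V"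
    by (auto elim!: B_cases)
  show "partial_model (b \<oplus>\<^bsub>B\<^esub> c) = partial_model b \<oplus>\<^bsub>B\<^esub> partial_model c"
    using b c by (simp add: partial_model_rc poly_derivation_add occurring_vars_closed
        occurring_partial_poly flip: rc_hom)
  show "partial_model (b \<otimes>\<^bsub>B\<^esub> c) = (partial_model b \<otimes>\<^bsub>B\<^esub> c) \<oplus>\<^bsub>B\<^esub> (b \<otimes>\<^bsub>B\<^esub> partial_model c)"
    using b c by (simp add: partial_model_rc poly_derivation_mult occurring_vars_closed
        occurring_partial_poly flip: rc_hom)
next
  fix t and b :: "'a mpoly set" assume "b \<in> carrier B"
  then obtain p where b: "b = rc p" "occurring_vars p \<subseteq> V" by (auto elim!: B_cases)
  show "partial_model (\<iota> t \<otimes>\<^bsub>B\<^esub> b) = \<iota> t \<otimes>\<^bsub>B\<^esub> partial_model b"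
    using b by (simp add: scalar_def partial_model_rc poly_derivation_mult occurring_vars_closed
        occurring_partial_poly flip: rc_hom)
qed

lemma prod_without_i:
  "(\<Prod>s\<in>{1..m}. var (YVar s) ^ a s) * (\<Prod>s\<in>{1..k} - {i}. var (XVar s)) = (monomial eQ :: 'a::comm_ring_1 mpoly)"
proof -
  have "eQ = (\<Sum>s\<in>{1..m}. single (YVar s) (a s)) + (\<Sum>r\<in>{1..k} - {i}. single (XVar r) 1)"
    using i_in unfolding eQ_def eU_def by (subst sum.remove[of _ i]) (auto simp: algebra_simps)
  then show ?thesis by (simp add: monomial_add monomial_sum monomial_single)
qed

lemma prod_without_j:
  "(\<Prod>s\<in>{1..n} - {j}. var (ZVar s) ^ l s) = (monomial eR :: 'a::comm_ring_1 mpoly)"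
proof -
  have "eR = (\<Sum>s\<in>{1..n} - {j}. single (ZVar s) (l s))"
    using j_in unfolding eR_def eT_def by (subst sum.remove[of _ j]) auto
  then show ?thesis by (simp add: monomial_sum monomial_single)
qed

lemma partial_values_iff:
  fixes D :: "'a::{idom, ring_char_0} mpoly set \<Rightarrow> 'a mpoly set"
  shows "partial_values k m n a l i j D \<longleftrightarrow> (\<forall>v\<in>V. D (rc (var v)) = rc (partial_val v))"
proof -
  have W_parts: "W = XVar ` ({1..k} - {i}) \<union> YVar ` {1..m} \<union> ZVar ` ({1..n} - {j})"
    by (auto simp: W_def variables_def)
  have "(\<forall>v\<in>W. D (rc (var v)) = \<zero>\<^bsub>B\<^esub>) \<longleftrightarrow>
      (\<forall>r\<in>{1..k} - {i}. D (rc (var (XVar r))) = \<zero>\<^bsub>B\<^esub>) \<and>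
      (\<forall>s\<in>{1..m}. D (rc (var (YVar s))) = \<zero>\<^bsub>B\<^esub>) \<and>
      (\<forall>p\<in>{1..n} - {j}. D (rc (var (ZVar p))) = \<zero>\<^bsub>B\<^esub>)"
    unfolding W_parts ball_Un ball_simps by (simp only: conj_assoc)
  then show ?thesis
    unfolding partial_values_def V_eq prod_without_i prod_without_j const_of_nat by (simp add: rc_zero)
qed

lemma partial_eq_model: "(partial :: 'a::{idom, ring_char_0} mpoly set \<Rightarrow> 'a mpoly set) = partial_model"
  unfolding partial_ij_def
proof (rule the_equality)
  show "derivation B \<iota> partial_model \<and> partial_values k m n a l i j (partial_model :: 'a mpoly set \<Rightarrow> _)"
    by (simp add: derivation_partial_model partial_values_iff partial_model_rc)
  fix D :: "'a mpoly set \<Rightarrow> 'a mpoly set"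
  assume "derivation B \<iota> D \<and> partial_values k m n a l i j D"
  then show "D = partial_model"
    by (intro derivation_eqI derivation_partial_model) (auto simp: partial_values_iff partial_model_rc)
qed

lemma derivation_partial:
  "derivation B \<iota> (partial :: 'a::{idom, ring_char_0} mpoly set \<Rightarrow> 'a mpoly set)"
  by (simp add: partial_eq_model derivation_partial_model)

lemma partial_rc:
  "occurring_vars p \<subseteq> V \<Longrightarrow> partial (rc p) = rc (partial_poly (p :: 'a::{idom, ring_char_0} mpoly))"
  by (simp add: partial_eq_model partial_model_rc)

abbreviation \<Delta> :: "'a::{idom, ring_char_0} mpoly fract \<Rightarrow> 'a mpoly fract" where
  "\<Delta> \<equiv> transport partial"

abbreviation Z :: "'a::idom mpoly fract" where "Z \<equiv> Phi (var (ZVar j))"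

lemma kder_\<Delta>: "kder (\<Delta> :: 'a::{idom, ring_char_0} mpoly fract \<Rightarrow> _)"
  by (rule kder_transport) (rule derivation_partial)

lemma \<Delta>_Phi: "occurring_vars p \<subseteq> V \<Longrightarrow> \<Delta> (Phi p) = Phi (partial_poly p)"
  by (simp add: transport_Phi partial_rc occurring_partial_poly)

lemma W_subset: "W \<subseteq> V" by (auto simp: W_def)

lemma \<Delta>_W: "occurring_vars p \<subseteq> W \<Longrightarrow> \<Delta> (Phi p) = 0"
  using W_subset by (subst \<Delta>_Phi) (auto simp: partial_poly_W)

lemma \<Delta>_var_W: "v \<in> W \<Longrightarrow> \<Delta> (Phi (var v)) = 0"
  by (rule \<Delta>_W) simp

lemma \<Delta>_Z: "\<Delta> Z = Phi (monomial eQ)"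
  using j_in by (simp add: \<Delta>_Phi)

lemma \<Delta>_Q: "\<Delta> (Phi (monomial eQ)) = 0"
  by (rule \<Delta>_W) (simp add: keys_eQ_W)

text \<open>
  The nilpotent elements form a subring, and the generators are nilpotent: \<open>z\<^sub>j\<close> is mapped to \<open>Q\<close>, which is killed, and
  \<open>x\<^sub>i\<close> to an element of the kernel times a power of \<open>z\<^sub>j\<close>.
\<close>

lemma LND_\<Delta>: "subring_LND S (\<Delta> :: 'a::{idom, ring_char_0} mpoly fract \<Rightarrow> _)"
proof -
  interpret d: subring_derivation S "\<Delta> :: 'a mpoly fract \<Rightarrow> _" using kder_\<Delta>[where 'a = 'a] by (simp add: kder_def)
  have "d.nilpotent (\<Delta> Z)" unfolding \<Delta>_Z by (rule d.nilpotent_kernel) (rule \<Delta>_Q)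
  then have Z: "Z \<in> S" "d.nilpotent Z" using j_in by (auto dest: d.nilpotent_D)
  have "occurring_vars (of_nat (l j) * monomial eR :: 'a mpoly) \<subseteq> W"
    using keys_eR_W by (intro occurring_vars_closed) (simp_all flip: const_of_nat)
  then have "Phi (of_nat (l j) * monomial eR :: 'a mpoly) \<in> S" "d.nilpotent (Phi (of_nat (l j) * monomial eR))"
    using W_subset by (auto intro: d.nilpotent_kernel \<Delta>_W)
  then have "d.nilpotent (Phi (of_nat (l j) * monomial eR) * Z ^ (l j - 1))"
    using Z by (intro d.nilpotent_mult d.nilpotent_power d.power_in)
  moreover have "\<Delta> (Phi (var (XVar i))) = Phi (of_nat (l j) * monomial eR :: 'a mpoly) * Z ^ (l j - 1)"
    using i_in by (simp add: \<Delta>_Phi) (simp add: Phi_simps)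
  ultimately have X: "d.nilpotent (Phi (var (XVar i)))" by (metis d.nilpotent_D)
  have var: "d.nilpotent (Phi (var v))" if "v \<in> V" for v
    using that X Z unfolding V_eq by (auto intro: d.nilpotent_kernel \<Delta>_var_W)
  have "d.nilpotent f" if f: "f \<in> S" for f
  proof -
    obtain p where p: "f = Phi p" "occurring_vars p \<subseteq> V" using f by (rule in_S_cases)
    have "Phi p \<in> S \<and> d.nilpotent (Phi p)"
      using p(2)
    proof (induction rule: mpoly_induct)
      case (const t)
      then show ?case using \<Delta>_W[of "const t"] by (auto intro: d.nilpotent_kernel)
    qed (auto simp: var Phi_simps d.add_in d.mult_in d.nilpotent_add d.nilpotent_mult)
    then show ?thesis using p by simp
  qed
  then show ?thesis by unfold_locales (auto simp: d.nilpotent_def)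
qed

lemma poly_map_Phi: "poly (map_poly Phi c) (Phi z) = Phi (poly c z)"
  by (induction c) (simp_all add: map_poly_pCons Phi_simps)

text \<open>
  Clearing denominators makes \<open>Q\<^sup>N b\<close> a polynomial in \<open>z\<^sub>j\<close> over the kernel. The degree function of \<open>\<Delta>\<close> bounds its degree
  by one, and \<open>cancel_var\<close> then removes the factor \<open>Q\<^sup>N\<close> again.
\<close>

lemma linear_elements:
  fixes b :: "'a::{idom, ring_char_0} mpoly fract"
  assumes b: "b \<in> S" and b2: "\<Delta> (\<Delta> b) = 0"
  obtains \<alpha> \<beta> where "occurring_vars \<alpha> \<subseteq> W" "occurring_vars \<beta> \<subseteq> W" "b = Phi \<alpha> + Phi \<beta> * Z"
proof -
  interpret d: subring_LND S "\<Delta> :: 'a mpoly fract \<Rightarrow> _" by (rule LND_\<Delta>)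
  obtain p where p: "b = Phi p" "occurring_vars p \<subseteq> V" using b by (rule in_S_cases)
  obtain N c g where N: "monomial eQ ^ N * p = poly c (var (ZVar j)) + F * g"
    and c: "\<And>r. occurring_vars (coeff c r) \<subseteq> W"
    using clear_denominator[of p "{}"] p by auto
  let ?c = "map_poly Phi c" and ?Q = "Phi (monomial eQ) :: 'a mpoly fract"
  have Q: "?Q ^ N * b = poly ?c Z"
    using arg_cong[OF N, of Phi] by (simp add: Phi_simps p poly_map_Phi)
  have QS: "?Q \<in> S" using keys_eQ_W W_subset by blast
  have ZS: "Z \<in> S" "\<Delta> Z \<noteq> 0" using j_in by (auto simp: \<Delta>_Z)
  have cS: "coeff ?c r \<in> S" "\<Delta> (coeff ?c r) = 0" for r
    using c[of r] W_subset by (auto simp: coeff_map_poly intro: \<Delta>_W)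
  have "\<Delta> (?Q ^ N) = 0" using QS \<Delta>_Q by (rule d.D_power_zero)
  then have "\<Delta> (\<Delta> (?Q ^ N * b)) = ?Q ^ N * \<Delta> (\<Delta> b)"
    using b QS d.iterate_const_mult[of "?Q ^ N" b 2] by (simp add: numeral_2_eq_2 d.power_in)
  then have iter: "(\<Delta> ^^ 2) (poly ?c Z) = 0" using b2 Q by (simp add: numeral_2_eq_2)
  have deg: "degree ?c \<le> 1"
  proof (rule ccontr)
    assume d: "\<not> degree ?c \<le> 1"
    then have "?c \<noteq> 0" by auto
    then have *: "poly ?c Z \<noteq> 0 \<and> d.ndeg (poly ?c Z) = degree ?c * d.ndeg Z"
      by (intro d.ndeg_poly cS ZS)
    have "d.ndeg Z > 0" using ZS d.ndeg_eq_0_iff by blast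
    then have "degree ?c * d.ndeg Z \<ge> degree ?c * 1" by (intro mult_le_mono2) simp
    moreover have "d.ndeg (poly ?c Z) < 2"
      using * iter d.iterate_vanish_iff[of "poly ?c Z" 2] d.poly_in[OF cS(1) ZS(1)] by blast
    ultimately show False using d * by linarith
  qed
  then have c_eq: "?c = [:coeff ?c 0, coeff ?c 1:]"
    by (intro poly_eqI) (auto simp: coeff_pCons coeff_eq_0 split: nat.splits)
  have "?Q ^ N * b = Phi (coeff c 0) + Phi (coeff c 1) * Z"
    unfolding Q by (subst c_eq) (simp add: coeff_map_poly mult.commute)
  then have "Phi (monomial eQ ^ N * p) = Phi (coeff c 0 + coeff c 1 * var (ZVar j))"
    by (simp add: p Phi_simps)
  then obtain g' where "monomial eQ ^ N * p - (coeff c 0 + coeff c 1 * var (ZVar j)) = F * g'"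
    by (auto simp: Phi_eq_iff elim: dvdE)
  then have "monomial eQ ^ N * p = coeff c 0 + coeff c 1 * var (ZVar j) + F * g'"
    by (simp add: algebra_simps)
  then have "\<exists>\<alpha> \<beta> g. monomial eQ ^ N * p = \<alpha> + \<beta> * var (ZVar j) + F * g
      \<and> occurring_vars \<alpha> \<subseteq> W \<and> occurring_vars \<beta> \<subseteq> W"
    using c by blast
  then have "\<exists>\<alpha> \<beta> g. p = \<alpha> + \<beta> * var (ZVar j) + F * g \<and> occurring_vars \<alpha> \<subseteq> W \<and> occurring_vars \<beta> \<subseteq> W"
    by (rule cancel_Q[rotated]) (metis cancel_var)
  then show ?thesis using that by (auto simp: p Phi_simps)
qed

text \<open>
  Both sides are derivations of \<open>S\<close>, and they agree on the generators. For \<open>x\<^sub>i\<close> this follows by applying \<open>E\<close> to the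
  relation \<open>Q x\<^sub>i = R z\<^sub>j ^ l\<^sub>j + 1\<close>.
\<close>

lemma proportional_to_\<Delta>:
  fixes E :: "'a::{idom, ring_char_0} mpoly fract \<Rightarrow> 'a mpoly fract"
  assumes E: "kder E" and W0: "\<And>v. v \<in> W \<Longrightarrow> E (Phi (var v)) = 0" and f: "f \<in> S"
  shows "Phi (monomial eQ) * E f = E Z * \<Delta> f"
proof -
  interpret e: subring_derivation S E using E by (simp add: kder_def)
  have WS: "E (Phi (monomial e)) = 0 \<and> Phi (monomial e :: 'a mpoly) \<in> S" if "keys e \<subseteq> W" for e
  proof -
    have v: "Phi (var v :: 'a mpoly) \<in> S" "E (Phi (var v)) = 0" if "v \<in> keys e" for v
      using that \<open>keys e \<subseteq> W\<close> W_subset by (blast intro: W0 Phi_var_in_S)+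
    show ?thesis
      unfolding Phi_monomial
    proof
      show "E (\<Prod>v\<in>keys e. Phi (var v) ^ lookup e v) = 0"
        by (rule e.D_prod_zero) (simp_all add: v e.power_in e.D_power_zero)
      show "(\<Prod>v\<in>keys e. Phi (var v :: 'a mpoly) ^ lookup e v) \<in> S"
        by (rule e.prod_in) (simp add: v e.power_in)
    qed
  qed
  have X: "Phi (monomial eQ) * E (Phi (var (XVar i))) = E Z * \<Delta> (Phi (var (XVar i)))"
  proof -
    have "E (Phi (monomial eQ) * Phi (var (XVar i))) = E (Phi (monomial eR) * Z ^ l j + 1)"
      unfolding Phi_x by (simp add: monomial_eT Phi_simps)
    moreover have "E (Phi (monomial eQ) * Phi (var (XVar i))) = Phi (monomial eQ) * E (Phi (var (XVar i)))"
      using WS[OF keys_eQ_W] i_in by (intro e.D_const_mult) auto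
    moreover have "E (Phi (monomial eR) * Z ^ l j + 1) = Phi (monomial eR) * (of_nat (l j) * Z ^ (l j - 1) * E Z)"
      using WS[OF keys_eR_W] j_in
      by (simp add: e.D_add e.mult_in e.power_in e.one_in e.D_one e.D_const_mult e.D_power Phi_var_in_S)
    ultimately show ?thesis using i_in by (simp add: \<Delta>_Phi) (simp add: Phi_simps Phi_of_nat)
  qed
  show ?thesis
  proof (rule kder_eqI[OF kder_scale[OF E] kder_scale[OF kder_\<Delta>] _ f])
    show "Phi (monomial eQ :: 'a mpoly) \<in> S" using WS[OF keys_eQ_W] by simp
    show "E Z \<in> S" using j_in by (intro e.D_in Phi_var_in_S) simp
    fix v assume "v \<in> V"
    then show "Phi (monomial eQ) * E (Phi (var v)) = E Z * \<Delta> (Phi (var v))"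
      unfolding V_eq using X by (auto simp: \<Delta>_Z W0 \<Delta>_var_W)
  qed
qed

text \<open>
  Put \<open>P = h Q\<close>, the image of \<open>z\<^sub>j\<close> under \<open>h \<Delta>\<close>. Commutation shows that \<open>E P\<close> is the image of \<open>E Z\<close> under \<open>h \<Delta>\<close>
  and is killed by \<open>\<Delta>\<close>. So \<open>E Z\<close> is linear in \<open>z\<^sub>j\<close>, \<open>E P\<close> is a multiple of \<open>P\<close>, and therefore \<open>E P = 0\<close>. Since \<open>P\<close> is
  divisible by all variables in \<open>W\<close>, \<open>E\<close> kills them and is proportional to \<open>\<Delta>\<close>.
\<close>

lemma commuting_same_kernel:
  fixes E :: "'a::{field, ring_char_0} mpoly fract \<Rightarrow> 'a mpoly fract" and c :: 'a
  assumes E: "kder E" "subring_LND S E" and nz: "\<exists>f\<in>S. E f \<noteq> 0"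
    and h: "h = Phi (const c * monomial e)" "c \<noteq> 0" "keys e \<subseteq> W"
      "\<And>s. s \<in> {1..n} - {j} \<Longrightarrow> ZVar s \<in> keys e"
    and comm: "\<And>f. f \<in> S \<Longrightarrow> h * \<Delta> (E f) = E (h * \<Delta> f)"
    and f: "f \<in> S"
  shows "E f = 0 \<longleftrightarrow> \<Delta> f = 0"
proof -
  interpret e: subring_LND S E by fact
  interpret d: subring_LND S "\<Delta> :: 'a mpoly fract \<Rightarrow> _" by (rule LND_\<Delta>)
  let ?Q = "Phi (monomial eQ) :: 'a mpoly fract" and ?b = "E Z"
  have occ: "occurring_vars (const c * monomial e) \<subseteq> W"
    using h(3) by (intro occurring_vars_closed) simp_all
  have hS: "h \<in> S" "\<Delta> h = 0" "h \<noteq> 0"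
    unfolding h(1) using occ W_subset h(2) by (auto simp: \<Delta>_W) (simp add: Phi_simps)
  have QS: "?Q \<in> S" using keys_eQ_W W_subset by blast
  have ZS: "Z \<in> S" using j_in by auto
  have bS: "?b \<in> S" using ZS by (rule e.D_in)
  define P where "P = h * ?Q"
  have PS: "P \<in> S" using hS QS by (simp add: P_def d.mult_in)
  have EP: "E P = h * \<Delta> ?b" using comm[OF ZS] by (simp add: \<Delta>_Z P_def)
  have "h * \<Delta> (E P) = E (h * \<Delta> P)" using PS by (rule comm)
  also have "\<Delta> P = 0" using hS QS by (simp add: P_def d.D_const_mult \<Delta>_Q)
  finally have "\<Delta> (E P) = 0" using hS by (simp add: e.D_zero)
  then have "\<Delta> (\<Delta> ?b) = 0" using hS bS unfolding EP by (simp add: d.D_const_mult d.D_in)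
  then obtain \<alpha> \<beta> where ab: "occurring_vars \<alpha> \<subseteq> W" "occurring_vars \<beta> \<subseteq> W" "?b = Phi \<alpha> + Phi \<beta> * Z"
    using linear_elements[OF bS] by blast
  have abS: "Phi \<alpha> \<in> S" "Phi \<beta> \<in> S" using ab W_subset by auto
  have "\<Delta> ?b = \<Delta> (Phi \<alpha>) + \<Delta> (Phi \<beta> * Z)"
    unfolding ab(3) using abS ZS by (intro d.D_add d.mult_in)
  also have "\<dots> = Phi \<beta> * ?Q"
    using ab(1,2) abS(2) ZS by (subst d.D_const_mult) (simp_all add: \<Delta>_W \<Delta>_Z)
  finally have "\<Delta> ?b = Phi \<beta> * ?Q" .
  then have "E P = Phi \<beta> * P" using EP by (simp add: P_def)
  then have EP0: "E P = 0" using PS abS by (intro e.D_multiple_imp_zero)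
  have ec: "P = Phi (const c) * Phi (monomial (e + eQ))"
    by (simp add: P_def h Phi_simps monomial_add)
  have eQ_keys: "keys (e + eQ) \<subseteq> V"
    using keys_add[of e eQ] h(3) keys_eQ_W W_subset by blast
  have "E P = Phi (const c) * E (Phi (monomial (e + eQ)))"
    unfolding ec using E(1) eQ_keys by (intro e.D_const_mult) (auto simp: kder_def)
  then have E0: "E (Phi (monomial (e + eQ))) = 0" using EP0 h(2) by simp
  have W0: "E (Phi (var v)) = 0" if "v \<in> W" for v
  proof -
    have "v \<in> keys e \<or> v \<in> keys eQ"
      using that h(4) unfolding keys_eQ by (cases v) (auto simp: W_def)
    then have "v \<in> keys (e + eQ)" by (auto simp: in_keys_iff lookup_add)
    then show ?thesis
      using E0 eQ_keys unfolding Phi_monomial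
      by (intro e.D_prod_power_zero[of "keys (e + eQ)" "\<lambda>v. Phi (var v)"
            "lookup (e + eQ)" v])
        (auto simp: in_keys_iff Phi_var_in_S subset_iff)
  qed
  have propl: "?Q * E g = E Z * \<Delta> g" if "g \<in> S" for g
    by (rule proportional_to_\<Delta>[OF E(1) W0 that])
  then have "E Z \<noteq> 0" using nz by auto
  then show ?thesis using propl[OF f] by (metis Phi_Q_nonzero mult_eq_0_iff)
qed

end

section \<open>The grading\<close>

context hypersurface
begin

text \<open>
  Equality of degrees in the grading group, in coordinates: the exponent vectors differ by an integer combination of
  \<open>eU\<close> and \<open>eT\<close>.
\<close>

definition sim :: "(variable \<Rightarrow>\<^sub>0 nat) \<Rightarrow> (variable \<Rightarrow>\<^sub>0 nat) \<Rightarrow> bool" where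
  "sim e f \<longleftrightarrow> (\<exists>\<alpha> \<beta>. \<forall>v. int (lookup e v)
     = int (lookup f v) + \<alpha> * int (lookup eU v) + \<beta> * int (lookup eT v))"

lemma sim_refl: "sim e e"
  unfolding sim_def by (rule exI[of _ 0], rule exI[of _ 0]) simp

lemma sim_sym: "sim e f \<Longrightarrow> sim f e"
proof -
  assume "sim e f"
  then obtain \<alpha> \<beta> where "\<And>v. int (lookup e v)
     = int (lookup f v) + \<alpha> * int (lookup eU v) + \<beta> * int (lookup eT v)"
    unfolding sim_def by blast
  then show "sim f e"
    unfolding sim_def by (intro exI[of _ "- \<alpha>"] exI[of _ "- \<beta>"]) simp
qed

lemma sim_trans: "sim e f \<Longrightarrow> sim f g \<Longrightarrow> sim e g"
proof -
  assume "sim e f" "sim f g"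
  then obtain \<alpha> \<beta> \<alpha>' \<beta>' where "\<And>v. int (lookup e v)
     = int (lookup f v) + \<alpha> * int (lookup eU v) + \<beta> * int (lookup eT v)"
    "\<And>v. int (lookup f v)
     = int (lookup g v) + \<alpha>' * int (lookup eU v) + \<beta>' * int (lookup eT v)"
    unfolding sim_def by blast
  then show "sim e g"
    unfolding sim_def by (intro exI[of _ "\<alpha> + \<alpha>'"] exI[of _ "\<beta> + \<beta>'"]) (simp add: algebra_simps)
qed

lemma sim_add_relation:
  assumes "sim d 0"
  shows "sim (d + e) f \<longleftrightarrow> sim e f"
proof -
  obtain \<alpha> \<beta> where "\<And>v. int (lookup d v)
     = \<alpha> * int (lookup eU v) + \<beta> * int (lookup eT v)"
    using assms unfolding sim_def by auto
  then have "sim (d + e) e"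
    unfolding sim_def by (intro exI[of _ \<alpha>] exI[of _ \<beta>]) (simp add: lookup_add)
  then show ?thesis using sim_sym sim_trans by blast
qed

lemma sim_U: "sim eU 0"
  unfolding sim_def by (rule exI[of _ 1], rule exI[of _ 0]) simp

lemma sim_T: "sim eT 0"
  unfolding sim_def by (rule exI[of _ 0], rule exI[of _ 1]) simp

lemma lookup_map_int: "lookup (Poly_Mapping.map int e) v = int (lookup e v)"
  by (simp add: Poly_Mapping.map.rep_eq when_def)

lemma keys_map_int: "keys (Poly_Mapping.map int e) = keys e"
  by (auto simp: in_keys_iff lookup_map_int)

lemma relation_subgroup_span:
  assumes "x \<in> relation_subgroup k m n a l"
  shows "keys x \<subseteq> V \<and> (\<exists>\<alpha> \<beta>. \<forall>v. lookup x v
     = \<alpha> * int (lookup eU v) + \<beta> * int (lookup eT v))"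
proof -
  let ?U = "Poly_Mapping.map int eU" and ?T = "Poly_Mapping.map int eT"
  have "(\<Sum>r\<in>{1..k}. single (XVar r) 1) + (\<Sum>s\<in>{1..m}. single (YVar s) (int (a s))) = ?U"
    by (rule poly_mapping_eqI) (simp add: lookup_map_int eU_def lookup_add lookup_sum lookup_single when_def
        of_nat_sum, intro arg_cong2[of _ _ _ _ "(+)"] sum.cong; simp)
  moreover have "(\<Sum>s\<in>{1..n}. single (ZVar s) (int (l s))) = ?T"
    by (rule poly_mapping_eqI) (simp add: lookup_map_int eT_def lookup_sum lookup_single when_def
        of_nat_sum, intro sum.cong; simp)
  ultimately have rel: "grading_relations k m n a l = {?U, ?T}"
    by (simp add: grading_relations_def)
  have keys: "keys ?U \<subseteq> V" "keys ?T \<subseteq> V"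
    by (auto simp: keys_map_int eU_keys eT_keys)
  have "x \<in> generate (free_Abelian_group V) {?U, ?T}"
    using assms by (simp add: relation_subgroup_def rel)
  then show ?thesis
  proof induction
    case one
    show ?case by (auto intro!: exI[of _ 0])
  next
    case (incl h)
    then show ?case
      using keys by (auto simp: lookup_map_int intro: exI[of _ 1] exI[of _ 0])
  next
    case (inv h)
    then have "inv\<^bsub>free_Abelian_group V\<^esub> h = - h" using keys by auto
    then show ?case
      using inv keys by (auto simp: lookup_map_int)
        (force intro: exI[of _ "- 1"] exI[of _ 0])+
  next
    case (eng g h)
    then obtain \<alpha> \<beta> \<alpha>' \<beta>' where *: "\<And>v. lookup g v
        = \<alpha> * int (lookup eU v) + \<beta> * int (lookup eT v)"
      "\<And>v. lookup h v
        = \<alpha>' * int (lookup eU v) + \<beta>' * int (lookup eT v)" by blast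
    have "\<forall>v. lookup (g + h) v
        = (\<alpha> + \<alpha>') * int (lookup eU v) + (\<beta> + \<beta>') * int (lookup eT v)"
      by (simp add: lookup_add * algebra_simps)
    moreover have "keys (g + h) \<subseteq> V" using eng keys_add[of g h] by blast
    ultimately show ?case by auto
  qed
qed

lemma same_degree_imp_sim:
  assumes "monomial_degree k m n a l e = monomial_degree k m n a l f"
  shows "sim e f"
proof -
  have "Poly_Mapping.map int e \<in> monomial_degree k m n a l e"
    unfolding monomial_degree_def relation_subgroup_def r_coset_def
    using generate.one[of "free_Abelian_group V" "grading_relations k m n a l"]
    by (auto intro!: bexI[of _ 0])
  then have "Poly_Mapping.map int e \<in> monomial_degree k m n a l f" using assms by simp
  then obtain h where "h \<in> relation_subgroup k m n a l" "Poly_Mapping.map int e = h + Poly_Mapping.map int f"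
    unfolding monomial_degree_def r_coset_def by auto
  then obtain \<alpha> \<beta> where "\<And>v. lookup (Poly_Mapping.map int e) v
     = \<alpha> * int (lookup eU v) + \<beta> * int (lookup eT v)
       + lookup (Poly_Mapping.map int f) v"
    using relation_subgroup_span by (metis lookup_add)
  then show ?thesis
    unfolding sim_def lookup_map_int by (intro exI[of _ \<alpha>] exI[of _ \<beta>]) simp
qed

lemma monomial_degree_in_group:
  "keys e \<subseteq> V \<Longrightarrow> monomial_degree k m n a l e \<in> carrier (grading_group k m n a l)"
  by (auto simp: grading_group_def FactGroup_def RCOSETS_def monomial_degree_def keys_map_int)

definition homog :: "'a::comm_ring_1 mpoly \<Rightarrow> bool" where
  "homog p \<longleftrightarrow> occurring_vars p \<subseteq> V \<and> (\<forall>e\<in>keys p. \<forall>f\<in>keys p. sim e f)"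

lemma homogeneous_polys_homog: "p \<in> homogeneous_polys k m n a l w \<Longrightarrow> homog p"
  by (auto simp: homogeneous_polys_def homog_def mpoly_ring_def intro!: same_degree_imp_sim)

lemma homogeneous_const_monomial:
  fixes c :: "'a::comm_ring_1"
  assumes "keys e \<subseteq> V"
  shows "const c * monomial e \<in> homogeneous_polys k m n a l (monomial_degree k m n a l e)"
proof -
  have "occurring_vars (const c * monomial e) \<subseteq> V"
    by (rule occurring_vars_closed) (simp_all add: assms)
  moreover have "keys (const c * monomial e) \<subseteq> {e}"
    by (simp flip: single_const_mono)
  ultimately show ?thesis by (auto simp: homogeneous_polys_def mpoly_ring_def)
qed

text \<open>The homogeneous component of \<open>p\<close> that has the degree of the monomial \<open>e\<close>.\<close>

definition class_part :: "(variable \<Rightarrow>\<^sub>0 nat) \<Rightarrow> 'a::comm_ring_1 mpoly \<Rightarrow> 'a mpoly" where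
  "class_part e p = (\<Sum>f\<in>{f \<in> keys p. sim f e}. single f (lookup p f))"

lemma lookup_class_part:
  "lookup (class_part e p) f = (if sim f e then lookup p f else 0)"
proof -
  have "lookup (class_part e p) f
      = (\<Sum>g\<in>{g \<in> keys p. sim g e}. if g = f then lookup p g else 0)"
    by (simp add: class_part_def lookup_sum lookup_single when_def)
  then show ?thesis by (simp add: in_keys_iff)
qed

lemma class_part_add: "class_part e (p + q) = class_part e p + class_part e q"
  by (rule poly_mapping_eqI) (simp add: lookup_class_part lookup_add)

lemma class_part_diff: "class_part e (p - q) = class_part e p - class_part e q"
  by (rule poly_mapping_eqI) (simp add: lookup_class_part lookup_minus)

lemma class_part_zero [simp]: "class_part e 0 = 0"
  by (rule poly_mapping_eqI) (simp add: lookup_class_part)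

lemma class_part_single:
  "class_part e (single f c) = (if sim f e then single f c else 0)"
  by (rule poly_mapping_eqI) (auto simp: lookup_class_part lookup_single when_def)

lemma class_part_sum: "class_part e (sum g A) = (\<Sum>x\<in>A. class_part e (g x))"
  by (induction A rule: infinite_finite_induct) (auto simp: class_part_add)

lemma class_part_relation_mult:
  fixes p :: "'a::comm_ring_1 mpoly"
  assumes "sim d 0"
  shows "class_part e (monomial d * p) = monomial d * class_part e p"
proof -
  have "monomial d * single f (lookup p f) = single (d + f) (lookup p f)" for f
    by (simp add: monomial_def mult_single)
  then have "class_part e (monomial d * single f (lookup p f))
      = monomial d * class_part e (single f (lookup p f))" for f
    by (simp add: class_part_single sim_add_relation[OF assms])
  then have "class_part e (monomial d * (\<Sum>f\<in>keys p. single f (lookup p f)))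
    = monomial d * class_part e (\<Sum>f\<in>keys p. single f (lookup p f))"
    by (simp add: sum_distrib_left class_part_sum)
  then show ?thesis by (simp only: poly_mapping_sum_singles)
qed

text \<open>All three monomials of \<open>F\<close> have degree \<open>0\<close>, so multiplication by \<open>F\<close> respects homogeneous components.\<close>

lemma class_part_F_mult: "class_part e (F * p) = F * class_part e (p :: 'a::comm_ring_1 mpoly)"
  by (simp add: trinomial_eq left_diff_distrib distrib_right class_part_diff class_part_add
      class_part_relation_mult sim_U sim_T)

end

context hypersurface_at
begin

lemma homogeneous_element_homog:
  assumes "homogeneous_element k m n a l b"
  obtains p where "homog p" "b = rc p"
  using assms homogeneous_polys_homog by (auto simp: homogeneous_element_def)

text \<open>
  Otherwise some component of \<open>c X\<^sup>e + c' X\<^sup>f - q\<close> is a nonzero multiple of a single monomial. As \<open>F\<close> divides the whole polynomial, it divides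
  each component, but it does not divide a monomial.
\<close>

lemma homogeneous_sum_of_monomials:
  fixes c c' :: "'a::idom"
  assumes eq: "Phi (const c * monomial e + const c' * monomial f) = Phi q" and q: "homog q"
    and nz: "c \<noteq> 0" "c' \<noteq> 0"
  shows "sim e f"
proof (rule ccontr)
  assume ns: "\<not> sim e f"
  let ?r = "const c * monomial e + const c' * monomial f - q"
  obtain g where g: "?r = F * g" using eq by (auto simp: Phi_eq_iff elim: dvdE)
  have part: "class_part d ?r = F * class_part d g" for d
    unfolding g by (rule class_part_F_mult)
  have q0: "class_part d q = 0" if "\<And>d'. d' \<in> keys q \<Longrightarrow> \<not> sim d' d" for d
    by (rule poly_mapping_eqI) (use that in \<open>auto simp: lookup_class_part in_keys_iff\<close>)
  have mono_part: "class_part d (const t * monomial d') = (if sim d' d then const t * monomial d' else 0)"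
    for d d' and t :: 'a
    by (simp add: class_part_single flip: single_const_mono)
  have impossible: "Phi (const t * monomial d) \<noteq> 0" if "t \<noteq> 0" for t :: 'a and d
    using that by (simp add: Phi_mult)
  \<comment> \<open>All of \<open>q\<close> has one degree, so it misses the degree of \<open>e\<close> or that of \<open>f\<close>.\<close>
  have "(\<forall>d\<in>keys q. \<not> sim d e) \<or> (\<forall>d\<in>keys q. \<not> sim d f)"
    using q ns unfolding homog_def by (metis sim_sym sim_trans)
  then show False
  proof
    assume "\<forall>d\<in>keys q. \<not> sim d e"
    then have "class_part e ?r = const c * monomial e"
      using ns q0[of e] by (auto simp: class_part_diff class_part_add mono_part sim_refl dest: sim_sym)
    then show False using impossible[OF nz(1), of e] part[of e] by (metis Phi_eq_0_iff dvd_triv_left)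
  next
    assume "\<forall>d\<in>keys q. \<not> sim d f"
    then have "class_part f ?r = const c' * monomial f"
      using ns q0[of f] by (auto simp: class_part_diff class_part_add mono_part sim_refl)
    then show False using impossible[OF nz(2), of f] part[of f] by (metis Phi_eq_0_iff dvd_triv_left)
  qed
qed

text \<open>
  The exponent vectors of \<open>p\<close> differ by integer combinations of \<open>eU\<close> and \<open>eT\<close>. The greatest common divisor
  \<open>\<mu>\<close> of the monomials is reached by taking the smallest multiple of \<open>eU\<close> for the \<open>x\<close> and \<open>y\<close> exponents and, independently, the smallest multiple of \<open>eT\<close> for the
  \<open>z\<close> exponents. The quotients are products of powers of \<open>U = T + 1\<close> and \<open>T\<close>, hence polynomials in \<open>T\<close>.
\<close>

lemma homog_normal_form:
  fixes p :: "'a::idom mpoly"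
  assumes p: "homog p"
  obtains \<mu> P where "keys \<mu> \<subseteq> V" "\<And>r. coeff P r \<in> range (\<lambda>t. Phi (const t))"
    "Phi p = Phi (monomial \<mu>) * poly P (Phi (monomial eT))"
proof (cases "p = 0")
  case True
  show ?thesis
  proof (rule that[of 0 0])
    show "coeff (0 :: 'a mpoly fract poly) r \<in> range (\<lambda>t. Phi (const t))" for r
      by (rule range_eqI[of _ _ 0]) simp
  qed (use True in simp_all)
next
  case False
  let ?K = "keys p"
  have fin: "finite ?K" "?K \<noteq> {}" using False by auto
  then obtain e0 where e0: "e0 \<in> ?K" by blast
  have "\<forall>e\<in>?K. \<exists>\<alpha> \<beta>. \<forall>v. int (lookup e v) = int (lookup e0 v)
      + \<alpha> * int (lookup eU v) + \<beta> * int (lookup eT v)"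
    using p e0 unfolding homog_def sim_def by blast
  then obtain A B where AB: "\<And>e v. e \<in> ?K \<Longrightarrow> int (lookup e v) = int (lookup e0 v)
      + A e * int (lookup eU v) + B e * int (lookup eT v)"
    by metis
  obtain e1 where e1: "e1 \<in> ?K" "\<And>e. e \<in> ?K \<Longrightarrow> A e1 \<le> A e"
    using ex_is_arg_min_if_finite[OF fin, of A] by (auto simp: is_arg_min_linorder)
  obtain e2 where e2: "e2 \<in> ?K" "\<And>e. e \<in> ?K \<Longrightarrow> B e2 \<le> B e"
    using ex_is_arg_min_if_finite[OF fin, of B] by (auto simp: is_arg_min_linorder)
  define \<mu> where "\<mu> = (\<Sum>v\<in>V. single v
    (if \<exists>s. v = ZVar s then lookup e2 v else lookup e1 v))"
  have KV: "keys e \<subseteq> V" if "e \<in> ?K" for e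
    using that p by (auto simp: homog_def occurring_vars_def)
  have \<mu>: "lookup \<mu> v = (if \<exists>s. v = ZVar s then lookup e2 v else lookup e1 v)" for v
  proof (cases "v \<in> V")
    case True
    then show ?thesis by (simp add: \<mu>_def lookup_sum lookup_single when_def)
  next
    case False
    then have "lookup e1 v = 0" "lookup e2 v = 0"
      using KV[OF e1(1)] KV[OF e2(1)] by (auto simp: in_keys_iff)
    moreover have "lookup \<mu> v = 0"
      using False unfolding \<mu>_def lookup_sum by (intro sum.neutral) (auto simp: lookup_single when_def)
    ultimately show ?thesis by simp
  qed
  have \<mu>V: "keys \<mu> \<subseteq> V"
  proof
    fix v assume "v \<in> keys \<mu>"
    then have "v \<in> keys e1 \<or> v \<in> keys e2"
      by (simp add: in_keys_iff \<mu> split: if_splits)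
    then show "v \<in> V" using KV[OF e1(1)] KV[OF e2(1)] by blast
  qed
  define A' B' where "A' e = nat (A e - A e1)" and "B' e = nat (B e - B e2)" for e
  have eq: "e = \<mu> + (\<Sum>_\<in>{..<A' e}. eU) + (\<Sum>_\<in>{..<B' e}. eT)" if e: "e \<in> ?K" for e
  proof (rule poly_mapping_eqI)
    fix v
    have A': "int (A' e) = A e - A e1" and B': "int (B' e) = B e - B e2"
      using e1(2)[OF e] e2(2)[OF e] by (auto simp: A'_def B'_def)
    have "int (lookup e v) = int (lookup \<mu> v
        + A' e * lookup eU v + B' e * lookup eT v)"
      using AB[OF e, of v] AB[OF e1(1), of v] AB[OF e2(1), of v]
      by (cases v) (simp_all add: \<mu> A' B' algebra_simps)
    then have "lookup e v = lookup \<mu> v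
        + A' e * lookup eU v + B' e * lookup eT v"
      by (simp only: of_nat_eq_iff)
    then show "lookup e v
        = lookup (\<mu> + (\<Sum>_\<in>{..<A' e}. eU) + (\<Sum>_\<in>{..<B' e}. eT)) v"
      by (simp only: lookup_add lookup_sum sum_constant card_lessThan of_nat_id)
  qed
  let ?T = "Phi (monomial eT) :: 'a mpoly fract"
  have mono_eq: "Phi (monomial e) = Phi (monomial \<mu>) * ((?T + 1) ^ A' e * ?T ^ B' e)" if "e \<in> ?K" for e
    by (subst eq[OF that]) (simp add: monomial_add monomial_sum Phi_simps Phi_prod Phi_U)
  define P where "P = (\<Sum>e\<in>?K. smult (Phi (const (lookup p e))) ([:1, 1:] ^ A' e * [:0, 1:] ^ B' e))"
  have "Phi p = (\<Sum>e\<in>?K. Phi (const (lookup p e)) * Phi (monomial e))"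
    by (subst mpoly_sum_monos) (simp add: Phi_sum Phi_mult)
  also have "\<dots> = (\<Sum>e\<in>?K. Phi (const (lookup p e)) * (Phi (monomial \<mu>) * ((?T + 1) ^ A' e * ?T ^ B' e)))"
    by (simp add: mono_eq)
  also have "\<dots> = Phi (monomial \<mu>) * poly P ?T"
    by (simp add: P_def poly_sum sum_distrib_left algebra_simps)
  finally have PhiP: "Phi p = \<dots>" .
  \<comment> \<open>The coefficients stay in the image of the ground field.\<close>
  define C where "C = range (\<lambda>t :: 'a. Phi (const t))"
  have C: "0 \<in> C" "1 \<in> C" "x \<in> C \<Longrightarrow> y \<in> C \<Longrightarrow> x + y \<in> C" "x \<in> C \<Longrightarrow> y \<in> C \<Longrightarrow> x * y \<in> C" for x y
  proof -
    show "0 \<in> C" unfolding C_def by (rule range_eqI[of _ _ 0]) simp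
    show "1 \<in> C" unfolding C_def by (rule range_eqI[of _ _ 1]) simp
    show "x + y \<in> C" if "x \<in> C" "y \<in> C"
      using that unfolding C_def by (auto simp flip: Phi_add const_add)
    show "x * y \<in> C" if "x \<in> C" "y \<in> C"
      using that unfolding C_def by (auto simp flip: Phi_mult const_mult)
  qed
  have Csum: "sum f X \<in> C" if "\<And>x. x \<in> X \<Longrightarrow> f x \<in> C" for f and X :: "'b set"
    using that by (induction X rule: infinite_finite_induct) (auto intro: C)
  define CP where "CP Q \<longleftrightarrow> (\<forall>r. coeff Q r \<in> C)" for Q
  have CPmult: "CP Q \<Longrightarrow> CP Q' \<Longrightarrow> CP (Q * Q')" for Q Q'
    unfolding CP_def coeff_mult by (auto intro!: Csum C)
  have CPpow: "CP Q \<Longrightarrow> CP (Q ^ N)" for Q N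
    by (induction N) (auto intro: CPmult simp: CP_def[of 1] coeff_1 C)
  have "CP [:1, 1:]" "CP [:0, 1:]"
    unfolding CP_def by (auto simp: coeff_pCons C split: nat.splits)
  then have "CP ([:1, 1:] ^ A' e * [:0, 1:] ^ B' e)" for e by (intro CPmult CPpow)
  then have "coeff P r \<in> C" for r
    unfolding P_def coeff_sum coeff_smult by (intro Csum C) (auto simp: CP_def C_def)
  then show ?thesis using that[OF \<mu>V _ PhiP] by (simp add: C_def)
qed

end

section \<open>Classification of the homogeneous locally nilpotent derivations\<close>

text \<open>
  Here \<open>p\<close> and \<open>q\<close> are the degrees of the two moved variables \<open>w\<close> and \<open>z\<close>, which have the exponents \<open>b\<close> in \<open>U\<close> and \<open>N\<close> in
  \<open>T\<close>. The exponent \<open>x\<close> of \<open>z\<close> in the image of \<open>w\<close> is \<open>\<beta> N - 1 > 0\<close>, so \<open>p > q\<close>. A positive exponent \<open>y\<close> of \<open>w\<close> in the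
  image of \<open>z\<close> would give \<open>q > p\<close> in the same way.
\<close>

lemma exponent_arithmetic:
  fixes p q b N x y :: nat and \<alpha> \<beta> :: int
  assumes "p = Suc (x * q)" "q = Suc (y * p)" "b * p = N * q" "N > 1" "b > 0"
    and "0 = int y + 1 + \<alpha> * int b" "int x + 1 = \<beta> * int N"
  shows "b = 1 \<and> \<alpha> = -1 \<and> \<beta> = 1 \<and> y = 0"
proof -
  have "x > 0"
  proof (rule ccontr)
    assume "\<not> x > 0"
    then have "\<beta> * int N = 1" using assms(7) by simp
    then have "int N dvd 1" by (metis dvd_triv_right)
    then show False using assms(4) by simp
  qed
  then have "1 * q \<le> x * q" by (intro mult_le_mono1) simp
  then have pq: "p > q" using assms(1) by linarith
  have y: "y = 0"
  proof (rule ccontr)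
    assume "y \<noteq> 0"
    then have "1 * p \<le> y * p" by (intro mult_le_mono1) simp
    then show False using assms(2) pq by linarith
  qed
  then have "- \<alpha> * int b = 1" using assms(6) by simp
  then have b: "b = 1" by (metis dvd_triv_right int_dvd_int_iff nat_dvd_1_iff_1 of_nat_1)
  then have \<alpha>: "\<alpha> = -1" using \<open>- \<alpha> * int b = 1\<close> by simp
  have "q = 1" using assms(2) y by simp
  then have "N = Suc x" using assms(1,3) b by simp
  then have "int N = int x + 1" by simp
  then have "int N * \<beta> = int N * 1" using assms(7) by (metis mult.commute mult_1_right)
  then have "\<beta> = 1" using assms(4) unfolding mult_cancel_left by simp
  then show ?thesis using b \<alpha> y by simp
qed

locale homogeneous_LND = hypersurface_at +
  fixes D :: "'a::{field, ring_char_0} mpoly fract \<Rightarrow> 'a mpoly fract"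
  assumes kder_D: "kder D" and LND_D: "subring_LND S D" and D_nonzero: "\<exists>f\<in>S. D f \<noteq> 0"
    and D_homogeneous: "keys e \<subseteq> V \<Longrightarrow> \<exists>q. homog q \<and> D (Phi (monomial e)) = Phi q"

sublocale homogeneous_LND \<subseteq> subring_LND S D
  by (rule LND_D)

context homogeneous_LND
begin

abbreviation Xv :: "variable \<Rightarrow> 'a mpoly fract" where "Xv v \<equiv> Phi (var v)"

lemma D_const: "D (Phi (const t)) = 0"
  using kder_D by (simp add: kder_def)

lemma keys_eU_V: "keys eU \<subseteq> V" and keys_eT_V: "keys eT \<subseteq> V"
  using eU_keys eT_keys by auto

lemma Phi_monomial_V:
  "keys e \<subseteq> V \<Longrightarrow> Phi (monomial e) = (\<Prod>v\<in>V. Phi (var v) ^ lookup e v)"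
  by (simp add: monomial_power_product power_product_superset[of V] Phi_prod Phi_power)

lemma ndeg_monomial:
  assumes "keys e \<subseteq> V"
  shows "ndeg (Phi (monomial e)) = (\<Sum>v\<in>V. lookup e v * ndeg (Xv v))"
proof -
  have "ndeg (\<Prod>v\<in>V. Xv v ^ lookup e v) = (\<Sum>v\<in>V. ndeg (Xv v ^ lookup e v))"
    by (rule ndeg_prod) (auto intro: power_in)
  also have "\<dots> = (\<Sum>v\<in>V. lookup e v * ndeg (Xv v))"
    by (rule sum.cong) (auto intro: ndeg_power)
  finally show ?thesis by (simp add: Phi_monomial_V[OF assms])
qed

lemma ndeg_monomial_ge:
  assumes "keys e \<subseteq> V" "v \<in> V"
  shows "lookup e v * ndeg (Xv v) \<le> ndeg (Phi (monomial e))"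
  unfolding ndeg_monomial[OF assms(1)]
  by (rule member_le_sum) (use assms in auto)

lemma D_U_eq_D_T: "D (Phi (monomial eU)) = D (Phi (monomial eT))"
  unfolding Phi_U using keys_eT_V by (simp add: D_add D_one one_in Phi_monomial_in_S)

lemma ndeg_U_eq_ndeg_T: "ndeg (Phi (monomial eU)) = ndeg (Phi (monomial eT))"
proof (cases "D (Phi (monomial eT)) = 0")
  case True
  then show ?thesis
    using D_U_eq_D_T keys_eU_V keys_eT_V by (metis Phi_monomial_in_S ndeg_eq_0_iff)
next
  case False
  then show ?thesis
    using D_U_eq_D_T keys_eU_V keys_eT_V by (metis Phi_monomial_in_S ndeg_D)
qed

lemma ndeg_var_le: 
  assumes "v \<in> V"
  shows "ndeg (Xv v) \<le> ndeg (Phi (monomial eT))"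
proof -
  have "v \<in> keys eU \<or> v \<in> keys eT"
    using assms by (auto simp: eU_keys eT_keys)
  then consider "lookup eU v \<noteq> 0" | "lookup eT v \<noteq> 0" by (auto simp: in_keys_iff)
  then show ?thesis
  proof cases
    case 1
    then have "1 * ndeg (Xv v) \<le> lookup eU v * ndeg (Xv v)" by (intro mult_le_mono1) simp
    also have "\<dots> \<le> ndeg (Phi (monomial eT))"
      using ndeg_monomial_ge[OF keys_eU_V assms] by (simp add: ndeg_U_eq_ndeg_T)
    finally show ?thesis by simp
  next
    case 2
    then have "1 * ndeg (Xv v) \<le> lookup eT v * ndeg (Xv v)" by (intro mult_le_mono1) simp
    also have "\<dots> \<le> ndeg (Phi (monomial eT))"
      using ndeg_monomial_ge[OF keys_eT_V assms] by simp
    finally show ?thesis by simp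
  qed
qed

lemma D_T_nonzero: "D (Phi (monomial eT)) \<noteq> 0"
proof
  assume "D (Phi (monomial eT)) = 0"
  then have "ndeg (Phi (monomial eT)) = 0" using keys_eT_V by (simp add: ndeg_eq_0_iff Phi_monomial_in_S)
  then have "D (Xv v) = 0" if "v \<in> V" for v
    using ndeg_var_le[OF that] that ndeg_eq_0_iff[of "Xv v"] by auto
  moreover have "kder (\<lambda>f :: 'a mpoly fract. 0)"
    by (rule kderI) (auto simp: zero_in)
  ultimately have "D f = 0" if "f \<in> S" for f
    using kder_eqI[OF kder_D, of "\<lambda>_. 0"] that by blast
  then show False using D_nonzero by blast
qed

definition moved :: "variable \<Rightarrow> bool" where
  "moved v \<longleftrightarrow> v \<in> V \<and> D (Xv v) \<noteq> 0"

text \<open>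
  The image of \<open>v\<close> is a monomial times a polynomial in \<open>T\<close>. Its degree is smaller than that of \<open>v\<close>, which is at most the
  degree of \<open>T\<close>; so the polynomial is constant.
\<close>

lemma D_moved:
  assumes "moved v"
  obtains c \<nu> where "c \<noteq> 0" "keys \<nu> \<subseteq> V" "D (Xv v) = Phi (const c * monomial \<nu>)"
    "ndeg (Xv v) = Suc (ndeg (Phi (monomial \<nu>)))"
proof -
  let ?T = "Phi (monomial eT) :: 'a mpoly fract"
  have v: "v \<in> V" "D (Xv v) \<noteq> 0" using assms by (auto simp: moved_def)
  obtain q where "homog q" "D (Xv v) = Phi q"
    using D_homogeneous[of "single v 1"] v by (auto simp: var_monomial)
  then obtain \<mu> P where \<mu>: "keys \<mu> \<subseteq> V" and P: "\<And>r. coeff P r \<in> range (\<lambda>t. Phi (const t))"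
    and eq: "D (Xv v) = Phi (monomial \<mu>) * poly P ?T"
    by (metis homog_normal_form)
  have P_in: "coeff P r \<in> S" "D (coeff P r) = 0" for r
    using P[of r] by (auto simp: D_const)
  have TS: "?T \<in> S" using keys_eT_V by auto
  have "P \<noteq> 0" using eq v by auto
  then have *: "poly P ?T \<noteq> 0 \<and> ndeg (poly P ?T) = degree P * ndeg ?T"
    by (intro ndeg_poly P_in TS D_T_nonzero)
  have "ndeg (D (Xv v)) = ndeg (Phi (monomial \<mu>)) + degree P * ndeg ?T"
    unfolding eq using \<mu> TS P_in * by (simp add: ndeg_mult poly_in Phi_monomial_in_S)
  moreover have "ndeg (Xv v) = Suc (ndeg (D (Xv v)))" using v by (intro ndeg_D) auto
  moreover have "ndeg (Xv v) \<le> ndeg ?T" using v by (intro ndeg_var_le)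
  ultimately have "degree P * ndeg ?T < 1 * ndeg ?T" by linarith
  then have d: "degree P = 0" by (metis less_one mult_less_cancel2)
  then obtain b where b: "P = [:b:]" by (metis degree_eq_zeroE)
  then obtain c where c: "b = Phi (const c)" using P[of 0] by auto
  have "D (Xv v) = Phi (const c * monomial \<mu>)" unfolding eq b c by (simp add: Phi_mult)
  moreover have "c \<noteq> 0" using \<open>P \<noteq> 0\<close> b c by auto
  moreover have "ndeg (Xv v) = Suc (ndeg (Phi (monomial \<mu>)))"
    using \<open>ndeg (D (Xv v)) = _\<close> \<open>ndeg (Xv v) = Suc _\<close> d by simp
  ultimately show ?thesis using that \<mu> by blast
qed

text \<open>A variable of positive degree cannot divide its own derivative, which has smaller degree.\<close>

lemma moved_exponent_zero:
  assumes "moved v" "keys \<nu> \<subseteq> V" "ndeg (Xv v) = Suc (ndeg (Phi (monomial \<nu>)))"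
  shows "lookup \<nu> v = 0"
proof (rule ccontr)
  assume "lookup \<nu> v \<noteq> 0"
  then have "1 * ndeg (Xv v) \<le> lookup \<nu> v * ndeg (Xv v)" by (intro mult_le_mono1) simp
  also have "\<dots> \<le> ndeg (Phi (monomial \<nu>))"
    using assms by (intro ndeg_monomial_ge) (auto simp: moved_def)
  finally show False using assms(3) by simp
qed

text \<open>The derivative of \<open>v w\<close> is a sum of the two monomials in question, and it is homogeneous.\<close>

lemma two_moved_sim:
  assumes "moved v" "moved w" "v \<noteq> w" and nz: "c \<noteq> 0" "c' \<noteq> 0"
    and v: "D (Xv v) = Phi (const c * monomial \<nu>)" and w: "D (Xv w) = Phi (const c' * monomial \<omega>)"
  shows "sim (\<nu> + single w 1) (\<omega> + single v 1)"
proof -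
  have V: "v \<in> V" "w \<in> V" using assms by (auto simp: moved_def)
  obtain q where q: "homog q" "D (Phi (monomial (single v 1 + single w 1))) = Phi q"
    using D_homogeneous[of "single v 1 + single w 1"] V
      keys_add[of "single v (1::nat)" "single w 1"] by auto
  have "D (Phi (monomial (single v 1 + single w 1))) = D (Xv v * Xv w)"
    by (simp only: monomial_add Phi_mult var_monomial)
  also have "\<dots> = Phi (const c * monomial (\<nu> + single w 1)
      + const c' * monomial (\<omega> + single v 1))"
    using V by (simp add: D_mult Phi_var_in_S v w) (simp add: Phi_simps monomial_add var_monomial)
  finally show ?thesis
    using q nz by (intro homogeneous_sum_of_monomials[of c _ c' _ q]) simp_all
qed

text \<open>
  If \<open>v \<noteq> w\<close> both divided \<open>U\<close>, then by \<open>two_moved_sim\<close> some multiple \<open>\<alpha> eU\<close> would have a negative entry at \<open>v\<close> and a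
  positive one at \<open>w\<close>, whereas \<open>eU\<close> is positive at both. The same holds for \<open>T\<close>.
\<close>

lemma moved_unique:
  assumes v: "moved v" and w: "moved w"
    and same: "lookup eU v \<noteq> 0 \<and> lookup eU w \<noteq> 0 \<or> lookup eT v \<noteq> 0 \<and> lookup eT w \<noteq> 0"
  shows "v = w"
proof (rule ccontr)
  assume ne: "v \<noteq> w"
  obtain c \<nu> where c: "c \<noteq> 0" "keys \<nu> \<subseteq> V" "D (Xv v) = Phi (const c * monomial \<nu>)"
    "ndeg (Xv v) = Suc (ndeg (Phi (monomial \<nu>)))" using D_moved[OF v] by metis
  obtain c' \<omega> where c': "c' \<noteq> 0" "keys \<omega> \<subseteq> V" "D (Xv w) = Phi (const c' * monomial \<omega>)"
    "ndeg (Xv w) = Suc (ndeg (Phi (monomial \<omega>)))" using D_moved[OF w] by metis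
  have z: "lookup \<nu> v = 0" "lookup \<omega> w = 0" using moved_exponent_zero v w c c' by blast+
  obtain \<alpha> \<beta> where ab: "\<And>u. int (lookup (\<nu> + single w 1) u)
      = int (lookup (\<omega> + single v 1) u) + \<alpha> * int (lookup eU u) + \<beta> * int (lookup eT u)"
    using two_moved_sim[OF v w ne c(1) c'(1) c(3) c'(3)] unfolding sim_def by blast
  have v_eq: "0 = int (lookup \<omega> v) + 1 + \<alpha> * int (lookup eU v) + \<beta> * int (lookup eT v)"
    and w_eq: "int (lookup \<nu> w) + 1 = \<alpha> * int (lookup eU w) + \<beta> * int (lookup eT w)"
    using ab[of v] ab[of w] ne z by (simp_all add: lookup_add lookup_single when_def)
  have excl: "lookup eU u = 0 \<or> lookup eT u = 0" for u by (cases u) auto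
  have "\<alpha> * int b < 0 \<Longrightarrow> \<alpha> * int b' > 0 \<Longrightarrow> False" for \<alpha> b b'
    by (metis mult_nonneg_nonneg mult_nonpos_nonneg not_less of_nat_0_le_iff linear)
  moreover have "\<exists>\<gamma> b b'. \<gamma> * int b < 0 \<and> \<gamma> * int b' > 0"
    using same
  proof
    assume "lookup eU v \<noteq> 0 \<and> lookup eU w \<noteq> 0"
    then have "lookup eT v = 0" "lookup eT w = 0" using excl[of v] excl[of w] by simp_all
    then have "\<alpha> * int (lookup eU v) < 0 \<and> \<alpha> * int (lookup eU w) > 0"
      using v_eq w_eq by simp
    then show ?thesis by blast
  next
    assume "lookup eT v \<noteq> 0 \<and> lookup eT w \<noteq> 0"
    then have "lookup eU v = 0" "lookup eU w = 0" using excl[of v] excl[of w] by simp_all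
    then have "\<beta> * int (lookup eT v) < 0 \<and> \<beta> * int (lookup eT w) > 0"
      using v_eq w_eq by simp
    then show ?thesis by blast
  qed
  ultimately show False by blast
qed

lemma exists_moved:
  assumes "keys e \<subseteq> V" "D (Phi (monomial e)) \<noteq> 0"
  obtains v where "moved v" "lookup e v \<noteq> 0"
proof -
  have "ndeg (Phi (monomial e)) \<noteq> 0" using assms by (simp add: ndeg_eq_0_iff Phi_monomial_in_S)
  then obtain v where "v \<in> V" "lookup e v * ndeg (Xv v) \<noteq> 0"
    unfolding ndeg_monomial[OF assms(1)] by (meson sum.neutral)
  then have "moved v" "lookup e v \<noteq> 0" using ndeg_eq_0_iff[of "Xv v"] by (auto simp: moved_def)
  then show ?thesis using that by blast
qed

text \<open>
  In terms of the monomials \<open>\<nu>\<close> and \<open>\<omega>\<close> of the images of the moved variables \<open>w\<close> and \<open>z\<close>, \<open>exponent_arithmetic\<close> turns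
  \<open>two_moved_sim\<close> into \<open>\<nu> + z + eU = \<omega> + w + eT\<close>. As \<open>U\<close> and \<open>T\<close> have no variable in common, \<open>U / w\<close> divides \<open>\<omega>\<close> and
  \<open>T / z\<close> divides \<open>\<nu>\<close>, with the same quotient \<open>h\<close>. The scalars are compared by differentiating \<open>U = T + 1\<close>.
\<close>

lemma shape:
  obtains i' j' c h where "i' \<in> {1..k}" "j' \<in> {1..n}" "c \<noteq> 0"
    "keys h \<subseteq> V - {XVar i', ZVar j'}"
    "D (Xv (XVar i')) = Phi (const c * monomial h * (of_nat (l j') * var (ZVar j') ^ (l j' - 1)
        * monomial (eT - single (ZVar j') (l j'))))"
    "D (Xv (ZVar j')) = Phi (const c * monomial h * monomial (eU - single (XVar i') 1))"
    "\<And>v. v \<in> V - {XVar i', ZVar j'} \<Longrightarrow> D (Xv v) = 0"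
proof -
  obtain z where z: "moved z" "lookup eT z \<noteq> 0"
    using exists_moved[OF keys_eT_V] D_T_nonzero by blast
  obtain w where w: "moved w" "lookup eU w \<noteq> 0"
    using exists_moved[OF keys_eU_V] D_T_nonzero D_U_eq_D_T by metis
  have zw: "z \<noteq> w" using z w by (cases z) auto
  have zwV: "z \<in> V" "w \<in> V" using z w by (auto simp: moved_def)
  obtain j' where j': "z = ZVar j'" "j' \<in> {1..n}"
    using z by (cases z) (auto split: if_splits)
  have lj: "l j' > 1" using l_gt j' by blast
  have others: "D (Xv v) = 0" if "v \<in> V" "v \<noteq> z" "v \<noteq> w" for v
  proof (rule ccontr)
    assume "D (Xv v) \<noteq> 0"
    then have "moved v" using that by (simp add: moved_def)
    moreover have "lookup eU v \<noteq> 0 \<or> lookup eT v \<noteq> 0"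
      using \<open>v \<in> V\<close> eU_keys[of v] eT_keys[of v] by (auto simp: in_keys_iff)
    ultimately show False using moved_unique[of v z] moved_unique[of v w] z w that by blast
  qed
  have wt: "ndeg (Phi (monomial e)) = lookup e w * ndeg (Xv w) + lookup e z * ndeg (Xv z)"
    if "keys e \<subseteq> V" for e
  proof -
    have "(\<Sum>v\<in>V. lookup e v * ndeg (Xv v)) = (\<Sum>v\<in>{w, z}. lookup e v * ndeg (Xv v))"
    proof (rule sum.mono_neutral_right)
      show "\<forall>v\<in>V - {w, z}. lookup e v * ndeg (Xv v) = 0"
      proof
        fix v assume "v \<in> V - {w, z}"
        then have "D (Xv v) = 0" "Xv v \<in> S" using others by auto
        then show "lookup e v * ndeg (Xv v) = 0" using ndeg_eq_0_iff by simp
      qed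
    qed (use zwV in auto)
    then show ?thesis using ndeg_monomial[OF that] zw by simp
  qed
  obtain c\<^sub>w \<nu> where \<nu>: "c\<^sub>w \<noteq> 0" "keys \<nu> \<subseteq> V" "D (Xv w) = Phi (const c\<^sub>w * monomial \<nu>)"
    "ndeg (Xv w) = Suc (ndeg (Phi (monomial \<nu>)))" using D_moved[OF w(1)] by metis
  obtain c \<omega> where \<omega>: "c \<noteq> 0" "keys \<omega> \<subseteq> V" "D (Xv z) = Phi (const c * monomial \<omega>)"
    "ndeg (Xv z) = Suc (ndeg (Phi (monomial \<omega>)))" using D_moved[OF z(1)] by metis
  have zero: "lookup \<nu> w = 0" "lookup \<omega> z = 0" using moved_exponent_zero z w \<nu> \<omega> by blast+
  obtain \<alpha> \<beta> where ab: "\<And>u. int (lookup (\<nu> + single z 1) u)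
      = int (lookup (\<omega> + single w 1) u) + \<alpha> * int (lookup eU u) + \<beta> * int (lookup eT u)"
    using two_moved_sim[OF w(1) z(1) zw[symmetric] \<nu>(1) \<omega>(1) \<nu>(3) \<omega>(3)] unfolding sim_def by blast
  have excl: "lookup eU u = 0 \<or> lookup eT u = 0" for u by (cases u) auto
  have w0: "lookup eT w = 0" and z0: "lookup eU z = 0" using excl[of w] excl[of z] z w by auto
  have arith: "lookup eU w = 1 \<and> \<alpha> = -1 \<and> \<beta> = 1 \<and> lookup \<omega> w = 0"
  proof (rule exponent_arithmetic)
    show "ndeg (Xv w) = Suc (lookup \<nu> z * ndeg (Xv z))" using \<nu>(4) wt[OF \<nu>(2)] zero by simp
    show "ndeg (Xv z) = Suc (lookup \<omega> w * ndeg (Xv w))" using \<omega>(4) wt[OF \<omega>(2)] zero by simp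
    show "lookup eU w * ndeg (Xv w) = l j' * ndeg (Xv z)"
      using ndeg_U_eq_ndeg_T wt[OF keys_eU_V] wt[OF keys_eT_V] w0 z0 j' by simp
    show "0 = int (lookup \<omega> w) + 1 + \<alpha> * int (lookup eU w)"
      using ab[of w] zw zero w0 by (simp add: lookup_add lookup_single when_def)
    show "int (lookup \<nu> z) + 1 = \<beta> * int (l j')"
      using ab[of z] zw zero z0 j' by (simp add: lookup_add lookup_single when_def)
  qed (use w lj in auto)
  obtain i' where i': "w = XVar i'" "i' \<in> {1..k}"
  proof (cases w)
    case (XVar r)
    then show ?thesis using that w by (auto split: if_splits)
  next
    case (YVar s)
    then have "s \<in> {1..m}" "a s = 1" using w arith by (auto split: if_splits)
    then show ?thesis using a_gt[of s] by simp
  qed (use w in simp)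
  interpret at': hypersurface_at k m n a l i' j'
    by unfold_locales (use i' j' in auto)
  \<comment> \<open>With \<open>\<alpha> = -1\<close> and \<open>\<beta> = 1\<close> the relation between the exponents holds in the natural numbers.\<close>
  have ptw: "lookup \<nu> u + (if u = z then 1 else 0) + lookup eU u = lookup \<omega> u + (if u = w then 1 else 0) + lookup eT u" for u
    using ab[of u] arith by (auto simp: lookup_add lookup_single when_def split: if_splits)
  define h where "h = \<omega> - at'.eQ"
  have Q: "lookup at'.eQ u = (if u = w then 0 else lookup eU u)" for u
    using arith by (auto simp: at'.eQ_def lookup_minus lookup_single when_def i')
  have R: "lookup at'.eR u = (if u = z then 0 else lookup eT u)" for u
    by (auto simp: at'.eR_def lookup_minus lookup_single when_def j' split: if_splits)
  have \<omega>_eq: "\<omega> = h + at'.eQ"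
  proof (rule poly_mapping_eqI)
    fix u
    have "lookup at'.eQ u \<le> lookup \<omega> u"
      unfolding Q using ptw[of u] excl[of u] z z0 by (auto split: if_splits)
    then show "lookup \<omega> u = lookup (h + at'.eQ) u" by (simp add: h_def lookup_add lookup_minus)
  qed
  have \<nu>_eq: "\<nu> = h + (at'.eR + single z (l j' - 1))"
  proof (rule poly_mapping_eqI)
    fix u
    have \<omega>u: "lookup \<omega> u = lookup h u + (if u = w then 0 else lookup eU u)"
      using arg_cong[OF \<omega>_eq, of "\<lambda>e. lookup e u"] by (simp add: lookup_add Q)
    have "lookup eT z = l j'" using j' by simp
    then show "lookup \<nu> u = lookup (h + (at'.eR + single z (l j' - 1))) u"
      using ptw[of u] \<omega>u zw arith w0 z0 lj
      by (auto simp: lookup_add lookup_single when_def R split: if_splits)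
  qed
  have hV: "keys h \<subseteq> V - {XVar i', ZVar j'}"
  proof
    fix u assume u: "u \<in> keys h"
    then have "lookup \<omega> u \<noteq> 0" "lookup \<nu> u \<noteq> 0"
      using \<omega>_eq \<nu>_eq by (auto simp: lookup_add in_keys_iff)
    then show "u \<in> V - {XVar i', ZVar j'}"
      using zero \<omega>(2) i' j' by (auto simp: in_keys_iff)
  qed
  have QV: "keys at'.eQ \<subseteq> V" "keys at'.eR \<subseteq> V"
    using at'.keys_eQ_W at'.keys_eR_W at'.W_subset by auto
  have kill: "D (Phi (monomial e)) = 0" if "keys e \<subseteq> at'.W" for e
  proof -
    have "D (Xv v) = 0 \<and> Xv v \<in> S" if "v \<in> keys e" for v
      using that \<open>keys e \<subseteq> at'.W\<close> others i' j' by (auto simp: at'.W_def)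
    then show ?thesis
      unfolding Phi_monomial by (intro D_prod_zero power_in D_power_zero) blast+
  qed
  have "D (Phi (monomial eU)) = Phi (monomial at'.eQ) * Phi (const c\<^sub>w * monomial \<nu>)"
    using kill[OF at'.keys_eQ_W] QV zwV i' \<nu>(3) unfolding at'.monomial_eU Phi_mult
    by (subst D_const_mult) (auto simp: Phi_mult)
  moreover have "D (Phi (monomial eT)) = Phi (monomial at'.eR) * (of_nat (l j') * Xv z ^ (l j' - 1)
      * Phi (const c * monomial \<omega>))"
    using kill[OF at'.keys_eR_W] QV zwV j' \<omega>(3) unfolding at'.monomial_eT Phi_mult Phi_power
    by (subst D_const_mult) (auto simp: Phi_mult D_power power_in Phi_var_in_S)
  ultimately have "Phi (monomial at'.eQ) * Phi (const c\<^sub>w * monomial \<nu>)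
      = Phi (monomial at'.eR) * (of_nat (l j') * Xv z ^ (l j' - 1) * Phi (const c * monomial \<omega>))"
    using D_U_eq_D_T by simp
  then have "Phi (monomial at'.eQ) * Phi (monomial h) * Phi (monomial at'.eR) * Xv z ^ (l j' - 1) * Phi (const c\<^sub>w)
      = Phi (monomial at'.eQ) * Phi (monomial h) * Phi (monomial at'.eR) * Xv z ^ (l j' - 1) * (of_nat (l j') * Phi (const c))"
    unfolding \<nu>_eq \<omega>_eq monomial_add monomial_single Phi_mult Phi_power by (simp only: ac_simps)
  then have cw: "Phi (const c\<^sub>w) = of_nat (l j') * Phi (const c)" by simp
  show ?thesis
  proof (rule that[OF i'(2) j'(2) \<omega>(1) hV])
    show "D (Xv (XVar i')) = Phi (const c * monomial h * (of_nat (l j') * var (ZVar j') ^ (l j' - 1)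
        * monomial (eT - single (ZVar j') (l j'))))"
      using \<nu>(3) unfolding \<nu>_eq i'(1) j'(1) Phi_mult cw monomial_add monomial_single at'.eR_def Phi_of_nat
      by (simp only: ac_simps)
    show "D (Xv (ZVar j')) = Phi (const c * monomial h * monomial (eU - single (XVar i') 1))"
      using \<omega>(3) unfolding \<omega>_eq j'(1) at'.eQ_def monomial_add by (simp only: ac_simps)
    show "D (Xv v) = 0" if "v \<in> V - {XVar i', ZVar j'}" for v
      using that others i' j' by auto
  qed
qed

end

section \<open>Maximality\<close>

lemma occurring_const_monomial:
  "c \<noteq> 0 \<Longrightarrow> occurring_vars (const c * monomial e :: 'a::comm_ring_1 mpoly) = keys e"
  by (simp add: occurring_vars_def flip: single_const_mono)

context hypersurface_at
begin

abbreviation times_partial :: "'a::idom mpoly \<Rightarrow> 'a mpoly set \<Rightarrow> 'a mpoly set" where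
  "times_partial h \<equiv> multiple_derivation k m n a l h partial"

lemma times_partial_rc:
  fixes h q :: "'a::{idom, ring_char_0} mpoly"
  assumes "occurring_vars h \<subseteq> V" "occurring_vars q \<subseteq> V"
  shows "times_partial h (rc q) = rc (h * partial_poly q)"
  using assms by (simp add: multiple_derivation_def rc_in_B partial_rc rc_hom occurring_partial_poly)

lemma derivation_times_partial:
  fixes h :: "'a::{idom, ring_char_0} mpoly"
  assumes h: "occurring_vars h \<subseteq> V"
  shows "derivation B \<iota> (times_partial h)"
  unfolding derivation_def
proof (intro conjI ballI allI)
  show "times_partial h \<in> carrier B \<rightarrow>\<^sub>E (carrier B :: 'a mpoly set set)"
  proof (rule PiE_I)
    fix b :: "'a mpoly set" assume "b \<in> carrier B"
    then obtain p where "b = rc p" "occurring_vars p \<subseteq> V" by (rule B_cases)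
    then show "times_partial h b \<in> carrier B"
      by (simp add: h times_partial_rc occurring_vars_closed occurring_partial_poly rc_in_B)
  qed (simp add: multiple_derivation_def)
  fix b c :: "'a mpoly set" assume "b \<in> carrier B" "c \<in> carrier B"
  then obtain p q where b: "b = rc p" "occurring_vars p \<subseteq> V" and c: "c = rc q" "occurring_vars q \<subseteq> V"
    by (auto elim!: B_cases)
  show "times_partial h (b \<oplus>\<^bsub>B\<^esub> c) = times_partial h b \<oplus>\<^bsub>B\<^esub> times_partial h c"
    using b c by (simp add: h times_partial_rc poly_derivation_add occurring_vars_closed
        occurring_partial_poly distrib_left flip: rc_hom)
  show "times_partial h (b \<otimes>\<^bsub>B\<^esub> c) = (times_partial h b \<otimes>\<^bsub>B\<^esub> c) \<oplus>\<^bsub>B\<^esub> (b \<otimes>\<^bsub>B\<^esub> times_partial h c)"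
    using b c by (simp add: h times_partial_rc poly_derivation_mult occurring_vars_closed
        occurring_partial_poly algebra_simps flip: rc_hom)
next
  fix t and b :: "'a mpoly set" assume "b \<in> carrier B"
  then obtain p where b: "b = rc p" "occurring_vars p \<subseteq> V" by (auto elim!: B_cases)
  show "times_partial h (\<iota> t \<otimes>\<^bsub>B\<^esub> b) = \<iota> t \<otimes>\<^bsub>B\<^esub> times_partial h b"
    using b by (simp add: h scalar_def times_partial_rc poly_derivation_mult occurring_vars_closed
        occurring_partial_poly mult_ac flip: rc_hom)
qed

lemma nonzero_rc_iff:
  fixes p :: "'a::idom mpoly"
  shows "occurring_vars p \<subseteq> V \<Longrightarrow> rc p = \<zero>\<^bsub>B\<^esub> \<longleftrightarrow> Phi p = 0"
  using rc_eq_iff[of p 0] by (simp add: rc_zero)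

text \<open>
  The indices \<open>i\<close>, \<open>j\<close> of the context only select the embedding into the fraction field; \<open>i'\<close>, \<open>j'\<close> are those of the
  derivation.
\<close>

lemma homogeneous_LND_classification:
  fixes \<delta> :: "'a::{field, ring_char_0} mpoly set \<Rightarrow> 'a mpoly set"
  assumes nz: "nonzero_LND B \<iota> \<delta>" and hom: "homogeneous_derivation k m n a l \<delta>"
  obtains i' j' c h where "i' \<in> {1..k}" "j' \<in> {1..n}" "c \<noteq> 0"
    "keys h \<subseteq> V - {XVar i', ZVar j'}"
    "\<delta> = multiple_derivation k m n a l (const c * monomial h) (partial_ij k m n a l i' j')"
proof -
  have LND: "LND B \<iota> \<delta>" and der: "derivation B \<iota> \<delta>"
    using nz by (auto simp: nonzero_LND_def LND_def)
  have in_B: "\<delta> b \<in> carrier B" if "b \<in> carrier B" for b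
    using der that by (auto simp: derivation_def)
  interpret homogeneous_LND k m n a l i j "transport \<delta>"
  proof (intro homogeneous_LND.intro homogeneous_LND_axioms.intro)
    show "hypersurface_at k m n a l i j" by (rule hypersurface_at_axioms)
    show "kder (transport \<delta>)" by (rule kder_transport[OF der])
    show "subring_LND S (transport \<delta>)" using LND LND_iff[OF der] by simp
    obtain b where b: "b \<in> carrier B" "\<delta> b \<noteq> \<zero>\<^bsub>B\<^esub>" using nz by (auto simp: nonzero_LND_def)
    then have "transport \<delta> (theta b) \<noteq> 0" using in_B by (simp add: transport_theta theta_eq_0_iff)
    then show "\<exists>f\<in>S. transport \<delta> f \<noteq> 0" using b theta_in_S by blast
    fix e :: "variable \<Rightarrow>\<^sub>0 nat" assume e: "keys e \<subseteq> V"
    have "homogeneous_element k m n a l (rc (monomial e :: 'a mpoly))"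
      using homogeneous_const_monomial[OF e, of "1 :: 'a"] monomial_degree_in_group[OF e]
      unfolding homogeneous_element_def by auto
    then have "homogeneous_element k m n a l (\<delta> (rc (monomial e)))"
      using hom rc_in_B[of "monomial e :: 'a mpoly"] e by (simp add: homogeneous_derivation_def)
    then obtain q where q: "homog q" "\<delta> (rc (monomial e)) = rc q" by (rule homogeneous_element_homog)
    then show "\<exists>q. homog q \<and> transport \<delta> (Phi (monomial e)) = Phi q"
      using e by (intro exI[of _ q]) (simp add: transport_Phi homog_def)
  qed
  obtain i' j' c h where sh: "i' \<in> {1..k}" "j' \<in> {1..n}" "c \<noteq> 0"
    "keys h \<subseteq> V - {XVar i', ZVar j'}"
    "transport \<delta> (Xv (XVar i')) = Phi (const c * monomial h * (of_nat (l j') * var (ZVar j') ^ (l j' - 1)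
        * monomial (eT - single (ZVar j') (l j'))))"
    "transport \<delta> (Xv (ZVar j')) = Phi (const c * monomial h * monomial (eU - single (XVar i') 1))"
    "\<And>v. v \<in> V - {XVar i', ZVar j'} \<Longrightarrow> transport \<delta> (Xv v) = 0"
    using shape by metis
  interpret at': hypersurface_at k m n a l i' j' by unfold_locales (use sh in auto)
  let ?h = "const c * monomial h :: 'a mpoly"
  have hV: "occurring_vars ?h \<subseteq> V" using sh(3,4) by (simp add: occurring_const_monomial) blast
  have "\<delta> = at'.times_partial ?h"
  proof (rule derivation_eqI[OF der at'.derivation_times_partial[OF hV]])
    fix v assume v: "v \<in> V"
    have occ: "occurring_vars (?h * at'.partial_val v) \<subseteq> V"
      using hV at'.occurring_partial_val by (rule occurring_vars_closed)
    have "transport \<delta> (Xv v) = Phi (?h * at'.partial_val v)"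
      using v sh(5,6) sh(7)[of v] by (auto simp: at'.partial_val_def at'.eQ_def at'.eR_def)
    then have "theta (\<delta> (rc (var v))) = theta (rc (?h * at'.partial_val v))"
      using v occ by (simp add: transport_Phi)
    then have "\<delta> (rc (var v)) = rc (?h * at'.partial_val v)"
      using v occ by (intro theta_inject in_B rc_in_B) auto
    then show "\<delta> (rc (var v)) = at'.times_partial ?h (rc (var v))"
      using v hV by (simp add: at'.times_partial_rc)
  qed
  then show ?thesis using that sh by blast
qed

lemma transport_commute:
  fixes D E :: "'a::{idom, ring_char_0} mpoly set \<Rightarrow> 'a mpoly set"
  assumes D: "derivation B \<iota> D" and E: "derivation B \<iota> E"
    and comm: "\<forall>b\<in>carrier B. D (E b) = E (D b)" and f: "f \<in> S"
  shows "transport D (transport E f) = transport E (transport D f)"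
proof -
  have b: "theta_inv f \<in> carrier B" "D (theta_inv f) \<in> carrier B" "E (theta_inv f) \<in> carrier B"
    using D E theta_inv_in_B[OF f] by (auto simp: derivation_def)
  have "transport D (theta (E (theta_inv f))) = transport E (theta (D (theta_inv f)))"
    using b comm by (simp add: transport_theta)
  then show ?thesis by (simp only: transport_def[of _ f])
qed

lemma transport_times_partial:
  fixes h :: "'a::{idom, ring_char_0} mpoly"
  assumes "occurring_vars h \<subseteq> V" "f \<in> S"
  shows "transport (times_partial h) f = Phi h * \<Delta> f"
proof -
  obtain p where "f = Phi p" "occurring_vars p \<subseteq> V" using assms(2) by (rule in_S_cases)
  then show ?thesis
    using assms by (simp add: transport_Phi times_partial_rc partial_rc occurring_vars_closed
        occurring_partial_poly Phi_mult)
qed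

lemma maximal_times_partial:
  fixes c :: "'a::{field, ring_char_0}"
  assumes c: "c \<noteq> 0" and e: "keys e \<subseteq> W"
    and all: "\<And>s. s \<in> {1..n} - {j} \<Longrightarrow> ZVar s \<in> keys e"
    and LND: "LND B \<iota> (times_partial (const c * monomial e))"
  shows "maximal_LND B \<iota> (times_partial (const c * monomial e))"
proof -
  let ?h = "const c * monomial e" and ?\<delta> = "times_partial (const c * monomial e)"
  have hV: "occurring_vars ?h \<subseteq> V"
    using e W_subset c by (simp add: occurring_const_monomial)
  have h0: "Phi ?h \<noteq> 0" using c by (simp add: Phi_mult)
  have der: "derivation B \<iota> ?\<delta>" using hV by (rule derivation_times_partial)
  have zV: "ZVar j \<in> V" using j_in by simp
  have occQ: "occurring_vars (?h * monomial eQ) \<subseteq> V"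
    using hV keys_eQ_W W_subset by (intro occurring_vars_closed hV) auto
  have "?\<delta> (rc (var (ZVar j))) = rc (?h * monomial eQ)"
    using zV hV by (simp add: times_partial_rc)
  moreover have "rc (?h * monomial eQ) \<noteq> \<zero>\<^bsub>B\<^esub>"
    using h0 by (simp add: nonzero_rc_iff[OF occQ] Phi_mult)
  ultimately have nz: "nonzero_LND B \<iota> ?\<delta>"
    using LND zV unfolding nonzero_LND_def by (metis occurring_vars_var rc_in_B singletonD subsetI)
  have "equivalent_LND B E ?\<delta>"
    if E: "nonzero_LND B \<iota> E" and comm: "\<forall>b\<in>carrier B. ?\<delta> (E b) = E (?\<delta> b)" for E
  proof -
    have derE: "derivation B \<iota> E" and LNDE: "LND B \<iota> E"
      using E by (auto simp: nonzero_LND_def LND_def)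
    have E_in: "E b \<in> carrier B" "?\<delta> b \<in> carrier B" if "b \<in> carrier B" for b
      using derE der that by (auto simp: derivation_def)
    obtain b where b: "b \<in> carrier B" "E b \<noteq> \<zero>\<^bsub>B\<^esub>" using E by (auto simp: nonzero_LND_def)
    have kE: "kder (transport E)" by (rule kder_transport[OF derE])
    then have ES: "transport E f \<in> S" if "f \<in> S" for f
      using that by (auto simp: kder_def subring_derivation_def)
    have same: "transport E f = 0 \<longleftrightarrow> \<Delta> f = 0" if f: "f \<in> S" for f
    proof (rule commuting_same_kernel[OF kE _ _ refl c e all _ f])
      show "subring_LND S (transport E)" using LNDE LND_iff[OF derE] by simp
      show "\<exists>f\<in>S. transport E f \<noteq> 0"
        using b E_in by (intro bexI[of _ "theta b"]) (auto simp: transport_theta theta_eq_0_iff theta_in_S)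
      show "Phi ?h * \<Delta> (transport E g) = transport E (Phi ?h * \<Delta> g)" if "g \<in> S" for g
        using transport_commute[OF der derE comm that] transport_times_partial[OF hV] that ES by simp
    qed
    have "E b = \<zero>\<^bsub>B\<^esub> \<longleftrightarrow> ?\<delta> b = \<zero>\<^bsub>B\<^esub>" if "b \<in> carrier B" for b
    proof -
      have "E b = \<zero>\<^bsub>B\<^esub> \<longleftrightarrow> transport E (theta b) = 0"
        using that E_in by (simp add: transport_theta theta_eq_0_iff)
      also have "\<dots> \<longleftrightarrow> transport ?\<delta> (theta b) = 0"
        using that h0 same[of "theta b"] by (simp add: transport_times_partial[OF hV] theta_in_S)
      also have "\<dots> \<longleftrightarrow> ?\<delta> b = \<zero>\<^bsub>B\<^esub>"
        using that E_in by (simp add: transport_theta theta_eq_0_iff)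
      finally show ?thesis .
    qed
    then show ?thesis by (auto simp: equivalent_LND_def a_kernel_def')
  qed
  then show ?thesis using nz by (auto simp: maximal_LND_def)
qed

text \<open>
  Two monomials of the same degree without \<open>x\<^sub>i\<close> and \<open>z\<^sub>j\<close> coincide: a multiple of \<open>eU\<close> in their difference would show up in
  the exponent of \<open>x\<^sub>i\<close>, a multiple of \<open>eT\<close> in that of \<open>z\<^sub>j\<close>.
\<close>

lemma homogeneous_kernel_poly:
  fixes h :: "'a::comm_ring_1 mpoly"
  assumes "h \<noteq> 0" "occurring_vars h \<subseteq> W" "homogeneous_poly k m n a l h"
  obtains c e where "c \<noteq> 0" "keys e \<subseteq> W" "h = const c * monomial e"
    "occurring_vars h = keys e"
proof -
  have hom: "homog h" using assms(3) homogeneous_polys_homog by (auto simp: homogeneous_poly_def)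
  obtain e where e: "e \<in> keys h" using assms(1) by fastforce
  have eq: "f = e" if f: "f \<in> keys h" for f
  proof -
    obtain \<alpha> \<beta> where ab: "\<And>v. int (lookup f v) = int (lookup e v)
        + \<alpha> * int (lookup eU v) + \<beta> * int (lookup eT v)"
      using hom e f unfolding homog_def sim_def by blast
    have "lookup g (XVar i) = 0 \<and> lookup g (ZVar j) = 0"
      if "g \<in> keys h" for g
      using keys_subset_occurring[OF that] assms(2) by (auto simp: W_def in_keys_iff)
    then have "\<alpha> = 0" "\<beta> = 0"
      using ab[of "XVar i"] ab[of "ZVar j"] e f i_in j_in l_gt[OF j_in] by simp_all
    then show ?thesis using ab by (intro poly_mapping_eqI) simp
  qed
  then have "keys h = {e}" using e by blast
  then have h: "h = const (lookup h e) * monomial e"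
    using mpoly_sum_monos[of h] by simp
  have c: "lookup h e \<noteq> 0" using e by (simp add: in_keys_iff)
  then have "occurring_vars h = keys e" by (subst h) (rule occurring_const_monomial)
  then show ?thesis using that c h assms(2) by blast
qed

text \<open>
  The image lies in the ideal generated by \<open>z\<^sub>s\<close>. This ideal is proper, because \<open>z\<^sub>s\<close> vanishes at the point of the
  hypersurface with all \<open>x\<close> and \<open>y\<close> equal to \<open>1\<close> and all \<open>z\<close> equal to \<open>0\<close>.
\<close>

lemma z_multiple_not_irreducible:
  fixes h :: "'a::{idom, ring_char_0} mpoly"
  assumes s: "s \<in> {1..n}" and h: "h = var (ZVar s) * g" "occurring_vars g \<subseteq> V"
  shows "\<not> irreducible_LND B \<iota> (times_partial h)"
proof
  assume irr: "irreducible_LND B \<iota> (times_partial h)"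
  interpret B: cring "B :: 'a mpoly set ring" by (rule cring_B)
  let ?z = "var (ZVar s) :: 'a mpoly"
  have zV: "occurring_vars ?z \<subseteq> V" using s by simp
  have hV: "occurring_vars h \<subseteq> V" unfolding h(1) using zV h(2) by (rule occurring_vars_closed)
  have "principalideal (PIdl\<^bsub>B\<^esub> (rc ?z)) B" by (rule B.cgenideal_is_principalideal) (use zV in auto)
  moreover have "times_partial h ` carrier B \<subseteq> PIdl\<^bsub>B\<^esub> (rc ?z)"
  proof
    fix c assume "c \<in> times_partial h ` carrier B"
    then obtain p where p: "c = times_partial h (rc p)" "occurring_vars p \<subseteq> V" by (auto elim!: B_cases)
    have occ: "occurring_vars (g * partial_poly p) \<subseteq> V"
      using h(2) occurring_partial_poly[OF p(2)] by (rule occurring_vars_closed)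
    have "h * partial_poly p = (g * partial_poly p) * ?z" unfolding h(1) by (simp only: mult_ac)
    then have "c = rc ((g * partial_poly p) * ?z)"
      unfolding p(1) times_partial_rc[OF hV p(2)] by (simp only:)
    then have "c = rc (g * partial_poly p) \<otimes>\<^bsub>B\<^esub> rc ?z" using occ zV by (simp add: rc_hom)
    then show "c \<in> PIdl\<^bsub>B\<^esub> (rc ?z)" using occ by (auto simp: cgenideal_def)
  qed
  moreover have "PIdl\<^bsub>B\<^esub> (rc ?z) \<noteq> carrier B"
  proof
    assume "PIdl\<^bsub>B\<^esub> (rc ?z) = carrier B"
    then have "\<one>\<^bsub>B\<^esub> \<in> PIdl\<^bsub>B\<^esub> (rc ?z)" using B.one_closed by simp
    then obtain p where p: "rc 1 = rc p \<otimes>\<^bsub>B\<^esub> rc ?z" "occurring_vars p \<subseteq> V"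
      by (auto simp: cgenideal_def rc_one elim!: B_cases)
    then have "rc 1 = rc (p * ?z)" using zV by (simp add: rc_hom)
    then have "Phi 1 = Phi (p * ?z)" using p(2) zV by (subst (asm) rc_eq_iff) (simp_all add: occurring_vars_closed)
    then obtain q where q: "1 - p * ?z = F * q" unfolding Phi_eq_iff by (elim dvdE)
    \<comment> \<open>evaluation at the point \<open>x = y = 1\<close>, \<open>z = 0\<close> of the hypersurface\<close>
    define x where "x v = (if \<exists>r. v = ZVar r then 0 else 1 :: 'a mpoly)" for v
    let ?ev = "subst.eval x"
    have "?ev (monomial eU) = 1"
      unfolding subst.eval_monomial power_product_def
      by (rule prod.neutral) (auto simp: eU_keys x_def)
    moreover have "?ev (monomial eT) = 0"
      unfolding subst.eval_monomial power_product_def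
      by (rule prod_zero)
        (use j_in l_gt[OF j_in] in \<open>auto simp: x_def eT_keys intro!: bexI[of _ "ZVar j"]\<close>)
    ultimately have "?ev F = 0" by (simp add: trinomial_eq subst.eval_simps)
    then have "?ev (1 - p * ?z) = 0" unfolding q by (simp add: subst.eval_mult)
    then show False by (simp add: subst.eval_simps x_def)
  qed
  ultimately show False using irr by (auto simp: irreducible_LND_def)
qed

end

context hypersurface
begin

text \<open>
  It suffices to compare the values on the variables. Applied to \<open>x\<^sub>i\<close>, both compositions give
  \<open>l\<^sub>j l\<^sub>s Q T / (z\<^sub>j z\<^sub>s)\<close>; all other variables are sent to \<open>0\<close>.
\<close>

lemma partials_commute:
  fixes q :: "'a::comm_ring_1 mpoly"
  assumes i: "i \<in> {1..k}" and j: "j \<in> {1..n}" and s: "s \<in> {1..n}" "s \<noteq> j"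
  shows "poly_derivation (hypersurface_at.partial_val k m n a l i j)
      (poly_derivation (hypersurface_at.partial_val k m n a l i s) q)
    = poly_derivation (hypersurface_at.partial_val k m n a l i s)
      (poly_derivation (hypersurface_at.partial_val k m n a l i j) q)"
proof -
  interpret A: hypersurface_at k m n a l i j by unfold_locales (use i j in auto)
  interpret C: hypersurface_at k m n a l i s by unfold_locales (use i s in auto)
  \<comment> \<open>\<open>e\<close> is the part of \<open>T\<close> without \<open>z\<^sub>j\<close> and \<open>z\<^sub>s\<close>.\<close>
  define e where "e = eT - single (ZVar j) (l j) - single (ZVar s) (l s)"
  have AR: "A.eR = e + single (ZVar s) (l s)"
    using j s by (intro poly_mapping_eqI)
      (auto simp: A.eR_def e_def lookup_add lookup_minus lookup_single when_def)
  have CR: "C.eR = e + single (ZVar j) (l j)"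
    using j s by (intro poly_mapping_eqI)
      (auto simp: C.eR_def e_def lookup_add lookup_minus lookup_single when_def)
  have "keys e \<subseteq> A.W \<inter> C.W"
  proof
    fix v assume "v \<in> keys e"
    then have "lookup e v \<noteq> 0" by (simp add: in_keys_iff)
    then show "v \<in> A.W \<inter> C.W"
      by (cases v) (auto simp: e_def lookup_minus lookup_single when_def A.W_def C.W_def split: if_splits)
  qed
  then have e0: "A.partial_poly (monomial e :: 'a mpoly) = 0" "C.partial_poly (monomial e :: 'a mpoly) = 0"
    by (auto intro!: A.partial_poly_W C.partial_poly_W)
  have val: "A.partial_val (ZVar s) = (0 :: 'a mpoly)" "C.partial_val (ZVar j) = (0 :: 'a mpoly)"
    using i j s by (auto simp: A.partial_val_def C.partial_val_def)
  have zero: "poly_derivation x 0 = 0" for x :: "variable \<Rightarrow> 'a mpoly"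
    using poly_derivation_const[of x 0] by simp
  have gen: "A.partial_poly (C.partial_val v) = C.partial_poly (A.partial_val v :: 'a mpoly)" for v
  proof (cases "v = XVar i")
    case True
    let ?r = "of_nat (l s) * var (ZVar s) ^ (l s - 1) * (of_nat (l j) * var (ZVar j) ^ (l j - 1))
      * (monomial e * monomial A.eQ) :: 'a mpoly"
    have "A.partial_poly (C.partial_val v) = ?r"
      unfolding True C.partial_val_simps(1) CR monomial_add monomial_single poly_derivation_mult
        poly_derivation_power poly_derivation_of_nat poly_derivation_var A.partial_val_simps(2) e0 val
      by (simp only: mult_zero_left mult_zero_right add_0_left add_0_right mult_ac)
    moreover have "C.partial_poly (A.partial_val v) = ?r"
      unfolding True A.partial_val_simps(1) AR monomial_add monomial_single poly_derivation_mult
        poly_derivation_power poly_derivation_of_nat poly_derivation_var C.partial_val_simps(2) e0 val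
      by (simp only: mult_zero_left mult_zero_right add_0_left add_0_right mult_ac)
    ultimately show ?thesis by simp
  next
    case False
    have "C.partial_poly (monomial A.eQ :: 'a mpoly) = 0" by (rule C.partial_poly_Q)
    then show ?thesis using False
      by (simp add: A.partial_val_def C.partial_val_def zero)
  qed
  show ?thesis by (rule poly_derivation_commute) (rule gen)
qed

text \<open>
  The derivation \<open>\<partial>\<^sub>i\<^sub>s\<close> commutes with \<open>\<partial>\<^sub>i\<^sub>j\<close> and kills \<open>h\<close>, as \<open>h\<close> contains neither \<open>x\<^sub>i\<close> nor \<open>z\<^sub>s\<close>. But \<open>\<partial>\<^sub>i\<^sub>j\<close> kills
  \<open>z\<^sub>s\<close>, and \<open>\<partial>\<^sub>i\<^sub>s\<close> does not.
\<close>

lemma missing_z_not_maximal: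
  fixes c :: "'a::{idom, ring_char_0}"
  assumes i: "i \<in> {1..k}" and j: "j \<in> {1..n}" and s: "s \<in> {1..n}" "s \<noteq> j"
    and e: "keys e \<subseteq> V - {XVar i, ZVar j}" "ZVar s \<notin> keys e"
  shows "\<not> maximal_LND (coordinate_ring k m n a l) (scalar k m n a l)
    (multiple_derivation k m n a l (const c * monomial e) (partial_ij k m n a l i j))"
proof -
  interpret A: hypersurface_at k m n a l i j by unfold_locales (use i j in auto)
  interpret C: hypersurface_at k m n a l i s by unfold_locales (use i s in auto)
  let ?B = "coordinate_ring k m n a l :: 'a mpoly set ring"
  let ?h = "const c * monomial e" and ?\<delta> = "A.times_partial (const c * monomial e)" and ?E = "C.partial :: 'a mpoly set \<Rightarrow> _"
  have hV: "occurring_vars ?h \<subseteq> V" and hC: "occurring_vars ?h \<subseteq> C.W"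
    using e by (intro occurring_vars_closed; auto simp: C.W_def)+
  have zV: "occurring_vars (var (ZVar s) :: 'a mpoly) \<subseteq> V" using s by simp
  have "LND ?B A.\<iota> ?E" using C.LND_iff[OF C.derivation_partial] C.LND_\<Delta> by blast
  moreover have Ez: "?E (C.rc (var (ZVar s))) \<noteq> \<zero>\<^bsub>?B\<^esub>"
  proof -
    have "occurring_vars (monomial C.eQ :: 'a mpoly) \<subseteq> V" using C.keys_eQ_W C.W_subset by simp
    then show ?thesis using zV by (simp add: C.partial_rc C.nonzero_rc_iff)
  qed
  ultimately have nz: "nonzero_LND ?B A.\<iota> ?E"
    using zV unfolding nonzero_LND_def by blast
  have comm: "?\<delta> (?E b) = ?E (?\<delta> b)" if b: "b \<in> carrier ?B" for b
  proof -
    obtain q where q: "b = A.rc q" "occurring_vars q \<subseteq> V" using b by (rule A.B_cases)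
    have "?\<delta> (?E b) = A.rc (?h * A.partial_poly (C.partial_poly q))"
      using q hV by (simp add: C.partial_rc A.times_partial_rc C.occurring_partial_poly)
    also have "A.partial_poly (C.partial_poly q) = C.partial_poly (A.partial_poly q)"
      by (rule partials_commute[OF i j s])
    also have "?h * C.partial_poly (A.partial_poly q) = C.partial_poly (?h * A.partial_poly q)"
      using C.partial_poly_W[OF hC] by (simp only: poly_derivation_mult mult_zero_left add_0)
    also have "A.rc \<dots> = ?E (?\<delta> b)"
      using q hV by (simp add: C.partial_rc A.times_partial_rc A.occurring_partial_poly occurring_vars_closed)
    finally show ?thesis .
  qed
  have "?\<delta> (A.rc (var (ZVar s))) = \<zero>\<^bsub>?B\<^esub>"
  proof -
    have "A.partial_val (ZVar s) = (0 :: 'a mpoly)" using s by (auto simp: A.partial_val_def)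
    then show ?thesis using zV hV by (simp add: A.times_partial_rc A.rc_zero)
  qed
  then have "\<not> equivalent_LND ?B ?E ?\<delta>"
    using Ez A.rc_in_B[OF zV] unfolding equivalent_LND_def a_kernel_def' by blast
  then show ?thesis using nz comm unfolding maximal_LND_def by blast
qed

end

theorem lemma9p2:
  fixes k m n :: nat and a l :: "nat \<Rightarrow> nat"
    and B :: "'a::{alg_closed_field, field_char_0} mpoly set ring"
    and \<iota> :: "'a \<Rightarrow> 'a mpoly set"
  assumes "k \<ge> 1" and "n \<ge> 2"
    and "\<forall>s\<in>{1..m}. a s > 1"
    and "\<forall>j\<in>{1..n}. l j > 1"
    and "B = coordinate_ring k m n a l"
    and "\<iota> = scalar k m n a l"
  shows "(\<forall>\<delta>. irreducible_LND B \<iota> \<delta> \<and> homogeneous_derivation k m n a l \<delta>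
              \<longrightarrow> \<not> maximal_LND B \<iota> \<delta>)
       \<and> (\<forall>\<delta>. LND B \<iota> \<delta> \<and> homogeneous_derivation k m n a l \<delta> \<longrightarrow>
            (maximal_LND B \<iota> \<delta> \<longleftrightarrow>
               (\<exists>i\<in>{1..k}. \<exists>j\<in>{1..n}. \<exists>h.
                  h \<noteq> 0 \<and>
                  occurring_vars h \<subseteq> variables k m n - {XVar i, ZVar j} \<and>
                  homogeneous_poly k m n a l h \<and>
                  (\<forall>s\<in>{1..n} - {j}. ZVar s \<in> occurring_vars h) \<and>
                  \<delta> = multiple_derivation k m n a l h (partial_ij k m n a l i j))))"
proof -
  interpret H: hypersurface k m n a l by unfold_locales (use assms in auto)
  note B = assms(5) and \<iota> = assms(6)
  have max: "\<exists>i\<in>{1..k}. \<exists>j\<in>{1..n}. \<exists>c e. c \<noteq> 0 \<and> keys e \<subseteq> H.V - {XVar i, ZVar j}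
      \<and> (\<forall>s\<in>{1..n} - {j}. ZVar s \<in> keys e)
      \<and> \<delta> = multiple_derivation k m n a l (const c * monomial e) (partial_ij k m n a l i j)"
    if m: "maximal_LND B \<iota> \<delta>" and hom: "homogeneous_derivation k m n a l \<delta>"
    for \<delta> :: "'a mpoly set \<Rightarrow> 'a mpoly set"
  proof -
    interpret A: hypersurface_at k m n a l 1 1 by unfold_locales (use assms in auto)
    have nz: "nonzero_LND A.B A.\<iota> \<delta>" using m by (simp add: maximal_LND_def B \<iota>)
    obtain i j c e where *: "i \<in> {1..k}" "j \<in> {1..n}" "c \<noteq> 0"
      "keys e \<subseteq> H.V - {XVar i, ZVar j}"
      "\<delta> = multiple_derivation k m n a l (const c * monomial e) (partial_ij k m n a l i j)"
      by (rule A.homogeneous_LND_classification[OF nz hom])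
    moreover have "ZVar s \<in> keys e" if "s \<in> {1..n} - {j}" for s
      using H.missing_z_not_maximal[OF *(1,2) _ _ *(4), of s c] that m *(5) by (auto simp: B \<iota>)
    ultimately show ?thesis by blast
  qed
  show ?thesis
  proof (intro conjI allI impI notI iffI; (elim conjE)?)
    fix \<delta> :: "'a mpoly set \<Rightarrow> 'a mpoly set"
    assume irr: "irreducible_LND B \<iota> \<delta>" and hom: "homogeneous_derivation k m n a l \<delta>"
      and m: "maximal_LND B \<iota> \<delta>"
    obtain i j c e where *: "i \<in> {1..k}" "j \<in> {1..n}" "c \<noteq> 0"
      "keys e \<subseteq> H.V - {XVar i, ZVar j}" "\<forall>s\<in>{1..n} - {j}. ZVar s \<in> keys e"
      "\<delta> = multiple_derivation k m n a l (const c * monomial e) (partial_ij k m n a l i j)"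
      using max[OF m hom] by blast
    interpret A: hypersurface_at k m n a l i j by unfold_locales (use * in auto)
    define s where "s = (if j = 1 then 2 else 1 :: nat)"
    have s: "s \<in> {1..n}" "s \<noteq> j" using assms(2) by (auto simp: s_def)
    then have zs: "ZVar s \<in> keys e" using * by blast
    define f where "f = e - single (ZVar s) 1"
    have e_eq: "e = single (ZVar s) 1 + f"
      using zs by (intro poly_mapping_eqI)
        (auto simp: f_def lookup_add lookup_minus lookup_single when_def in_keys_iff)
    have "keys f \<subseteq> keys e"
      by (auto simp: f_def in_keys_iff lookup_minus)
    then have fV: "occurring_vars (const c * monomial f) \<subseteq> H.V"
      using * by (simp add: occurring_const_monomial) blast
    have h: "const c * monomial e = var (ZVar s) * (const c * monomial f)"
      by (subst e_eq) (simp add: monomial_add var_monomial mult_ac)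
    then show False
      using A.z_multiple_not_irreducible[OF s(1) h fV] irr *(6) by (simp only: B \<iota>)
  next
    fix \<delta> :: "'a mpoly set \<Rightarrow> 'a mpoly set"
    assume hom: "homogeneous_derivation k m n a l \<delta>" and m: "maximal_LND B \<iota> \<delta>"
    obtain i j c e where *: "i \<in> {1..k}" "j \<in> {1..n}" "c \<noteq> 0"
      "keys e \<subseteq> H.V - {XVar i, ZVar j}" "\<forall>s\<in>{1..n} - {j}. ZVar s \<in> keys e"
      "\<delta> = multiple_derivation k m n a l (const c * monomial e) (partial_ij k m n a l i j)"
      using max[OF m hom] by blast
    let ?h = "const c * monomial e"
    have occ: "occurring_vars ?h = keys e" using *(3) by (rule occurring_const_monomial)
    have "homogeneous_poly k m n a l ?h"
      unfolding homogeneous_poly_def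
      using H.homogeneous_const_monomial[of e c] H.monomial_degree_in_group[of e] *(4) by blast
    moreover have "?h \<noteq> 0" using *(3) by simp
    ultimately show "\<exists>i\<in>{1..k}. \<exists>j\<in>{1..n}. \<exists>h. h \<noteq> 0 \<and>
        occurring_vars h \<subseteq> variables k m n - {XVar i, ZVar j} \<and> homogeneous_poly k m n a l h \<and>
        (\<forall>s\<in>{1..n} - {j}. ZVar s \<in> occurring_vars h) \<and>
        \<delta> = multiple_derivation k m n a l h (partial_ij k m n a l i j)"
      using * occ by (intro bexI[of _ i] bexI[of _ j] exI[of _ ?h]) auto
  next
    fix \<delta> :: "'a mpoly set \<Rightarrow> 'a mpoly set"
    assume LND: "LND B \<iota> \<delta>"
      and "\<exists>i\<in>{1..k}. \<exists>j\<in>{1..n}. \<exists>h. h \<noteq> 0 \<and>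
        occurring_vars h \<subseteq> variables k m n - {XVar i, ZVar j} \<and> homogeneous_poly k m n a l h \<and>
        (\<forall>s\<in>{1..n} - {j}. ZVar s \<in> occurring_vars h) \<and>
        \<delta> = multiple_derivation k m n a l h (partial_ij k m n a l i j)"
    then obtain i j h where *: "i \<in> {1..k}" "j \<in> {1..n}" "h \<noteq> 0"
      "occurring_vars h \<subseteq> variables k m n - {XVar i, ZVar j}" "homogeneous_poly k m n a l h"
      "\<forall>s\<in>{1..n} - {j}. ZVar s \<in> occurring_vars h"
      "\<delta> = multiple_derivation k m n a l h (partial_ij k m n a l i j)" by blast
    interpret A: hypersurface_at k m n a l i j by unfold_locales (use * in auto)
    obtain c e where h: "c \<noteq> 0" "keys e \<subseteq> A.W" "h = const c * monomial e"
      "occurring_vars h = keys e"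
      using A.homogeneous_kernel_poly[of h] * by (auto simp: A.W_def)
    have "maximal_LND A.B A.\<iota> (A.times_partial (const c * monomial e))"
    proof (rule A.maximal_times_partial[OF h(1,2)])
      show "ZVar s \<in> keys e" if "s \<in> {1..n} - {j}" for s
        using that *(6) h(4) by blast
      show "LND A.B A.\<iota> (A.times_partial (const c * monomial e))"
        using LND *(7) h(3) by (simp add: B \<iota>)
    qed
    then show "maximal_LND B \<iota> \<delta>" using *(7) h(3) by (simp add: B \<iota>)
  qed
qed

end
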